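(* Let $C>0$ and $\Delta\in\mathbb{N}$ and let $p(\cdot)$ be a bounded induced graph counting polynomial. Then there is a deterministic $(n/\varepsilon)^{O(1)}$-time algorithm which, given any $n$-vertex graph $G$ of maximum degree at most $\Delta$ and any $\varepsilon>0$, computes the inverse power sums $p_1,\ldots,p_m$ of $p(G)$ for $m=C\ln(n/\varepsilon)$ (i.e. $p_j$ for all integers $1\le j\le m$).
   Context: Let $\mathcal{G}$ be the collection of all finite graphs (considered up to isomorphism), and $\mathcal{G}_k$ the collection of those with at most $k$ vertices. For graphs $H,G$, $\mathrm{ind}(H,G)$ is the number of sets $S\subseteq V(G)$ such that the induced subgraph $G[S]$ is isomorphic to $H$; for $H$ the empty graph, $\mathrm{ind}(H,G)=1$. A graph invariant is a function on $\mathcal{G}$ taking the same value on isomorphic graphs; a graph polynomial is a graph invariant $p:\mathcal{G}\to\mathbb{C}[z]$. A graph invariant $f$ is multiplicative if $f(\emptyset)=1$ and $f(G_1\cup G_2)=f(G_1)f(G_2)$ for all graphs $G_1,G_2$, where $G_1\cup G_2$ denotes disjoint union. A bounded induced graph counting polynomial (BIGCP) is a multiplicative graph polynomial $p(G)(z)=\sum_{i=0}^{d(G)}e_i(G)z^i$ with $e_0(G)=1$ for every $G\in\mathcal{G}$ (and $e_i(G)=0$ for $i>d(G)$), for which there exist constants $\alpha,\beta\in\mathbb{N}$ such that: (i) for every graph $G$ the coefficients satisfy $e_i(G)=\sum_{H\in\mathcal{G}_{\alpha i}}\lambda_{H,i}\,\mathrm{ind}(H,G)$ for certain $\lambda_{H,i}\in\mathbb{C}$;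 (ii) for each $H\in\mathcal{G}_{\alpha i}$, the coefficient $\lambda_{H,i}$ can be computed in time $O(\beta^{|V(H)|})$. The algorithm accesses $p$ only via the algorithm of (ii) computing the numbers $\lambda_{H,i}$. If $\zeta_1,\ldots,\zeta_d\in\mathbb{C}$ are the roots (with multiplicity) of $p(G)$, its $j$th inverse power sum is $p_j:=\zeta_1^{-j}+\cdots+\zeta_d^{-j}$. The running time is an asymptotic bound; the constant implicit in the exponent $O(1)$ may depend on the fixed data $C$, $\Delta$ and $p$ (including $\alpha,\beta$), but not on $G$ or $\varepsilon$.
   Formalization: The running time is shown to be polynomial in max(n,1)/min(ε,1); this equals n/ε for ε ≤ 1 and n ≥ 1, while for ε > 1 the bound is polynomial in n, because the literal bound (n/ε)^{O(1)} fails there (e.g. ε = n/e). *)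

theory Defs
  imports Complex_Main "HOL-Computational_Algebra.Polynomial"
begin

section \<open>Finite simple graphs\<close>

text \<open>Vertices are natural numbers; every finite graph is isomorphic to such a graph.\<close>

record graph =
  verts :: "nat set"
  edges :: "nat set set"

definition fin_graph :: "graph \<Rightarrow> bool" where
  "fin_graph G \<longleftrightarrow> finite (verts G) \<and> (\<forall>e\<in>edges G. e \<subseteq> verts G \<and> card e = 2)"

definition isomorphic :: "graph \<Rightarrow> graph \<Rightarrow> bool" where
  "isomorphic G H \<longleftrightarrow>
     (\<exists>f. bij_betw f (verts G) (verts H) \<and> edges H = (\<lambda>e. f ` e) ` edges G)"

definition induced :: "graph \<Rightarrow> nat set \<Rightarrow> graph" where
  "induced G S = \<lparr>verts = S, edges = {e \<in> edges G. e \<subseteq> S}\<rparr>"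

definition ind :: "graph \<Rightarrow> graph \<Rightarrow> nat" where
  "ind H G = card {S. S \<subseteq> verts G \<and> isomorphic (induced G S) H}"

definition empty_graph :: graph where
  "empty_graph = \<lparr>verts = {}, edges = {}\<rparr>"

definition graph_union :: "graph \<Rightarrow> graph \<Rightarrow> graph" where
  "graph_union G H = \<lparr>verts = verts G \<union> verts H, edges = edges G \<union> edges H\<rparr>"

definition max_degree_le :: "graph \<Rightarrow> nat \<Rightarrow> bool" where
  "max_degree_le G \<Delta> \<longleftrightarrow> (\<forall>v\<in>verts G. card {u \<in> verts G. {u, v} \<in> edges G} \<le> \<Delta>)"

definition graph_invariant :: "(graph \<Rightarrow> 'a) \<Rightarrow> bool" where
  "graph_invariant f \<longleftrightarrow>
     (\<forall>G H. fin_graph G \<longrightarrow> fin_graph H \<longrightarrow> isomorphic G H \<longrightarrow> f G = f H)"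

definition multiplicative :: "(graph \<Rightarrow> 'a::monoid_mult) \<Rightarrow> bool" where
  "multiplicative f \<longleftrightarrow> f empty_graph = 1 \<and>
     (\<forall>G H. fin_graph G \<longrightarrow> fin_graph H \<longrightarrow> verts G \<inter> verts H = {} \<longrightarrow>
        f (graph_union G H) = f G * f H)"

definition graphs_upto :: "nat \<Rightarrow> graph set" where
  "graphs_upto k = {H. fin_graph H \<and> card (verts H) \<le> k}"

definition iso_rel :: "(graph \<times> graph) set" where
  "iso_rel = {(G, H). fin_graph G \<and> fin_graph H \<and> isomorphic G H}"

text \<open>One graph from each isomorphism class of graphs with at most \<open>k\<close> vertices; sums over
  this set are only taken of isomorphism invariant terms.\<close>

definition iso_reps :: "nat \<Rightarrow> graph set" where
  "iso_reps k = (\<lambda>X. SOME H. H \<in> X) ` (graphs_upto k // iso_rel)"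

lemma isomorphic_initial_segment:
  assumes "fin_graph H"
  obtains H' where "verts H' = {..<card (verts H)}" "fin_graph H'" "isomorphic H H'"
proof -
  have fin: "finite (verts H)" using assms by (simp add: fin_graph_def)
  obtain f where f: "bij_betw f (verts H) {..<card (verts H)}"
    using ex_bij_betw_finite_nat[OF fin] by (auto simp: atLeast0LessThan)
  define H' where "H' = \<lparr>verts = {..<card (verts H)}, edges = (\<lambda>e. f ` e) ` edges H\<rparr>"
  have "f ` e \<subseteq> {..<card (verts H)} \<and> card (f ` e) = 2" if "e \<in> edges H" for e
  proof -
    have e: "e \<subseteq> verts H" "card e = 2" using assms that by (auto simp: fin_graph_def)
    have "inj_on f e" using f e(1) by (meson bij_betw_def inj_on_subset)
    then show ?thesis using e f by (auto simp: card_image bij_betw_def)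
  qed
  then have "fin_graph H'" by (auto simp: fin_graph_def H'_def)
  moreover have "isomorphic H H'" using f by (auto simp: isomorphic_def H'_def)
  ultimately show thesis using that[of H'] by (simp add: H'_def)
qed

lemma isomorphic_sym:
  assumes "fin_graph G" "isomorphic G H"
  shows "isomorphic H G"
proof -
  obtain f where f: "bij_betw f (verts G) (verts H)" "edges H = (\<lambda>e. f ` e) ` edges G"
    using assms(2) by (auto simp: isomorphic_def)
  let ?g = "inv_into (verts G) f"
  have "?g ` f ` e = e" if "e \<in> edges G" for e
    using that assms(1) f(1)
    by (meson bij_betw_imp_inj_on fin_graph_def inv_into_image_cancel)
  then have "edges G = (\<lambda>e. ?g ` e) ` edges H"
    by (auto simp: f(2) image_iff)
  then show ?thesis using bij_betw_inv_into[OF f(1)] by (auto simp: isomorphic_def)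
qed

lemma isomorphic_trans:
  assumes "isomorphic G H" "isomorphic H K"
  shows "isomorphic G K"
proof -
  obtain f g where "bij_betw f (verts G) (verts H)" "edges H = (\<lambda>e. f ` e) ` edges G"
    "bij_betw g (verts H) (verts K)" "edges K = (\<lambda>e. g ` e) ` edges H"
    using assms by (auto simp: isomorphic_def)
  then show ?thesis
    unfolding isomorphic_def
    by (intro exI[of _ "g \<circ> f"]) (auto intro: bij_betw_trans simp: image_comp image_image)
qed

lemma equiv_iso_rel: "equiv {H. fin_graph H} iso_rel"
proof -
  have "isomorphic G G" for G
    unfolding isomorphic_def by (intro exI[of _ id]) auto
  then show ?thesis
    by (auto simp: equiv_def refl_on_def sym_def trans_def iso_rel_def
        intro: isomorphic_sym isomorphic_trans)
qed

lemma finite_iso_reps: "finite (iso_reps k)"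
proof -
  let ?S = "(\<lambda>(n, E). \<lparr>verts = {..<n}, edges = E\<rparr>) ` ({..k} \<times> Pow (Pow {..<k}))"
  have "X \<in> (\<lambda>H. iso_rel `` {H}) ` ?S" if X_in: "X \<in> graphs_upto k // iso_rel" for X
  proof -
    obtain H where "H \<in> graphs_upto k" and X: "X = iso_rel `` {H}"
      using X_in by (rule quotientE)
    then have H: "fin_graph H" "card (verts H) \<le> k" by (auto simp: graphs_upto_def)
    obtain H' where H': "verts H' = {..<card (verts H)}" "fin_graph H'" "isomorphic H H'"
      using isomorphic_initial_segment[OF H(1)] .
    have "X = iso_rel `` {H'}"
      using H X H' equiv_class_eq[OF equiv_iso_rel, of H H'] by (simp add: iso_rel_def)
    moreover have "H' \<in> ?S"
    proof (rule image_eqI[of _ _ "(card (verts H), edges H')"])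
      show "H' = (case (card (verts H), edges H') of (n, E) \<Rightarrow> \<lparr>verts = {..<n}, edges = E\<rparr>)"
        using H'(1) by simp
      have "edges H' \<subseteq> Pow {..<card (verts H)}"
        using H'(1,2) by (auto simp: fin_graph_def)
      also have "\<dots> \<subseteq> Pow {..<k}" using H(2) by auto
      finally show "(card (verts H), edges H') \<in> {..k} \<times> Pow (Pow {..<k})"
        using H(2) by simp
    qed
    ultimately show ?thesis by blast
  qed
  then have "graphs_upto k // iso_rel \<subseteq> (\<lambda>H. iso_rel `` {H}) ` ?S" by blast
  moreover have "finite ?S" by simp
  ultimately have "finite (graphs_upto k // iso_rel)" by (meson finite_imageI finite_subset)
  then show ?thesis by (simp add: iso_reps_def)
qed


section \<open>Model of computation\<close>

text \<open>
  Programs of a structured language run on a random access machine with a discrete memory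
  (natural numbers) and a numeric memory (complex numbers); a memory consists of named arrays
  whose cells are addressed by two indices.  Every evaluation of an operator, every test and
  every assignment costs one unit.

  On natural numbers there are only addition and truncated subtraction.  With unit cost
  multiplication one could build numbers of exponential bit length in polynomial time; as it is,
  the discrete part is polynomially equivalent to a Turing machine.  On complex numbers the
  model is the usual exact (real RAM, Blum-Shub-Smale) one: field operations, equality tests,
  and comparison of real parts, but no rounding and no transcendental functions.  Division by
  zero yields zero.  Conversion from the numeric to the discrete memory is not available.
\<close>

datatype nexp =
    NConst nat
  | NCell string nexp nexp
  | NAdd nexp nexp
  | NSub nexp nexp

datatype cexp =
    CConst complex
  | CCell string nexp nexp
  | COfNat nexp
  | CAdd cexp cexp
  | CSub cexp cexp
  | CMul cexp cexp
  | CDiv cexp cexp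

datatype bexp =
    NLe nexp nexp
  | CEq cexp cexp
  | ReLe cexp cexp
  | BNot bexp
  | BAnd bexp bexp

datatype com =
    Skip
  | NSet string nexp nexp nexp
  | CSet string nexp nexp cexp
  | Seq com com
  | If bexp com com
  | While bexp com
  | Call string nexp nexp string

record state =
  nats :: "string \<Rightarrow> nat \<Rightarrow> nat \<Rightarrow> nat"
  nums :: "string \<Rightarrow> nat \<Rightarrow> nat \<Rightarrow> complex"

definition set_nat :: "string \<Rightarrow> nat \<Rightarrow> nat \<Rightarrow> nat \<Rightarrow> state \<Rightarrow> state" where
  "set_nat x i j v s = s\<lparr>nats := (nats s)(x := (nats s x)(i := (nats s x i)(j := v)))\<rparr>"

definition set_num :: "string \<Rightarrow> nat \<Rightarrow> nat \<Rightarrow> complex \<Rightarrow> state \<Rightarrow> state" where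
  "set_num x i j v s = s\<lparr>nums := (nums s)(x := (nums s x)(i := (nums s x i)(j := v)))\<rparr>"

fun nval :: "nexp \<Rightarrow> state \<Rightarrow> nat" where
  "nval (NConst c) s = c"
| "nval (NCell x i j) s = nats s x (nval i s) (nval j s)"
| "nval (NAdd a b) s = nval a s + nval b s"
| "nval (NSub a b) s = nval a s - nval b s"

fun ncost :: "nexp \<Rightarrow> nat" where
  "ncost (NConst c) = 1"
| "ncost (NCell x i j) = 1 + ncost i + ncost j"
| "ncost (NAdd a b) = 1 + ncost a + ncost b"
| "ncost (NSub a b) = 1 + ncost a + ncost b"

fun cval :: "cexp \<Rightarrow> state \<Rightarrow> complex" where
  "cval (CConst c) s = c"
| "cval (CCell x i j) s = nums s x (nval i s) (nval j s)"
| "cval (COfNat a) s = of_nat (nval a s)"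
| "cval (CAdd a b) s = cval a s + cval b s"
| "cval (CSub a b) s = cval a s - cval b s"
| "cval (CMul a b) s = cval a s * cval b s"
| "cval (CDiv a b) s = cval a s / cval b s"

fun ccost :: "cexp \<Rightarrow> nat" where
  "ccost (CConst c) = 1"
| "ccost (CCell x i j) = 1 + ncost i + ncost j"
| "ccost (COfNat a) = 1 + ncost a"
| "ccost (CAdd a b) = 1 + ccost a + ccost b"
| "ccost (CSub a b) = 1 + ccost a + ccost b"
| "ccost (CMul a b) = 1 + ccost a + ccost b"
| "ccost (CDiv a b) = 1 + ccost a + ccost b"

fun bval :: "bexp \<Rightarrow> state \<Rightarrow> bool" where
  "bval (NLe a b) s \<longleftrightarrow> nval a s \<le> nval b s"
| "bval (CEq a b) s \<longleftrightarrow> cval a s = cval b s"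
| "bval (ReLe a b) s \<longleftrightarrow> Re (cval a s) \<le> Re (cval b s)"
| "bval (BNot a) s \<longleftrightarrow> \<not> bval a s"
| "bval (BAnd a b) s \<longleftrightarrow> bval a s \<and> bval b s"

fun bcost :: "bexp \<Rightarrow> nat" where
  "bcost (NLe a b) = 1 + ncost a + ncost b"
| "bcost (CEq a b) = 1 + ccost a + ccost b"
| "bcost (ReLe a b) = 1 + ccost a + ccost b"
| "bcost (BNot a) = 1 + bcost a"
| "bcost (BAnd a b) = 1 + bcost a + bcost b"

text \<open>
  A subroutine is a relation \<open>sub k A i z t\<close>: on the graph with vertex set \<open>{..<k}\<close> and
  adjacency matrix \<open>A\<close>, and the number \<open>i\<close>, it returns \<open>z\<close> after \<open>t\<close> steps.  The command
  \<open>Call a k i b\<close> passes the top left \<open>k\<close> by \<open>k\<close> part of the array \<open>a\<close> and the number \<open>i\<close> to the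
  subroutine and stores the result in cell (0, 0) of the array \<open>b\<close>; it is charged for copying
  the argument and for the running time of the subroutine.
\<close>

type_synonym subroutine = "nat \<Rightarrow> (nat \<Rightarrow> nat \<Rightarrow> nat) \<Rightarrow> nat \<Rightarrow> complex \<Rightarrow> nat \<Rightarrow> bool"

definition restrict_matrix :: "nat \<Rightarrow> (nat \<Rightarrow> nat \<Rightarrow> nat) \<Rightarrow> nat \<Rightarrow> nat \<Rightarrow> nat" where
  "restrict_matrix k A u v = (if u < k \<and> v < k then A u v else 0)"

text \<open>\<open>exec sub c s t s'\<close>: started in state \<open>s\<close>, the program \<open>c\<close> halts after \<open>t\<close> steps in \<open>s'\<close>.\<close>

inductive exec :: "subroutine \<Rightarrow> com \<Rightarrow> state \<Rightarrow> nat \<Rightarrow> state \<Rightarrow> bool"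
  for sub :: subroutine where
  Skip: "exec sub Skip s 1 s"
| NSet: "exec sub (NSet x i j a) s (1 + ncost i + ncost j + ncost a)
           (set_nat x (nval i s) (nval j s) (nval a s) s)"
| CSet: "exec sub (CSet x i j a) s (1 + ncost i + ncost j + ccost a)
           (set_num x (nval i s) (nval j s) (cval a s) s)"
| Seq: "exec sub c s t s' \<Longrightarrow> exec sub d s' t' s'' \<Longrightarrow> exec sub (Seq c d) s (t + t') s''"
| IfTrue: "bval b s \<Longrightarrow> exec sub c s t s' \<Longrightarrow> exec sub (If b c d) s (bcost b + t) s'"
| IfFalse: "\<not> bval b s \<Longrightarrow> exec sub d s t s' \<Longrightarrow> exec sub (If b c d) s (bcost b + t) s'"
| WhileFalse: "\<not> bval b s \<Longrightarrow> exec sub (While b c) s (bcost b) s"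
| WhileTrue: "bval b s \<Longrightarrow> exec sub c s t s' \<Longrightarrow> exec sub (While b c) s' t' s'' \<Longrightarrow>
    exec sub (While b c) s (bcost b + t + t') s''"
| Call: "sub (nval k s) (restrict_matrix (nval k s) (nats s a)) (nval i s) z t \<Longrightarrow>
    exec sub (Call a k i b) s (1 + ncost k + ncost i + nval k s * nval k s + t)
      (set_num b 0 0 z s)"

text \<open>The input of a program: a graph on \<open>{..<n}\<close> given by its adjacency matrix, a natural
  number and a complex number; all other cells are zero.\<close>

definition input :: "nat \<Rightarrow> (nat \<Rightarrow> nat \<Rightarrow> nat) \<Rightarrow> nat \<Rightarrow> complex \<Rightarrow> state" where
  "input n A i z =
     set_nat ''n'' 0 0 n (set_nat ''i'' 0 0 i (set_num ''eps'' 0 0 z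
       \<lparr>nats = (\<lambda>_ _ _. 0)(''adj'' := A), nums = \<lambda>_ _ _. 0\<rparr>))"

definition adjacency :: "graph \<Rightarrow> nat \<Rightarrow> nat \<Rightarrow> nat" where
  "adjacency G u v = (if {u, v} \<in> edges G then 1 else 0)"

definition outputs :: "state \<Rightarrow> complex list \<Rightarrow> bool" where
  "outputs s zs \<longleftrightarrow> nats s ''len'' 0 0 = length zs \<and>
     (\<forall>j<length zs. nums s ''out'' j 0 = zs ! j)"

definition no_sub :: subroutine where
  "no_sub = (\<lambda>_ _ _ _ _. False)"

definition run_as_sub :: "com \<Rightarrow> subroutine" where
  "run_as_sub Q = (\<lambda>k A i z t. \<exists>s. exec no_sub Q (input k A i 0) t s \<and> nums s ''out'' 0 0 = z)"

lemma exec_deterministic: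
  assumes sub: "\<And>k A i z t z' t'. sub k A i z t \<Longrightarrow> sub k A i z' t' \<Longrightarrow> z' = z \<and> t' = t"
  shows "exec sub c s t s' \<Longrightarrow> exec sub c s u s'' \<Longrightarrow> u = t \<and> s'' = s'"
proof (induction arbitrary: u s'' rule: exec.induct)
  case (Skip s)
  then show ?case by (auto elim: exec.cases)
next
  case (NSet x i j a s)
  from NSet.prems show ?case by cases simp
next
  case (CSet x i j a s)
  from CSet.prems show ?case by cases simp
next
  case (Seq c s t s' d t' s2)
  from Seq.prems show ?case by cases (metis Seq.IH)
next
  case (IfTrue b s c t s' d)
  from IfTrue.prems show ?case by cases (metis IfTrue.IH, metis IfTrue.hyps(1))
next
  case (IfFalse b s d t s' c)
  from IfFalse.prems show ?case by cases (metis IfFalse.hyps(1), metis IfFalse.IH)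
next
  case (WhileFalse b s c)
  from WhileFalse.prems show ?case by cases (simp_all add: WhileFalse.hyps)
next
  case (WhileTrue b s c t s' t' s2)
  from WhileTrue.prems show ?case
    by cases (metis WhileTrue.hyps(1), metis WhileTrue.IH)
next
  case (Call k s a i z t b)
  from Call.prems show ?case by cases (metis Call.hyps sub)
qed

lemma run_as_sub_deterministic:
  assumes "run_as_sub Q k A i z t" "run_as_sub Q k A i z' t'"
  shows "z' = z \<and> t' = t"
proof -
  obtain s s' where *: "exec no_sub Q (input k A i 0) t s" "nums s ''out'' 0 0 = z"
    "exec no_sub Q (input k A i 0) t' s'" "nums s' ''out'' 0 0 = z'"
    using assms by (auto simp: run_as_sub_def)
  have "t' = t \<and> s' = s"
    by (rule exec_deterministic[OF _ *(1) *(3)]) (simp_all add: no_sub_def)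
  then show ?thesis using * by auto
qed


section \<open>Bounded induced graph counting polynomials\<close>

text \<open>\<open>computes_coeffs \<alpha> \<beta> lam Q\<close>: for every graph \<open>H\<close> with at most \<open>\<alpha> i\<close> vertices, \<open>Q\<close> computes
  \<open>lam H i\<close> in time \<open>O(\<beta> ^ |V(H)|)\<close>, whichever labelling of \<open>H\<close> by \<open>{..<|V(H)|}\<close> it is given.\<close>

definition computes_coeffs :: "nat \<Rightarrow> nat \<Rightarrow> (graph \<Rightarrow> nat \<Rightarrow> complex) \<Rightarrow> com \<Rightarrow> bool" where
  "computes_coeffs \<alpha> \<beta> lam Q \<longleftrightarrow>
     (\<exists>K::nat. \<forall>i k H. fin_graph H \<longrightarrow> verts H = {..<k} \<longrightarrow> k \<le> \<alpha> * i \<longrightarrow>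
        (\<exists>t\<le>K * \<beta> ^ k. run_as_sub Q k (adjacency H) i (lam H i) t))"

text \<open>\<open>p\<close> is a bounded induced graph counting polynomial with constants \<open>\<alpha>\<close>, \<open>\<beta>\<close>, with
  coefficients \<open>lam H i\<close> and with \<open>Q\<close> an algorithm computing these.  Since \<open>lam H i\<close> belongs to
  the isomorphism class of \<open>H\<close>, it is required to be a graph invariant.\<close>

definition bigcp ::
    "nat \<Rightarrow> nat \<Rightarrow> (graph \<Rightarrow> nat \<Rightarrow> complex) \<Rightarrow> com \<Rightarrow> (graph \<Rightarrow> complex poly) \<Rightarrow> bool" where
  "bigcp \<alpha> \<beta> lam Q p \<longleftrightarrow>
     graph_invariant p \<and> multiplicative p \<and>
     (\<forall>G. fin_graph G \<longrightarrow> coeff (p G) 0 = 1) \<and>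
     (\<forall>i. graph_invariant (\<lambda>H. lam H i)) \<and>
     (\<forall>G i. fin_graph G \<longrightarrow>
        coeff (p G) i = (\<Sum>H\<in>iso_reps (\<alpha> * i). lam H i * of_nat (ind H G))) \<and>
     computes_coeffs \<alpha> \<beta> lam Q"

definition inverse_power_sum :: "complex poly \<Rightarrow> nat \<Rightarrow> complex" where
  "inverse_power_sum q j = (\<Sum>\<zeta>\<in>#proots q. inverse \<zeta> ^ j)"

end

theory Submission
  imports Defs "HOL-Computational_Algebra.Fundamental_Theorem_Algebra"
    "HOL-Computational_Algebra.Polynomial_FPS"
begin

text \<open>
  Write \<open>P\<^sub>j(S)\<close> for the \<open>j\<close>th inverse power sum of \<open>p(G[S])\<close> and \<open>c\<^sub>j\<close> for the Moebius transform of
  \<open>P\<^sub>j\<close> over subsets, so that \<open>p\<^sub>j = P\<^sub>j(V)\<close> is the sum of all \<open>c\<^sub>j(S)\<close>.  The coefficients \<open>e\<^sub>i\<close> have Moebius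
  transforms supported on sets of size at most \<open>\<alpha> i\<close>; by Newton's identities \<open>c\<^sub>j\<close> is supported on sets
  of size at most \<open>\<alpha> j\<close>.  As \<open>p\<close> is multiplicative, \<open>P\<^sub>j\<close> is additive over disjoint unions, and \<open>c\<^sub>j(S)\<close>
  vanishes unless \<open>G[S]\<close> is connected.  Hence \<open>p\<^sub>j\<close> is the sum of \<open>c\<^sub>j(S)\<close> over any family \<open>F\<close> that contains
  all connected sets of size at most \<open>\<alpha> j\<close>.

  Connected sets of size \<open>l\<close> are vertex sets of walks of length \<open>2 l - 2\<close>, so for \<open>m = O(ln (n / \<epsilon>))\<close> and
  bounded degree there are only polynomially many of size at most \<open>\<alpha> m\<close>, and the family \<open>F\<close> of all their
  subsets is polynomial as well.  The algorithm tabulates \<open>F\<close>: starting from the empty set it first adds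
  adjacent vertices as long as possible, then deletes vertices.  Since \<open>F\<close> is closed under subsets, the
  \<open>e\<^sub>i(S)\<close>, the \<open>P\<^sub>j(S)\<close> and the \<open>c\<^sub>j(S)\<close> are computed inside the table, and neither connectivity nor
  isomorphism has to be tested.
\<close>

section \<open>Moebius inversion over finite sets\<close>

text \<open>Running through all vertex sets of size \<open>\<alpha> * m\<close> would take
  \<open>n\<close> to a power of order \<open>ln (n / \<epsilon>)\<close>. Restricting to connected
  sets leaves \<open>n\<close> times a constant to the power \<open>m\<close>, and such an
  exponential is a power of \<open>n / \<epsilon>\<close>. The restriction is possible only after
  passing to transforms: the numbers \<open>lam\<close> behind the coefficients need not vanish on
  disconnected graphs, whereas the transform of an additive invariant does. The table has to be
  closed under subsets because \<open>e\<^sub>i(S)\<close> and \<open>c\<^sub>j(S)\<close> are both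
  sums over all subsets of \<open>S\<close>; this costs only a factor
  \<open>2 ^ (\<alpha> * m)\<close>. The convolution formula for transforms of products serves only
  to bound supports; the program evaluates Newton's identities for each \<open>S\<close> directly.
  The numbers \<Delta> and \<beta> and the running time of the subroutine enter the analysis but not
  the program: a single bound \<open>M\<close> dominates all loop lengths and calls, and the whole
  run costs \<open>O(M ^ 4)\<close>.\<close>

definition moebius :: "('a set \<Rightarrow> complex) \<Rightarrow> 'a set \<Rightarrow> complex" where
  "moebius f S = (\<Sum>T\<in>Pow S. (-1) ^ card S * (-1) ^ card T * f T)"

lemma sum_Pow_insert:
  fixes f :: "'a set \<Rightarrow> 'b::comm_monoid_add"
  assumes "finite S" "x \<notin> S"
  shows "sum f (Pow (insert x S)) = sum f (Pow S) + (\<Sum>T\<in>Pow S. f (insert x T))"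
proof -
  have "inj_on (insert x) (Pow S)"
    using assms(2) by (meson PowD inj_on_def insert_ident subsetD)
  moreover have "Pow S \<inter> insert x ` Pow S = {}" using assms(2) by auto
  ultimately show ?thesis
    using assms(1) by (simp add: Pow_insert sum.union_disjoint sum.reindex)
qed

lemma moebius_empty [simp]: "moebius f {} = f {}"
  by (simp add: moebius_def)

lemma moebius_cong:
  assumes "\<And>T. T \<subseteq> S \<Longrightarrow> f T = g T"
  shows "moebius f S = moebius g S"
  unfolding moebius_def using assms by (intro sum.cong) auto

lemma moebius_add: "moebius (\<lambda>T. f T + g T) S = moebius f S + moebius g S"
  by (simp add: moebius_def sum.distrib algebra_simps)

lemma moebius_cmult: "moebius (\<lambda>T. c * f T) S = c * moebius f S"
  by (simp add: moebius_def sum_distrib_left algebra_simps)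

lemma moebius_sum: "moebius (\<lambda>T. \<Sum>i\<in>I. f i T) S = (\<Sum>i\<in>I. moebius (f i) S)"
  unfolding moebius_def by (simp add: sum_distrib_left) (rule sum.swap)

text \<open>Subsets of \<open>insert x S\<close> are split by membership of \<open>x\<close>. The
  transform is thus an iterated difference, one difference per element, and this recursion drives
  the inductions below.\<close>

lemma moebius_insert:
  assumes "finite S" "x \<notin> S"
  shows "moebius f (insert x S) = moebius (\<lambda>T. f (insert x T)) S - moebius f S"
proof -
  have "card (insert x T) = Suc (card T)" if "T \<in> Pow S" for T
    using that assms by (metis PowD card_insert_disjoint finite_subset subsetD)
  then have *: "(\<Sum>T\<in>Pow S. (-1) ^ card (insert x S) * (-1) ^ card (insert x T) * f (insert x T)) =
      moebius (\<lambda>T. f (insert x T)) S"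
    unfolding moebius_def using assms by (intro sum.cong) auto
  show ?thesis
    unfolding moebius_def[of f "insert x S"] sum_Pow_insert[OF assms] *
    using assms by (simp add: moebius_def sum_negf)
qed

text \<open>The sets containing \<open>x\<close> contribute differences whose second terms cancel
  the sets avoiding \<open>x\<close>. What is left is the claim for \<open>f (insert x T)\<close>,
  so \<open>f\<close> has to vary in the induction.\<close>

lemma sum_moebius:
  assumes "finite V"
  shows "(\<Sum>S\<in>Pow V. moebius f S) = f V"
  using assms
proof (induction V arbitrary: f rule: finite_induct)
  case (insert x V)
  have "(\<Sum>S\<in>Pow V. moebius f (insert x S)) =
      (\<Sum>S\<in>Pow V. moebius (\<lambda>T. f (insert x T)) S - moebius f S)"
  proof (rule sum.cong)
    fix S assume "S \<in> Pow V"
    then have "finite S" "x \<notin> S" using insert.hyps by (auto simp: finite_subset)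
    then show "moebius f (insert x S) = moebius (\<lambda>T. f (insert x T)) S - moebius f S"
      by (rule moebius_insert)
  qed simp
  then show ?case
    using insert.IH by (simp add: sum_Pow_insert[OF insert.hyps] sum_subtractf)
qed simp

text \<open>Uniqueness in the inversion formula: a transform can be read off from any representation
  as a subset sum, without evaluating an alternating sum.\<close>

lemma moebius_of_sum:
  assumes "finite S" "\<And>T. T \<subseteq> S \<Longrightarrow> f T = (\<Sum>U\<in>Pow T. d U)"
  shows "moebius f S = d S"
  using assms
proof (induction S arbitrary: f d rule: finite_induct)
  case (insert x S)
  have "moebius (\<lambda>T. f (insert x T)) S = d S + d (insert x S)"
  proof (rule insert.IH)
    fix T assume "T \<subseteq> S"
    then have "finite T" "x \<notin> T" using insert.hyps by (auto simp: finite_subset)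
    moreover have "f (insert x T) = sum d (Pow (insert x T))"
      using insert.prems \<open>T \<subseteq> S\<close> by (meson insert_mono)
    ultimately show "f (insert x T) = (\<Sum>U\<in>Pow T. d U + d (insert x U))"
      by (simp add: sum_Pow_insert sum.distrib)
  qed
  moreover have "moebius f S = d S"
    by (rule insert.IH) (use insert.prems in auto)
  ultimately show ?case by (simp add: moebius_insert insert.hyps)
qed simp

text \<open>Expand both factors by inversion and group the pairs \<open>(U, U')\<close> by their
  union; uniqueness then identifies the transform. The two sets may overlap.\<close>

lemma moebius_mult:
  assumes "finite W"
  shows "moebius (\<lambda>T. f T * g T) W =
    (\<Sum>(U, U')\<in>{(U, U'). U \<union> U' = W}. moebius f U * moebius g U')"
proof (rule moebius_of_sum[OF assms])
  fix T assume "T \<subseteq> W"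
  then have T: "finite T" using assms by (rule finite_subset)
  have "f T * g T = (\<Sum>U\<in>Pow T. moebius f U) * (\<Sum>U\<in>Pow T. moebius g U)"
    by (simp add: sum_moebius T)
  also have "\<dots> = (\<Sum>(U, U')\<in>Pow T \<times> Pow T. moebius f U * moebius g U')"
    by (simp add: sum_product sum.cartesian_product)
  also have "Pow T \<times> Pow T = (\<Union>X\<in>Pow T. {(U, U'). U \<union> U' = X})" by auto
  also have "(\<Sum>(U, U')\<in>(\<Union>X\<in>Pow T. {(U, U'). U \<union> U' = X}). moebius f U * moebius g U') =
      (\<Sum>X\<in>Pow T. \<Sum>(U, U')\<in>{(U, U'). U \<union> U' = X}. moebius f U * moebius g U')"
  proof (rule sum.UNION_disjoint)
    show "\<forall>X\<in>Pow T. finite {(U, U'). U \<union> U' = X}"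
    proof
      fix X assume "X \<in> Pow T"
      then have "finite X" using T by (auto intro: finite_subset)
      moreover have "{(U, U'). U \<union> U' = X} \<subseteq> Pow X \<times> Pow X" by auto
      ultimately show "finite {(U, U'). U \<union> U' = X}" by (meson finite_Pow_iff finite_SigmaI finite_subset)
    qed
  qed (use T in auto)
  finally show "f T * g T = (\<Sum>X\<in>Pow T. \<Sum>(U, U')\<in>{(U, U'). U \<union> U' = X}. moebius f U * moebius g U')" .
qed

text \<open>A set function is a multilinear polynomial in the indicators of the vertices, with the
  values of \<open>moebius\<close> as coefficients; this is a bound on its degree.\<close>

definition moebius_degree_le :: "'a set \<Rightarrow> nat \<Rightarrow> ('a set \<Rightarrow> complex) \<Rightarrow> bool" where
  "moebius_degree_le V k f \<longleftrightarrow> (\<forall>S\<subseteq>V. k < card S \<longrightarrow> moebius f S = 0)"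

lemma moebius_degree_le_mult:
  assumes "finite V" "moebius_degree_le V k f" "moebius_degree_le V l g"
  shows "moebius_degree_le V (k + l) (\<lambda>T. f T * g T)"
  unfolding moebius_degree_le_def
proof (intro allI impI)
  fix S assume S: "S \<subseteq> V" "k + l < card S"
  then have "finite S" using assms(1) finite_subset by blast
  have "moebius f U * moebius g U' = 0" if "U \<union> U' = S" for U U'
  proof -
    have "card S \<le> card U + card U'" using card_Un_le[of U U'] that by simp
    then have "k < card U \<or> l < card U'" using S(2) by linarith
    then show ?thesis using assms(2,3) S(1) that by (auto simp: moebius_degree_le_def)
  qed
  then show "moebius (\<lambda>T. f T * g T) S = 0"
    unfolding moebius_mult[OF \<open>finite S\<close>] by (intro sum.neutral) auto
qed

lemma moebius_degree_le_add:
  "moebius_degree_le V k f \<Longrightarrow> moebius_degree_le V k g \<Longrightarrow> moebius_degree_le V k (\<lambda>T. f T + g T)"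
  by (simp add: moebius_degree_le_def moebius_add)

lemma moebius_degree_le_cmult:
  "moebius_degree_le V k f \<Longrightarrow> moebius_degree_le V k (\<lambda>T. c * f T)"
  by (simp add: moebius_degree_le_def moebius_cmult)

lemma moebius_degree_le_sum:
  "(\<And>i. i \<in> I \<Longrightarrow> moebius_degree_le V k (f i)) \<Longrightarrow> moebius_degree_le V k (\<lambda>T. \<Sum>i\<in>I. f i T)"
  by (simp add: moebius_degree_le_def moebius_sum)

text \<open>A function that ignores some \<open>x\<close> in \<open>S\<close> has difference zero in
  the direction of \<open>x\<close>.\<close>

lemma moebius_Int_eq_0:
  assumes "finite S" "\<not> S \<subseteq> A"
  shows "moebius (\<lambda>T. f (T \<inter> A)) S = 0"
proof -
  obtain x where x: "x \<in> S" "x \<notin> A" using assms by auto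
  define R where "R = S - {x}"
  have "S = insert x R" "finite R" "x \<notin> R" using x assms by (auto simp: R_def)
  then show ?thesis using x(2) by (simp add: moebius_insert)
qed

text \<open>Each summand ignores a nonempty part of \<open>S\<close>: the first ignores
  \<open>B\<close>, the second ignores \<open>A\<close>.\<close>

lemma moebius_additive_eq_0:
  assumes "finite S" "A \<union> B = S" "A \<inter> B = {}" "A \<noteq> {}" "B \<noteq> {}"
    and "\<And>T. T \<subseteq> S \<Longrightarrow> f T = f (T \<inter> A) + f (T \<inter> B)"
  shows "moebius f S = 0"
proof -
  have "moebius f S = moebius (\<lambda>T. f (T \<inter> A) + f (T \<inter> B)) S"
    by (rule moebius_cong) (use assms(6) in blast)
  also have "\<dots> = moebius (\<lambda>T. f (T \<inter> A)) S + moebius (\<lambda>T. f (T \<inter> B)) S"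
    by (rule moebius_add)
  also have "\<dots> = 0" using assms(1-5) by (subst (1 2) moebius_Int_eq_0) auto
  finally show ?thesis .
qed

section \<open>Newton's identities\<close>

lemma inverse_power_sum_mult:
  assumes "q \<noteq> 0" "r \<noteq> 0"
  shows "inverse_power_sum (q * r) j = inverse_power_sum q j + inverse_power_sum r j"
  using assms by (simp add: inverse_power_sum_def proots_mult)

text \<open>The logarithmic derivative of the product is the sum of \<open>1 / (X - x)\<close>, and
  each of these is minus the geometric series with terms \<open>X ^ k / x ^ (k + 1)\<close>. The
  equation is multiplied out to avoid dividing series.\<close>

lemma fps_deriv_roots:
  fixes M :: "complex multiset"
  assumes "0 \<notin># M"
  shows "fps_deriv (\<Prod>x\<in>#M. fps_const (- x) + fps_X) =
    - (\<Prod>x\<in>#M. fps_const (- x) + fps_X) * Abs_fps (\<lambda>k. \<Sum>x\<in>#M. inverse x ^ Suc k)"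
  using assms
proof (induction M)
  case (add a M)
  have a: "a \<noteq> 0" using add.prems by auto
  let ?Q = "\<Prod>x\<in>#M. fps_const (- x) + fps_X"
  let ?P = "\<lambda>M. Abs_fps (\<lambda>k. \<Sum>x\<in>#M. inverse x ^ Suc k)"
  let ?L = "fps_const (- a) + fps_X :: complex fps"
  let ?g = "Abs_fps (\<lambda>k. inverse a ^ Suc k)"
  have P: "?P (add_mset a M) = ?g + ?P M" by (simp add: fps_eq_iff)
  \<comment> \<open>Telescoping: all coefficients except the constant one cancel.\<close>
  have L: "?L * ?g = -1"
    by (rule fps_ext) (use a in \<open>auto simp: algebra_simps gr0_conv_Suc fps_X_mult_nth
        fps_mult_left_const_nth split: nat.splits\<close>)
  have IH: "fps_deriv ?Q = - ?Q * ?P M" using add by simp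
  have "fps_deriv (?L * ?Q) = ?Q + ?L * fps_deriv ?Q" by (simp add: algebra_simps)
  also have "\<dots> = ?Q + ?L * (- ?Q * ?P M)" by (simp only: IH)
  also have "\<dots> = - ((?L * ?g) * ?Q) - ?L * ?Q * ?P M" unfolding L by (simp add: algebra_simps)
  also have "\<dots> = - (?L * ?Q) * ?P (add_mset a M)" unfolding P by (simp add: algebra_simps)
  finally show ?case by simp
qed (simp add: fps_zero_def)

text \<open>Compare the coefficients of \<open>X ^ (j - 1)\<close> in \<open>q' = - q P\<close>,
  where \<open>P\<close> generates the inverse power sums from index 1 on. Coefficients of
  \<open>q\<close> beyond its degree are zero, so large \<open>j\<close> need no separate
  case.\<close>

lemma newton_identity:
  fixes q :: "complex poly"
  assumes "coeff q 0 = 1" "0 < j"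
  shows "inverse_power_sum q j =
    - (of_nat j * coeff q j + (\<Sum>i\<in>{1..<j}. coeff q i * inverse_power_sum q (j - i)))"
proof -
  have nz: "q \<noteq> 0" using assms(1) by auto
  have "poly q 0 \<noteq> 0" using assms(1) by (simp add: poly_0_coeff_0)
  then have 0: "0 \<notin># proots q" using nz by simp
  let ?Q = "\<Prod>x\<in>#proots q. fps_const (- x) + fps_X"
  let ?P = "Abs_fps (\<lambda>k. inverse_power_sum q (Suc k))"
  have lin: "fps_of_poly (\<Prod>x\<in>#M. [:- x, 1:]) = (\<Prod>x\<in>#M. fps_const (- x) + fps_X)"
    for M :: "complex multiset"
    by (induction M) (simp_all add: fps_of_poly_mult fps_of_poly_pCons
        del: mult_pCons_left)
  \<comment> \<open>The leading coefficient is a constant factor on both sides of the differential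
    equation.\<close>
  have "fps_of_poly q = fps_const (lead_coeff q) * ?Q"
    by (subst complex_poly_decompose_multiset[symmetric, of q])
      (simp add: fps_of_poly_smult lin nz)
  moreover have "fps_deriv ?Q = - ?Q * ?P"
    using fps_deriv_roots[OF 0] by (simp add: inverse_power_sum_def)
  ultimately have "fps_deriv (fps_of_poly q) = - fps_of_poly q * ?P"
    by (simp add: algebra_simps)
  then have "fps_nth (fps_deriv (fps_of_poly q)) (j - 1) = fps_nth (- fps_of_poly q * ?P) (j - 1)"
    by simp
  also have "fps_nth (- fps_of_poly q * ?P) (j - 1) =
      - (\<Sum>i=0..j-1. coeff q i * inverse_power_sum q (Suc (j - 1 - i)))"
    by (simp add: fps_mult_nth sum_negf)
  also have "(\<Sum>i=0..j-1. coeff q i * inverse_power_sum q (Suc (j - 1 - i))) =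
      (\<Sum>i\<in>{0..<j}. coeff q i * inverse_power_sum q (j - i))"
    by (rule sum.cong) (use assms(2) in \<open>auto simp: Suc_diff_Suc\<close>)
  \<comment> \<open>The term for \<open>i = 0\<close> is the inverse power sum sought, because the
    constant coefficient is 1.\<close>
  also have "\<dots> = inverse_power_sum q j + (\<Sum>i\<in>{1..<j}. coeff q i * inverse_power_sum q (j - i))"
    using assms by (simp add: sum.atLeast_Suc_lessThan)
  finally show ?thesis using assms(2) by (simp add: algebra_simps eq_neg_iff_add_eq_0)
qed

section \<open>Localisation of the inverse power sums\<close>

lemma fin_graph_induced:
  assumes "fin_graph G" "S \<subseteq> verts G"
  shows "fin_graph (induced G S)"
  using assms by (auto simp: fin_graph_def induced_def intro: finite_subset)

lemma induced_induced: "S \<subseteq> T \<Longrightarrow> induced (induced G T) S = induced G S"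
  by (auto simp: induced_def)

lemma induced_verts: "fin_graph G \<Longrightarrow> induced G (verts G) = G"
  by (cases G) (auto simp: fin_graph_def induced_def)

lemma verts_induced [simp]: "verts (induced G S) = S"
  by (simp add: induced_def)

lemma isomorphic_card: "isomorphic G H \<Longrightarrow> card (verts G) = card (verts H)"
  by (auto simp: isomorphic_def bij_betw_same_card)

section \<open>Representatives of isomorphism classes\<close>

lemma iso_repsE:
  assumes "H \<in> iso_reps k"
  obtains X where "X \<in> graphs_upto k // iso_rel" "H = (SOME H. H \<in> X)" "X = iso_rel `` {H}"
    "fin_graph H" "card (verts H) \<le> k"
proof -
  obtain X where X: "X \<in> graphs_upto k // iso_rel" "H = (SOME H. H \<in> X)"
    using assms by (auto simp: iso_reps_def)
  obtain H0 where H0: "H0 \<in> graphs_upto k" "X = iso_rel `` {H0}"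
    using X(1) by (rule quotientE)
  have "(H0, H0) \<in> iso_rel"
    using H0(1) equiv_iso_rel by (auto simp: equiv_def refl_on_def graphs_upto_def)
  then have "H \<in> X" unfolding X(2) H0(2) by (metis ImageI someI singletonI)
  then have H: "(H0, H) \<in> iso_rel" using H0(2) by auto
  then have "X = iso_rel `` {H}" using H0(2) equiv_class_eq[OF equiv_iso_rel] by simp
  moreover have "fin_graph H" "card (verts H) \<le> k"
    using H H0(1) isomorphic_card[of H0 H] by (auto simp: iso_rel_def graphs_upto_def)
  ultimately show thesis using X that by blast
qed

lemma iso_reps_exists:
  assumes "fin_graph K" "card (verts K) \<le> k"
  obtains H where "H \<in> iso_reps k" "isomorphic K H"
proof -
  let ?X = "iso_rel `` {K}"
  have "?X \<in> graphs_upto k // iso_rel"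
    using assms by (intro quotientI) (simp add: graphs_upto_def)
  then have "(SOME H. H \<in> ?X) \<in> iso_reps k"
    unfolding iso_reps_def by (rule imageI)
  moreover have "K \<in> ?X"
    using assms(1) equiv_iso_rel by (auto simp: equiv_def refl_on_def)
  then have "(SOME H. H \<in> ?X) \<in> ?X" by (rule someI)
  ultimately show thesis using that by (auto simp: iso_rel_def)
qed

lemma iso_reps_unique:
  assumes "H \<in> iso_reps k" "H' \<in> iso_reps k" "isomorphic H H'"
  shows "H = H'"
proof -
  obtain X where X: "H = (SOME H. H \<in> X)" "X = iso_rel `` {H}" "fin_graph H"
    using assms(1) by (rule iso_repsE)
  obtain X' where X': "H' = (SOME H. H \<in> X')" "X' = iso_rel `` {H'}" "fin_graph H'"
    using assms(2) by (rule iso_repsE)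
  have "(H, H') \<in> iso_rel" using assms(3) X(3) X'(3) by (simp add: iso_rel_def)
  then have "X = X'" using X(2) X'(2) equiv_class_eq[OF equiv_iso_rel] by simp
  then show ?thesis using X(1) X'(1) by simp
qed

section \<open>Coefficients and power sums as set functions\<close>

lemma bigcp_coeff_0: "bigcp \<alpha> \<beta> lam Q p \<Longrightarrow> fin_graph G \<Longrightarrow> coeff (p G) 0 = 1"
  unfolding bigcp_def by blast

lemma bigcp_union:
  assumes "bigcp \<alpha> \<beta> lam Q p" "fin_graph G" "fin_graph H" "verts G \<inter> verts H = {}"
  shows "p (graph_union G H) = p G * p H"
  using assms unfolding bigcp_def multiplicative_def by blast

text \<open>Each set \<open>S\<close> of at most \<open>\<alpha> * i\<close> vertices is counted by
  \<open>ind H G\<close> for exactly one representative \<open>H\<close>, and \<open>lam\<close>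
  agrees on \<open>H\<close> and \<open>induced G S\<close>. Summing over sets instead of
  isomorphism classes exhibits the transform of the coefficient and removes isomorphism from the
  computation.\<close>

lemma coeff_eq_sum_induced:
  assumes "bigcp \<alpha> \<beta> lam Q p" "fin_graph G"
  shows "coeff (p G) i = (\<Sum>S\<in>Pow (verts G). if card S \<le> \<alpha> * i then lam (induced G S) i else 0)"
proof -
  have fin: "finite (verts G)" using assms(2) by (simp add: fin_graph_def)
  define A where "A H = {S. S \<subseteq> verts G \<and> isomorphic (induced G S) H}" for H
  have finA: "finite (A H)" for H
    by (rule finite_subset[of _ "Pow (verts G)"]) (auto simp: A_def fin)
  have inv: "graph_invariant (\<lambda>H. lam H i)" using assms(1) by (simp add: bigcp_def)
  have "coeff (p G) i = (\<Sum>H\<in>iso_reps (\<alpha> * i). lam H i * of_nat (ind H G))"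
    using assms by (simp add: bigcp_def)
  also have "\<dots> = (\<Sum>H\<in>iso_reps (\<alpha> * i). \<Sum>S\<in>A H. lam (induced G S) i)"
  proof (rule sum.cong)
    fix H assume H: "H \<in> iso_reps (\<alpha> * i)"
    have "(\<Sum>S\<in>A H. lam (induced G S) i) = (\<Sum>S\<in>A H. lam H i)"
    proof (rule sum.cong)
      fix S assume "S \<in> A H"
      then show "lam (induced G S) i = lam H i"
        using inv fin_graph_induced[OF assms(2)] H
        by (auto simp: graph_invariant_def A_def elim!: iso_repsE)
    qed simp
    then show "lam H i * of_nat (ind H G) = (\<Sum>S\<in>A H. lam (induced G S) i)"
      by (simp add: ind_def A_def)
  qed simp
  also have "\<dots> = (\<Sum>S\<in>(\<Union>H\<in>iso_reps (\<alpha> * i). A H). lam (induced G S) i)"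
  proof (rule sum.UNION_disjoint[symmetric])
    show "\<forall>H\<in>iso_reps (\<alpha> * i). \<forall>H'\<in>iso_reps (\<alpha> * i). H \<noteq> H' \<longrightarrow> A H \<inter> A H' = {}"
    proof (intro ballI impI equals0I)
      fix H H' S
      assume HH': "H \<in> iso_reps (\<alpha> * i)" "H' \<in> iso_reps (\<alpha> * i)" "H \<noteq> H'" "S \<in> A H \<inter> A H'"
      then have "fin_graph (induced G S)" using assms(2) by (auto simp: A_def fin_graph_induced)
      moreover have "isomorphic (induced G S) H" "isomorphic (induced G S) H'"
        using HH'(4) by (auto simp: A_def)
      ultimately have "isomorphic H H'" using isomorphic_trans isomorphic_sym by metis
      then show False using iso_reps_unique HH' by blast
    qed
  qed (use finite_iso_reps finA in auto)
  also have "(\<Union>H\<in>iso_reps (\<alpha> * i). A H) = {S \<in> Pow (verts G). card S \<le> \<alpha> * i}"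
  proof (intro equalityI subsetI)
    fix S assume "S \<in> (\<Union>H\<in>iso_reps (\<alpha> * i). A H)"
    then show "S \<in> {S \<in> Pow (verts G). card S \<le> \<alpha> * i}"
      using isomorphic_card[of "induced G S"] by (auto simp: A_def elim!: iso_repsE)
  next
    fix S assume "S \<in> {S \<in> Pow (verts G). card S \<le> \<alpha> * i}"
    then show "S \<in> (\<Union>H\<in>iso_reps (\<alpha> * i). A H)"
      using iso_reps_exists[of "induced G S" "\<alpha> * i"] fin_graph_induced[OF assms(2), of S]
      by (auto simp: A_def)
  qed
  also have "(\<Sum>S\<in>{S \<in> Pow (verts G). card S \<le> \<alpha> * i}. lam (induced G S) i) =
      (\<Sum>S\<in>Pow (verts G). if card S \<le> \<alpha> * i then lam (induced G S) i else 0)"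
    by (rule sum.inter_filter) (simp add: fin)
  finally show ?thesis .
qed

text \<open>Strong induction on \<open>j\<close> along Newton's identities: degrees add under
  multiplication, and \<open>\<alpha> * i + \<alpha> * (j - i) = \<alpha> * j\<close>.\<close>

lemma moebius_degree_le_power_sum:
  assumes "bigcp \<alpha> \<beta> lam Q p" "fin_graph G" "0 < j"
  shows "moebius_degree_le (verts G) (\<alpha> * j) (\<lambda>T. inverse_power_sum (p (induced G T)) j)"
  using assms(3)
proof (induction j rule: less_induct)
  case (less j)
  let ?V = "verts G"
  let ?e = "\<lambda>i T. coeff (p (induced G T)) i" and ?P = "\<lambda>j T. inverse_power_sum (p (induced G T)) j"
  have fin: "finite ?V" using assms(2) by (simp add: fin_graph_def)
  have e: "moebius_degree_le ?V (\<alpha> * i) (?e i)" for i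
    unfolding moebius_degree_le_def
  proof (intro allI impI)
    fix S assume S: "S \<subseteq> ?V" "\<alpha> * i < card S"
    \<comment> \<open>For every \<open>T\<close> inside \<open>S\<close> the coefficient of
      \<open>induced G T\<close> is a sum over subsets of \<open>T\<close> with the same summands,
      so uniqueness applies.\<close>
    have "moebius (?e i) S = (if card S \<le> \<alpha> * i then lam (induced G S) i else 0)"
    proof (rule moebius_of_sum)
      show "finite S" using S(1) fin by (rule finite_subset)
      fix T assume "T \<subseteq> S"
      then have "fin_graph (induced G T)" using S(1) assms(2) by (auto intro: fin_graph_induced)
      then show "?e i T = (\<Sum>U\<in>Pow T. if card U \<le> \<alpha> * i then lam (induced G U) i else 0)"
        by (subst coeff_eq_sum_induced[OF assms(1)])
          (auto intro!: sum.cong simp: induced_induced)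
    qed
    then show "moebius (?e i) S = 0" using S(2) by simp
  qed
  have "moebius_degree_le ?V (\<alpha> * j) (\<lambda>T. ?e i T * ?P (j - i) T)" if "i \<in> {1..<j}" for i
  proof -
    have "moebius_degree_le ?V (\<alpha> * (j - i)) (?P (j - i))" using that by (intro less.IH) auto
    then have "moebius_degree_le ?V (\<alpha> * i + \<alpha> * (j - i)) (\<lambda>T. ?e i T * ?P (j - i) T)"
      by (rule moebius_degree_le_mult[OF fin e])
    moreover have "\<alpha> * i + \<alpha> * (j - i) = \<alpha> * j"
      using that by (simp flip: distrib_left)
    ultimately show ?thesis by simp
  qed
  then have "moebius_degree_le ?V (\<alpha> * j)
      (\<lambda>T. (-1) * (of_nat j * ?e j T + (\<Sum>i\<in>{1..<j}. ?e i T * ?P (j - i) T)))"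
    by (intro moebius_degree_le_cmult moebius_degree_le_add moebius_degree_le_sum e)
  moreover have "?P j T = (-1) * (of_nat j * ?e j T + (\<Sum>i\<in>{1..<j}. ?e i T * ?P (j - i) T))"
    if "T \<subseteq> ?V" for T
    using assms(1,2) that less.prems
    by (subst newton_identity) (auto simp: bigcp_coeff_0[OF assms(1)] fin_graph_induced)
  ultimately show ?case
    unfolding moebius_degree_le_def by (metis (no_types, lifting) moebius_cong order_trans)
qed

text \<open>Connectivity is encoded by a way to build the set, each vertex being adjacent to an
  earlier one; the first phase of the algorithm adds vertices in just this way. The empty set is
  included as the start of every construction.\<close>

inductive connected_set :: "graph \<Rightarrow> nat set \<Rightarrow> bool" for G where
  empty: "connected_set G {}"
| insert: "connected_set G S \<Longrightarrow> v \<in> verts G \<Longrightarrow> v \<notin> S \<Longrightarrow> S = {} \<or> (\<exists>u\<in>S. {u, v} \<in> edges G) \<Longrightarrow>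
    connected_set G (insert v S)"

lemma connected_set_finite_subset:
  "connected_set G S \<Longrightarrow> finite S \<and> S \<subseteq> verts G"
  by (induction rule: connected_set.induct) auto

text \<open>A maximal nonempty connected subset \<open>A\<close> of \<open>S\<close> has no edge to
  the rest, since the other end could be added to it. Singletons show that some such subset
  exists.\<close>

lemma not_connected_set_split:
  assumes "finite S" "S \<subseteq> verts G" "\<not> connected_set G S"
  obtains A B where "A \<union> B = S" "A \<inter> B = {}" "A \<noteq> {}" "B \<noteq> {}"
    "\<And>u v. u \<in> A \<Longrightarrow> v \<in> B \<Longrightarrow> {u, v} \<notin> edges G"
proof -
  have "S \<noteq> {}" using assms(3) connected_set.empty by auto
  then obtain x where x: "x \<in> S" by auto
  define D where "D = {A. A \<subseteq> S \<and> A \<noteq> {} \<and> connected_set G A}"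
  have "connected_set G {x}"
    using connected_set.insert[OF connected_set.empty, of x] x assms(2) by auto
  then have "D \<noteq> {}" "finite D"
    using x assms(1) finite_subset[of D "Pow S"] by (auto simp: D_def)
  then obtain A where A: "A \<in> D" "\<And>A'. A' \<in> D \<Longrightarrow> A \<subseteq> A' \<Longrightarrow> A' = A"
    using finite_has_maximal[of D] by metis
  show thesis
  proof (rule that[of A "S - A"])
    show "A \<union> (S - A) = S" "A \<inter> (S - A) = {}" "A \<noteq> {}" using A(1) by (auto simp: D_def)
    show "S - A \<noteq> {}" using A(1) assms(3) by (auto simp: D_def)
    fix u v assume uv: "u \<in> A" "v \<in> S - A"
    show "{u, v} \<notin> edges G"
    proof
      assume "{u, v} \<in> edges G"
      then have "connected_set G (insert v A)"
        using uv A(1) assms(2) by (intro connected_set.insert) (auto simp: D_def)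
      then have "insert v A \<in> D" using uv A(1) by (auto simp: D_def)
      then show False using A(2) uv by blast
    qed
  qed
qed

lemma moebius_power_sum_not_connected:
  assumes "bigcp \<alpha> \<beta> lam Q p" "fin_graph G" "S \<subseteq> verts G" "\<not> connected_set G S"
  shows "moebius (\<lambda>T. inverse_power_sum (p (induced G T)) j) S = 0"
proof -
  have "finite S" using assms(2,3) by (auto simp: fin_graph_def intro: finite_subset)
  then obtain A B where AB: "A \<union> B = S" "A \<inter> B = {}" "A \<noteq> {}" "B \<noteq> {}"
    "\<And>u v. u \<in> A \<Longrightarrow> v \<in> B \<Longrightarrow> {u, v} \<notin> edges G"
    using not_connected_set_split[OF _ assms(3,4)] by (smt (verit))
  show ?thesis
  proof (rule moebius_additive_eq_0[OF \<open>finite S\<close> AB(1-4)])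
    fix T assume T: "T \<subseteq> S"
    \<comment> \<open>An edge has two ends and none crosses between \<open>A\<close> and
      \<open>B\<close>, so \<open>induced G T\<close> is a disjoint union.\<close>
    have "e \<subseteq> A \<or> e \<subseteq> B" if e: "e \<in> edges G" "e \<subseteq> T" for e
    proof -
      have "card e = 2" using e(1) assms(2) by (auto simp: fin_graph_def)
      then obtain u v where "e = {u, v}" by (auto simp: card_2_iff)
      then show ?thesis using AB(1,5) e T by (metis UnE doubleton_eq_iff empty_subsetI insert_subset subsetD)
    qed
    then have "induced G T = graph_union (induced G (T \<inter> A)) (induced G (T \<inter> B))"
      using T AB(1) by (auto simp: induced_def graph_union_def)
    moreover have fins: "fin_graph (induced G (T \<inter> A))" "fin_graph (induced G (T \<inter> B))"
      using T assms(2,3) by (auto intro!: fin_graph_induced)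
    ultimately have "p (induced G T) = p (induced G (T \<inter> A)) * p (induced G (T \<inter> B))"
      using AB(2) by (simp only:) (rule bigcp_union[OF assms(1)], auto)
    \<comment> \<open>The constant coefficients are 1, so both factors are nonzero and the roots of
      the product are those of the factors taken together.\<close>
    moreover have "p (induced G (T \<inter> A)) \<noteq> 0" "p (induced G (T \<inter> B)) \<noteq> 0"
      using fins[THEN bigcp_coeff_0[OF assms(1)]] by auto
    ultimately show "inverse_power_sum (p (induced G T)) j =
        inverse_power_sum (p (induced G (T \<inter> A))) j + inverse_power_sum (p (induced G (T \<inter> B))) j"
      by (simp add: inverse_power_sum_mult)
  qed
qed

text \<open>Outside \<open>F\<close> the transform vanishes, for lack of connectivity or by degree.
  Further members of \<open>F\<close> do no harm, so a single family can serve all \<open>j\<close>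
  up to \<open>m\<close>.\<close>

lemma inverse_power_sum_localised:
  assumes "bigcp \<alpha> \<beta> lam Q p" "fin_graph G" "0 < j"
    and "F \<subseteq> Pow (verts G)" "\<And>S. connected_set G S \<Longrightarrow> card S \<le> \<alpha> * j \<Longrightarrow> S \<in> F"
  shows "inverse_power_sum (p G) j =
    (\<Sum>S\<in>F. moebius (\<lambda>T. inverse_power_sum (p (induced G T)) j) S)"
proof -
  let ?P = "\<lambda>T. inverse_power_sum (p (induced G T)) j"
  have fin: "finite (verts G)" using assms(2) by (simp add: fin_graph_def)
  have "(\<Sum>S\<in>F. moebius ?P S) = (\<Sum>S\<in>Pow (verts G). moebius ?P S)"
  proof (rule sum.mono_neutral_left)
    show "\<forall>S\<in>Pow (verts G) - F. moebius ?P S = 0"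
    proof
      fix S assume S: "S \<in> Pow (verts G) - F"
      then have "\<not> connected_set G S \<or> \<alpha> * j < card S" using assms(5)[of S] by force
      then show "moebius ?P S = 0"
        using S moebius_power_sum_not_connected[OF assms(1,2)]
          moebius_degree_le_power_sum[OF assms(1-3)]
        by (auto simp: moebius_degree_le_def)
    qed
  qed (use assms(4) fin in auto)
  also have "\<dots> = inverse_power_sum (p G) j"
    by (simp add: sum_moebius fin induced_verts assms(2))
  finally show ?thesis by simp
qed

section \<open>Counting connected sets\<close>

definition neighbours :: "graph \<Rightarrow> nat \<Rightarrow> nat set" where
  "neighbours G v = {u \<in> verts G. {u, v} \<in> edges G}"

fun walks :: "graph \<Rightarrow> nat \<Rightarrow> nat list set" where
  "walks G 0 = (\<lambda>v. [v]) ` verts G"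
| "walks G (Suc l) = (\<Union>w\<in>walks G l. (\<lambda>u. u # w) ` neighbours G (hd w))"

lemma walks_finite_card:
  assumes "fin_graph G" "max_degree_le G \<Delta>"
  shows "finite (walks G l) \<and> card (walks G l) \<le> card (verts G) * \<Delta> ^ l"
proof -
  have fin: "finite (verts G)" using assms(1) by (simp add: fin_graph_def)
  have hd: "hd w \<in> verts G" if "w \<in> walks G l" for w l
    using that by (cases l) (auto simp: neighbours_def)
  have nb: "finite (neighbours G v) \<and> card (neighbours G v) \<le> \<Delta>" if "v \<in> verts G" for v
    using assms(2) that fin by (auto simp: neighbours_def max_degree_le_def)
  show ?thesis
  proof (induction l)
    case 0
    then show ?case using fin by (auto intro: card_image_le)
  next
    case (Suc l)
    have "card (walks G (Suc l)) \<le> (\<Sum>w\<in>walks G l. card ((\<lambda>u. u # w) ` neighbours G (hd w)))"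
      using Suc by (auto intro: card_UN_le)
    also have "\<dots> \<le> (\<Sum>w\<in>walks G l. \<Delta>)"
    proof (rule sum_mono)
      fix w assume "w \<in> walks G l"
      then have "finite (neighbours G (hd w))" "card (neighbours G (hd w)) \<le> \<Delta>" using hd nb by auto
      then show "card ((\<lambda>u. u # w) ` neighbours G (hd w)) \<le> \<Delta>"
        using card_image_le order_trans by blast
    qed
    also have "\<dots> = card (walks G l) * \<Delta>" by simp
    also have "\<dots> \<le> card (verts G) * \<Delta> ^ l * \<Delta>" using Suc by (intro mult_right_mono) auto
    finally show ?case using Suc hd nb by (auto simp: ac_simps)
  qed
qed

text \<open>The recursion extends a walk only at its head; a description by indices allows a detour
  to be inserted in the middle.\<close>

lemma in_walks_iff:
  "xs \<in> walks G l \<longleftrightarrow> length xs = Suc l \<and> set xs \<subseteq> verts G \<and>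
     (\<forall>i<l. {xs ! i, xs ! Suc i} \<in> edges G)"
proof (induction l arbitrary: xs)
  case 0
  then show ?case by (cases xs) auto
next
  case (Suc l)
  show ?case
  proof (cases xs)
    case (Cons u w)
    have "xs \<in> walks G (Suc l) \<longleftrightarrow> w \<in> walks G l \<and> u \<in> neighbours G (hd w)"
      using Cons by auto
    also have "\<dots> \<longleftrightarrow> length w = Suc l \<and> set w \<subseteq> verts G \<and> u \<in> verts G \<and> {u, w ! 0} \<in> edges G \<and>
        (\<forall>i<l. {w ! i, w ! Suc i} \<in> edges G)"
      unfolding Suc.IH neighbours_def by (cases w) auto
    finally show ?thesis using Cons by (auto simp: All_less_Suc2)
  qed auto
qed

text \<open>A depth-first traversal of a connected set is a closed walk, which extends over a new vertex
  \<open>v\<close> adjacent to \<open>u\<close> by the detour \<open>u, v, u\<close>.\<close>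

lemma connected_set_walk:
  assumes "connected_set G S" "S \<noteq> {}"
  shows "S \<in> set ` walks G (2 * (card S - 1))"
  using assms
proof (induction rule: connected_set.induct)
  case (insert S v)
  have fin: "finite S" using insert.hyps(1) connected_set_finite_subset by blast
  show ?case
  proof (cases "S = {}")
    case True
    then show ?thesis using insert.hyps by (auto simp: image_image)
  next
    case False
    then obtain xs u where xs: "xs \<in> walks G (2 * (card S - 1))" "set xs = S"
      and u: "u \<in> S" "{u, v} \<in> edges G"
      using insert by auto
    obtain ys zs where yz: "xs = ys @ u # zs" using u(1) xs(2) split_list by metis
    let ?l = "length ys"
    have len: "length xs = Suc (2 * (card S - 1))"
      and adj: "\<And>i. i < 2 * (card S - 1) \<Longrightarrow> {xs ! i, xs ! Suc i} \<in> edges G"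
      and sub: "set xs \<subseteq> verts G"
      using xs(1) by (auto simp: in_walks_iff)
    have cS: "card S \<ge> 1" using False fin by (simp add: card_gt_0_iff Suc_le_eq)
    have card: "2 * (card (insert v S) - 1) = length xs + 1"
      using insert.hyps(3) fin len cS by simp
    let ?ws = "ys @ u # v # u # zs"
    have "?ws \<in> walks G (2 * (card (insert v S) - 1))"
      unfolding in_walks_iff card
    proof (intro conjI allI impI)
      show "set ?ws \<subseteq> verts G" using sub yz insert.hyps(2) by auto
      fix i assume i: "i < length xs + 1"
      \<comment> \<open>Steps up to the chosen \<open>u\<close>, the step from \<open>u\<close> to
        \<open>v\<close>, the step back, and the later steps of the old walk, shifted by 2.\<close>
      consider "Suc i < Suc ?l" | "i = ?l" | "i = Suc ?l" | j where "i = j + 2" "?l \<le> j" "Suc j < length xs"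
      proof -
        have "i < ?l \<or> i = ?l \<or> i = Suc ?l \<or> (i = (i - 2) + 2 \<and> ?l \<le> i - 2 \<and> Suc (i - 2) < length xs)"
          using i by arith
        then show thesis using that by auto
      qed
      then show "{?ws ! i, ?ws ! Suc i} \<in> edges G"
      proof cases
        case 1
        then have "?ws ! i = xs ! i" "?ws ! Suc i = xs ! Suc i"
          by (auto simp: yz nth_append)
        moreover have "i < 2 * (card S - 1)" using 1 len by (simp add: yz)
        ultimately show ?thesis using adj by simp
      next
        case 2
        then show ?thesis using u by (simp add: nth_append)
      next
        case 3
        then show ?thesis using u by (simp add: nth_append insert_commute)
      next
        case (4 j)
        then have "?ws ! i = xs ! j" "?ws ! Suc i = xs ! Suc j"
          by (auto simp: yz nth_append nth_Cons' Suc_diff_le)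
        moreover have "j < 2 * (card S - 1)" using 4 len by simp
        ultimately show ?thesis using adj by simp
      qed
    qed (use yz in auto)
    moreover have "set ?ws = insert v S" using xs(2) yz by auto
    ultimately show ?thesis by blast
  qed
qed simp

text \<open>A nonempty connected set is the vertex set of a walk, and walks are counted by their
  start and at most \<open>\<Delta>\<close> choices per step. The summand 1 is for the empty
  set.\<close>

lemma card_connected_sets:
  assumes "fin_graph G" "max_degree_le G \<Delta>"
  shows "card {S. connected_set G S \<and> card S \<le> k} \<le> 1 + k * (card (verts G) * (\<Delta> + 1) ^ (2 * k))"
proof -
  let ?C = "{S. connected_set G S \<and> card S \<le> k}"
  let ?W = "\<Union>l<k. set ` walks G (2 * l)"
  have W: "finite (walks G l)" "card (walks G l) \<le> card (verts G) * \<Delta> ^ l" for l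
    using walks_finite_card[OF assms, of l] by auto
  have "?C \<subseteq> insert {} ?W"
  proof
    fix S assume S: "S \<in> ?C"
    show "S \<in> insert {} ?W"
    proof (cases "S = {}")
      case False
      then have "card S - 1 < k"
        using S connected_set_finite_subset[of G S] by (auto simp: card_gt_0_iff less_diff_conv2 Suc_le_eq)
      then show ?thesis using connected_set_walk[of G S] S False by blast
    qed simp
  qed
  then have "card ?C \<le> card (insert {} ?W)" using W by (intro card_mono) auto
  also have "\<dots> \<le> 1 + card ?W" by (simp add: card_insert_le_m1 card_insert_if W)
  also have "card ?W \<le> (\<Sum>l<k. card (set ` walks G (2 * l)))" by (rule card_UN_le) simp
  also have "\<dots> \<le> (\<Sum>l<k. card (verts G) * (\<Delta> + 1) ^ (2 * k))"
  proof (rule sum_mono)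
    fix l assume "l \<in> {..<k}"
    have "card (set ` walks G (2 * l)) \<le> card (walks G (2 * l))" by (rule card_image_le) (rule W)
    also have "\<dots> \<le> card (verts G) * \<Delta> ^ (2 * l)" by (rule W)
    \<comment> \<open>The base \<open>\<Delta> + 1\<close> makes powers monotone in the exponent
      even for \<open>\<Delta> = 0\<close>.\<close>
    also have "\<Delta> ^ (2 * l) \<le> (\<Delta> + 1) ^ (2 * l)" by (rule power_mono) auto
    also have "(\<Delta> + 1) ^ (2 * l) \<le> (\<Delta> + 1) ^ (2 * k)"
      using \<open>l \<in> {..<k}\<close> by (intro power_increasing) auto
    finally show "card (set ` walks G (2 * l)) \<le> card (verts G) * (\<Delta> + 1) ^ (2 * k)" by simp
  qed
  also have "\<dots> = k * (card (verts G) * (\<Delta> + 1) ^ (2 * k))" by simp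
  finally show ?thesis by simp
qed

lemma card_subsets_connected_sets:
  fixes k :: nat
  assumes "fin_graph G" "max_degree_le G \<Delta>"
  defines "F \<equiv> {U. \<exists>S. connected_set G S \<and> card S \<le> k \<and> U \<subseteq> S}"
  shows "finite F" and "card F \<le> (1 + k * (card (verts G) * (\<Delta> + 1) ^ (2 * k))) * 2 ^ k"
proof -
  let ?C = "{S. connected_set G S \<and> card S \<le> k}"
  have F: "F = (\<Union>S\<in>?C. Pow S)" by (auto simp: F_def)
  have fin: "finite (verts G)" using assms(1) by (simp add: fin_graph_def)
  have finC: "finite ?C"
    by (rule finite_subset[of _ "Pow (verts G)"]) (use fin connected_set_finite_subset in auto)
  then show "finite F" unfolding F using connected_set_finite_subset by auto
  have "card F \<le> (\<Sum>S\<in>?C. card (Pow S))" unfolding F by (rule card_UN_le[OF finC])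
  also have "\<dots> \<le> (\<Sum>S\<in>?C. 2 ^ k)"
    using connected_set_finite_subset by (intro sum_mono) (auto simp: card_Pow)
  also have "\<dots> = card ?C * 2 ^ k" by simp
  also have "\<dots> \<le> (1 + k * (card (verts G) * (\<Delta> + 1) ^ (2 * k))) * 2 ^ k"
    by (intro mult_right_mono card_connected_sets assms) simp
  finally show "card F \<le> (1 + k * (card (verts G) * (\<Delta> + 1) ^ (2 * k))) * 2 ^ k" .
qed

section \<open>Weakest preconditions with running times\<close>

text \<open>Total correctness: a terminating run must exist. The time passed to \<open>Q\<close> is
  counted from the start of \<open>c\<close>, so sequencing adds times.\<close>

definition wp :: "subroutine \<Rightarrow> com \<Rightarrow> state \<Rightarrow> (state \<Rightarrow> nat \<Rightarrow> bool) \<Rightarrow> bool" where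
  "wp sub c s Q \<longleftrightarrow> (\<exists>t s'. exec sub c s t s' \<and> Q s' t)"

lemma wp_mono: "wp sub c s Q \<Longrightarrow> (\<And>s' t. Q s' t \<Longrightarrow> R s' t) \<Longrightarrow> wp sub c s R"
  unfolding wp_def by blast

lemma wp_Skip [simp]: "wp sub Skip s Q \<longleftrightarrow> Q s 1"
  unfolding wp_def using exec.Skip[of sub s] by (auto elim: exec.cases)

lemma wp_NSet [simp]: "wp sub (NSet x i j a) s Q \<longleftrightarrow>
    Q (set_nat x (nval i s) (nval j s) (nval a s) s) (1 + ncost i + ncost j + ncost a)"
  unfolding wp_def using exec.NSet[of sub x i j a s] by (auto elim: exec.cases)

lemma wp_CSet [simp]: "wp sub (CSet x i j a) s Q \<longleftrightarrow>
    Q (set_num x (nval i s) (nval j s) (cval a s) s) (1 + ncost i + ncost j + ccost a)"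
  unfolding wp_def using exec.CSet[of sub x i j a s] by (auto elim: exec.cases)

lemma wp_Seq [simp]:
  "wp sub (Seq c d) s Q \<longleftrightarrow> wp sub c s (\<lambda>s' t. wp sub d s' (\<lambda>s'' t'. Q s'' (t + t')))"
proof
  assume "wp sub (Seq c d) s Q"
  then obtain t s' where "exec sub (Seq c d) s t s'" "Q s' t" unfolding wp_def by blast
  then show "wp sub c s (\<lambda>s' t. wp sub d s' (\<lambda>s'' t'. Q s'' (t + t')))"
    unfolding wp_def by cases blast
qed (unfold wp_def, blast intro: exec.Seq)

lemma wp_If [simp]:
  "wp sub (If b c d) s Q \<longleftrightarrow>
    (if bval b s then wp sub c s (\<lambda>s' t. Q s' (bcost b + t)) else wp sub d s (\<lambda>s' t. Q s' (bcost b + t)))"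
proof
  assume "wp sub (If b c d) s Q"
  then obtain t s' where "exec sub (If b c d) s t s'" "Q s' t" unfolding wp_def by blast
  then show "if bval b s then wp sub c s (\<lambda>s' t. Q s' (bcost b + t)) else wp sub d s (\<lambda>s' t. Q s' (bcost b + t))"
    unfolding wp_def by cases auto
qed (auto simp: wp_def split: if_splits intro: exec.IfTrue exec.IfFalse)

lemma wp_If_True:
  "bval b s \<Longrightarrow> wp sub c s (\<lambda>s' t. Q s' (bcost b + t)) \<Longrightarrow> wp sub (If b c d) s Q"
  by simp

lemma wp_Call:
  assumes "sub (nval k s) (restrict_matrix (nval k s) (nats s a)) (nval i s) z t"
    "Q (set_num b 0 0 z s) (1 + ncost k + ncost i + nval k s * nval k s + t)"
  shows "wp sub (Call a k i b) s Q"
  using assms exec.Call unfolding wp_def by blast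

text \<open>The measure \<open>f\<close> bounds the number of rounds, each costing one test and at
  most \<open>T\<close>; the last summand is the failing test that ends the loop.\<close>

lemma wp_While:
  assumes "\<And>s. I s \<Longrightarrow> bval b s \<Longrightarrow> wp sub c s (\<lambda>s' t. t \<le> T \<and> I s' \<and> f s' < f s)" and "I s"
  shows "wp sub (While b c) s (\<lambda>s' t. I s' \<and> \<not> bval b s' \<and> t \<le> f s * (bcost b + T) + bcost b)"
  using assms(2)
proof (induction "f s" arbitrary: s rule: less_induct)
  case (less s)
  show ?case
  proof (cases "bval b s")
    case True
    obtain t s1 where 1: "exec sub c s t s1" "t \<le> T" "I s1" "f s1 < f s"
      using assms(1)[OF less.prems True] unfolding wp_def by blast
    obtain t' s2 where 2: "exec sub (While b c) s1 t' s2" "I s2" "\<not> bval b s2"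
      "t' \<le> f s1 * (bcost b + T) + bcost b"
      using less.hyps[OF 1(4,3)] unfolding wp_def by blast
    have "Suc (f s1) * (bcost b + T) \<le> f s * (bcost b + T)" using 1(4) by (intro mult_right_mono) auto
    then have "bcost b + t + t' \<le> f s * (bcost b + T) + bcost b" using 1(2) 2(4) by simp
    then show ?thesis
      unfolding wp_def using exec.WhileTrue[OF True 1(1) 2(1)] 2 by blast
  next
    case False
    then show ?thesis unfolding wp_def using exec.WhileFalse[OF False] less.prems by fastforce
  qed
qed

section \<open>State updates and derived commands\<close>

lemma nats_set_nat [simp]: "nats (set_nat x i j v s) y =
    (if y = x then (nats s x)(i := (nats s x i)(j := v)) else nats s y)"
  by (simp add: set_nat_def)

lemma nums_set_nat [simp]: "nums (set_nat x i j v s) = nums s"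
  by (simp add: set_nat_def)

lemma nums_set_num [simp]: "nums (set_num x i j v s) y =
    (if y = x then (nums s x)(i := (nums s x i)(j := v)) else nums s y)"
  by (simp add: set_num_def)

lemma nats_set_num [simp]: "nats (set_num x i j v s) = nats s"
  by (simp add: set_num_def)

abbreviation NVar :: "string \<Rightarrow> nexp" where
  "NVar x \<equiv> NCell x (NConst 0) (NConst 0)"

abbreviation CVar :: "string \<Rightarrow> cexp" where
  "CVar x \<equiv> CCell x (NConst 0) (NConst 0)"

abbreviation Assign :: "string \<Rightarrow> nexp \<Rightarrow> com" where
  "Assign x \<equiv> NSet x (NConst 0) (NConst 0)"

abbreviation CAssign :: "string \<Rightarrow> cexp \<Rightarrow> com" where
  "CAssign x \<equiv> CSet x (NConst 0) (NConst 0)"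

abbreviation NLess :: "nexp \<Rightarrow> nexp \<Rightarrow> bexp" where
  "NLess a b \<equiv> BNot (NLe b a)"

definition For :: "string \<Rightarrow> string \<Rightarrow> com \<Rightarrow> com" where
  "For x y c = Seq (Assign x (NConst 0))
     (While (NLess (NVar x) (NVar y)) (Seq c (Assign x (NAdd (NVar x) (NConst 1)))))"

text \<open>In the lemmas below \<open>M\<close> strictly exceeds the limits of all loops and bounds
  the time of a subroutine call. With one bound for everything, a loop turns a cost
  \<open>a * M ^ d\<close> into a multiple of \<open>M ^ (d + 1)\<close>.\<close>

locale machine =
  fixes sub :: subroutine and M :: nat
  assumes M_ge_1: "1 \<le> M"
begin

lemma M_powers: "1 \<le> M" "M \<le> M\<^sup>2" "M\<^sup>2 \<le> M ^ 3" "M ^ 3 \<le> M ^ 4" "M ^ 4 \<le> M ^ 5"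
  using M_ge_1 power_increasing[of 1 2 M] power_increasing[of 2 3 M] power_increasing[of 3 4 M]
    power_increasing[of 4 5 M] by simp_all

text \<open>The loop invariant \<open>I k\<close> describes the state in which \<open>k\<close> rounds are finished and the loop
  counter has been incremented.\<close>

lemma wp_For:
  assumes "x \<noteq> y" "nats s y 0 0 = n" "n < M"
    and init: "I 0 (set_nat x 0 0 0 s)"
    and step: "\<And>k s. k < n \<Longrightarrow> I k s \<Longrightarrow> nats s x 0 0 = k \<Longrightarrow> nats s y 0 0 = n \<Longrightarrow>
      wp sub c s (\<lambda>s' t. t \<le> a * M ^ d \<and> nats s' x 0 0 = k \<and> nats s' y 0 0 = n \<and>
        I (Suc k) (set_nat x 0 0 (Suc k) s'))"
    and post: "\<And>s' t. I n s' \<Longrightarrow> nats s' x 0 0 = n \<Longrightarrow> t \<le> (a + 20) * M ^ (d + 1) \<Longrightarrow> Q s' t"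
  shows "wp sub (For x y c) s Q"
proof -
  let ?J = "\<lambda>s. I (nats s x 0 0) s \<and> nats s x 0 0 \<le> n \<and> nats s y 0 0 = n"
  let ?b = "NLess (NVar x) (NVar y)" and ?T = "a * M ^ d + 8"
  have wp: "wp sub (While ?b (Seq c (Assign x (NAdd (NVar x) (NConst 1))))) (set_nat x 0 0 0 s)
      (\<lambda>s' t. ?J s' \<and> \<not> bval ?b s' \<and>
        t \<le> (n - nats (set_nat x 0 0 0 s) x 0 0) * (bcost ?b + ?T) + bcost ?b)"
  proof (rule wp_While)
    fix s assume s: "?J s" "bval ?b s"
    have "wp sub c s (\<lambda>s' t. t \<le> a * M ^ d \<and> nats s' x 0 0 = nats s x 0 0 \<and> nats s' y 0 0 = n \<and>
        I (Suc (nats s x 0 0)) (set_nat x 0 0 (Suc (nats s x 0 0)) s'))"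
      using s by (intro step) auto
    then show "wp sub (Seq c (Assign x (NAdd (NVar x) (NConst 1)))) s
        (\<lambda>s' t. t \<le> ?T \<and> ?J s' \<and> n - nats s' x 0 0 < n - nats s x 0 0)"
      unfolding wp_Seq by (rule wp_mono) (use s assms(1) in auto)
  qed (use assms in auto)
  \<comment> \<open>A round costs 16 besides the body: 8 for the test and 8 for the increment. The
    spare round granted by \<open>n < M\<close> pays for the initial assignment (4) and the failing
    test (8).\<close>
  have "Suc (Suc (Suc (Suc t))) \<le> (a + 20) * M ^ (d + 1)" if "t \<le> n * (bcost ?b + ?T) + bcost ?b" for t
  proof -
    have "n * (a * M ^ d + 16) \<le> (M - 1) * (a * M ^ d + 16)"
      using assms(3) by (intro mult_right_mono) auto
    moreover have "t \<le> n * (a * M ^ d + 16) + 8" using that by (simp add: ac_simps)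
    ultimately have "Suc (Suc (Suc (Suc t))) \<le> (M - 1) * (a * M ^ d + 16) + (a * M ^ d + 16)" by linarith
    also have "\<dots> = M * (a * M ^ d + 16)" using M_ge_1 by (cases M) auto
    also have "\<dots> \<le> M * (a * M ^ d + 16 * M ^ d)" using M_ge_1 by simp
    also have "\<dots> \<le> (a + 20) * M ^ (d + 1)" by (simp add: algebra_simps)
    finally show ?thesis .
  qed
  then show ?thesis
    unfolding For_def wp_Seq wp_NSet
    using wp by (auto intro!: post elim!: wp_mono)
qed

end

text \<open>Whole arrays serve as the footprint of a command, and a name stands for an array in each
  memory. Facts about all other arrays then carry over without being listed.\<close>

definition frame :: "string set \<Rightarrow> state \<Rightarrow> state \<Rightarrow> bool" where
  "frame W s s' \<longleftrightarrow> (\<forall>y. y \<notin> W \<longrightarrow> nats s' y = nats s y \<and> nums s' y = nums s y)"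

lemma frame_refl [simp]: "frame W s s"
  by (simp add: frame_def)

lemma frame_trans: "frame W s s' \<Longrightarrow> frame W' s' s'' \<Longrightarrow> W \<subseteq> W'' \<Longrightarrow> W' \<subseteq> W'' \<Longrightarrow> frame W'' s s''"
  unfolding frame_def by (metis subsetD)

lemma frame_set_nat [simp]: "x \<in> W \<Longrightarrow> frame W s (set_nat x i j v s') \<longleftrightarrow> frame W s s'"
  by (auto simp: frame_def)

lemma frame_set_num [simp]: "x \<in> W \<Longrightarrow> frame W s (set_num x i j v s') \<longleftrightarrow> frame W s s'"
  by (auto simp: frame_def)

lemma frame_nats: "frame W s s' \<Longrightarrow> y \<notin> W \<Longrightarrow> nats s' y = nats s y"
  by (simp add: frame_def)

lemma frame_nums: "frame W s s' \<Longrightarrow> y \<notin> W \<Longrightarrow> nums s' y = nums s y"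
  by (simp add: frame_def)

section \<open>Tables of vertex sets\<close>

text \<open>Row \<open>r\<close> of the array \<open>F\<close> holds the characteristic function of a set of vertices.\<close>

definition row :: "state \<Rightarrow> nat \<Rightarrow> nat set" where
  "row s r = {v. v < nats s ''n'' 0 0 \<and> 1 \<le> nats s ''F'' r v}"

definition Subset :: "string \<Rightarrow> string \<Rightarrow> com" where
  "Subset x y = Seq (Assign ''sub'' (NConst 1))
     (For ''w'' ''n'' (If (BAnd (NLe (NConst 1) (NCell ''F'' (NVar x) (NVar ''w'')))
          (NLe (NCell ''F'' (NVar y) (NVar ''w'')) (NConst 0)))
        (Assign ''sub'' (NConst 0)) Skip))"

definition Scan :: com where
  "Scan = Seq (Assign ''cnt'' (NConst 0)) (Seq (Assign ''touch'' (NConst 0))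
     (For ''w'' ''n'' (If (NLe (NConst 1) (NCell ''F'' (NVar ''r'') (NVar ''w'')))
        (Seq (Assign ''cnt'' (NAdd (NVar ''cnt'') (NConst 1)))
             (If (NLe (NConst 1) (NCell ''adj'' (NVar ''w'') (NVar ''u'')))
                (Assign ''touch'' (NConst 1)) Skip))
        Skip)))"

text \<open>The candidate is written into row \<open>N\<close>, just past the table; it joins the
  table only if \<open>Extend\<close> increments \<open>N\<close>. Any positive entry means
  membership, and truncated subtraction turns it into 0.\<close>

definition Flip :: com where
  "Flip = Seq
     (For ''w'' ''n'' (NSet ''F'' (NVar ''N'') (NVar ''w'') (NCell ''F'' (NVar ''r'') (NVar ''w''))))
     (NSet ''F'' (NVar ''N'') (NVar ''u'') (NSub (NConst 1) (NCell ''F'' (NVar ''r'') (NVar ''u''))))"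

definition Find :: com where
  "Find = Seq (Assign ''found'' (NConst 0))
     (For ''x'' ''N'' (Seq (Subset ''x'' ''N'') (If (NLe (NConst 1) (NVar ''sub''))
        (Seq (Subset ''N'' ''x'') (If (NLe (NConst 1) (NVar ''sub''))
           (Assign ''found'' (NConst 1)) Skip))
        Skip)))"

definition Extend :: "bexp \<Rightarrow> com" where
  "Extend b = Seq Scan (If b (Seq Flip (Seq Find (If (NLe (NVar ''found'') (NConst 0))
     (Assign ''N'' (NAdd (NVar ''N'') (NConst 1))) Skip))) Skip)"

text \<open>The table is its own queue: row \<open>r\<close> is tried with every vertex, and new
  sets are appended behind to be treated later. Since \<open>N\<close> grows meanwhile, the outer
  loop has no fixed limit.\<close>

definition Saturate :: "bexp \<Rightarrow> com" where
  "Saturate b = Seq (Assign ''r'' (NConst 0)) (While (NLess (NVar ''r'') (NVar ''N''))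
     (Seq (For ''u'' ''n'' (Extend b)) (Assign ''r'' (NAdd (NVar ''r'') (NConst 1)))))"

text \<open>One operation covers insertion and deletion, so both phases of the algorithm are
  instances of the same saturation.\<close>

definition flip :: "'a set \<Rightarrow> 'a \<Rightarrow> 'a set" where
  "flip S u = (if u \<in> S then S - {u} else insert u S)"

lemma row_cong:
  "nats s ''n'' = nats s' ''n'' \<Longrightarrow> nats s ''F'' = nats s' ''F'' \<Longrightarrow> row s = row s'"
  by (simp add: row_def fun_eq_iff)

lemma row_frame:
  "frame W s s' \<Longrightarrow> ''n'' \<notin> W \<Longrightarrow> ''F'' \<notin> W \<Longrightarrow> row s' = row s"
  by (rule row_cong) (auto simp: frame_def)

lemma finite_row [simp]: "finite (row s r)"
  by (simp add: row_def)

section \<open>Correctness of the table commands\<close>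

context machine
begin

lemma wp_Subset:
  assumes "{x, y} \<inter> {''w'', ''sub'', ''n''} = {}" "nats s ''n'' 0 0 < M"
    and post: "\<And>s' t. frame {''w'', ''sub''} s s' \<Longrightarrow>
      nats s' ''sub'' 0 0 = (if row s (nats s x 0 0) \<subseteq> row s (nats s y 0 0) then 1 else 0) \<Longrightarrow>
      t \<le> 100 * M \<Longrightarrow> Q s' t"
  shows "wp sub (Subset x y) s Q"
proof -
  let ?W = "{''w'', ''sub''}" and ?F = "nats s ''F''" and ?x = "nats s x 0 0" and ?y = "nats s y 0 0"
  let ?I = "\<lambda>k s'. frame ?W s s' \<and>
    nats s' ''sub'' 0 0 = (if \<forall>v<k. 1 \<le> ?F ?x v \<longrightarrow> 1 \<le> ?F ?y v then 1 else 0)"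
  show ?thesis
    unfolding Subset_def wp_Seq wp_NSet
  proof (rule wp_For[where I = ?I and a = 50 and d = 0 and n = "nats s ''n'' 0 0"])
    fix k s' assume I: "?I k s'" "nats s' ''w'' 0 0 = k" and "nats s' ''n'' 0 0 = nats s ''n'' 0 0"
    note [simp] = frame_nats[OF conjunct1[OF I(1)]]
    show "wp sub (If (BAnd (NLe (NConst 1) (NCell ''F'' (NVar x) (NVar ''w'')))
          (NLe (NCell ''F'' (NVar y) (NVar ''w'')) (NConst 0)))
        (Assign ''sub'' (NConst 0)) Skip) s'
      (\<lambda>s' t. t \<le> 50 * M ^ 0 \<and> nats s' ''w'' 0 0 = k \<and> nats s' ''n'' 0 0 = nats s ''n'' 0 0 \<and>
        ?I (Suc k) (set_nat ''w'' 0 0 (Suc k) s'))"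
      using I assms(1) by (auto simp: less_Suc_eq)
  next
    fix s' t assume "?I (nats s ''n'' 0 0) s'" "t \<le> (50 + 20) * M ^ (0 + 1)"
    then show "Q s' (1 + ncost (NConst 0) + ncost (NConst 0) + ncost (NConst 1) + t)"
      using M_ge_1 by (intro post) (auto simp: row_def)
  qed (use assms in auto)
qed

lemma wp_Scan:
  assumes "nats s ''n'' 0 0 < M"
    and post: "\<And>s' t. frame {''w'', ''cnt'', ''touch''} s s' \<Longrightarrow>
      nats s' ''cnt'' 0 0 = card (row s (nats s ''r'' 0 0)) \<Longrightarrow>
      (1 \<le> nats s' ''touch'' 0 0 \<longleftrightarrow>
        (\<exists>v\<in>row s (nats s ''r'' 0 0). 1 \<le> nats s ''adj'' v (nats s ''u'' 0 0))) \<Longrightarrow>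
      t \<le> 100 * M \<Longrightarrow> Q s' t"
  shows "wp sub Scan s Q"
proof -
  let ?W = "{''w'', ''cnt'', ''touch''}" and ?r = "nats s ''r'' 0 0" and ?u = "nats s ''u'' 0 0"
  let ?R = "\<lambda>k. {v. v < k \<and> 1 \<le> nats s ''F'' ?r v}"
  let ?I = "\<lambda>k s'. frame ?W s s' \<and> nats s' ''cnt'' 0 0 = card (?R k) \<and>
    (1 \<le> nats s' ''touch'' 0 0 \<longleftrightarrow> (\<exists>v\<in>?R k. 1 \<le> nats s ''adj'' v ?u))"
  have R: "?R (Suc k) = (if 1 \<le> nats s ''F'' ?r k then insert k (?R k) else ?R k)" for k
    by (auto simp: less_Suc_eq)
  show ?thesis
    unfolding Scan_def wp_Seq wp_NSet
  proof (rule wp_For[where I = ?I and a = 50 and d = 0 and n = "nats s ''n'' 0 0"])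
    fix k s' assume I: "?I k s'" "nats s' ''w'' 0 0 = k" "nats s' ''n'' 0 0 = nats s ''n'' 0 0"
    note [simp] = frame_nats[OF conjunct1[OF I(1)]]
    show "wp sub (If (NLe (NConst 1) (NCell ''F'' (NVar ''r'') (NVar ''w'')))
        (Seq (Assign ''cnt'' (NAdd (NVar ''cnt'') (NConst 1)))
             (If (NLe (NConst 1) (NCell ''adj'' (NVar ''w'') (NVar ''u'')))
                (Assign ''touch'' (NConst 1)) Skip))
        Skip) s'
      (\<lambda>s' t. t \<le> 50 * M ^ 0 \<and> nats s' ''w'' 0 0 = k \<and> nats s' ''n'' 0 0 = nats s ''n'' 0 0 \<and>
        ?I (Suc k) (set_nat ''w'' 0 0 (Suc k) s'))"
      unfolding R using I by auto
  next
    fix s' t assume "?I (nats s ''n'' 0 0) s'" "t \<le> (50 + 20) * M ^ (0 + 1)"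
    then show "Q s' (1 + ncost (NConst 0) + ncost (NConst 0) + ncost (NConst 0) +
        (1 + ncost (NConst 0) + ncost (NConst 0) + ncost (NConst 0) + t))"
      using M_ge_1 by (intro post) (auto simp: row_def)
  qed (use assms in auto)
qed

lemma wp_Flip:
  assumes "nats s ''n'' 0 0 < M" "nats s ''r'' 0 0 \<noteq> nats s ''N'' 0 0"
    "nats s ''u'' 0 0 < nats s ''n'' 0 0"
    and post: "\<And>s' t. frame {''w'', ''F''} s s' \<Longrightarrow>
      (\<And>i. row s' i = (if i = nats s ''N'' 0 0
        then flip (row s (nats s ''r'' 0 0)) (nats s ''u'' 0 0) else row s i)) \<Longrightarrow>
      t \<le> 100 * M \<Longrightarrow> Q s' t"
  shows "wp sub Flip s Q"
proof -
  let ?W = "{''w'', ''F''}" and ?r = "nats s ''r'' 0 0" and ?N = "nats s ''N'' 0 0" and ?F = "nats s ''F''"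
  let ?I = "\<lambda>k s'. frame ?W s s' \<and> (\<forall>i. i \<noteq> ?N \<longrightarrow> nats s' ''F'' i = ?F i) \<and>
    (\<forall>v<k. nats s' ''F'' ?N v = ?F ?r v)"
  show ?thesis
    unfolding Flip_def wp_Seq
  proof (rule wp_For[where I = ?I and a = 50 and d = 0 and n = "nats s ''n'' 0 0"])
    fix k s' assume I: "?I k s'" "nats s' ''w'' 0 0 = k" "nats s' ''n'' 0 0 = nats s ''n'' 0 0"
    note [simp] = frame_nats[OF conjunct1[OF I(1)]]
    show "wp sub (NSet ''F'' (NVar ''N'') (NVar ''w'') (NCell ''F'' (NVar ''r'') (NVar ''w''))) s'
      (\<lambda>s' t. t \<le> 50 * M ^ 0 \<and> nats s' ''w'' 0 0 = k \<and> nats s' ''n'' 0 0 = nats s ''n'' 0 0 \<and>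
        ?I (Suc k) (set_nat ''w'' 0 0 (Suc k) s'))"
      using I assms(2) by (auto simp: less_Suc_eq)
  next
    fix s' t assume I: "?I (nats s ''n'' 0 0) s'" and t: "t \<le> (50 + 20) * M ^ (0 + 1)"
    note [simp] = frame_nats[OF conjunct1[OF I]]
    show "wp sub (NSet ''F'' (NVar ''N'') (NVar ''u'')
        (NSub (NConst 1) (NCell ''F'' (NVar ''r'') (NVar ''u'')))) s' (\<lambda>s'' t'. Q s'' (t + t'))"
      unfolding wp_NSet
    proof (rule post)
      fix i
      show "row (set_nat ''F'' (nval (NVar ''N'') s') (nval (NVar ''u'') s')
          (nval (NSub (NConst 1) (NCell ''F'' (NVar ''r'') (NVar ''u''))) s') s') i =
        (if i = ?N then flip (row s ?r) (nats s ''u'' 0 0) else row s i)"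
        using I assms(2,3) by (auto simp: row_def flip_def split: if_splits)
    qed (use I t M_ge_1 in auto)
  qed (use assms in auto)
qed

lemma wp_Find:
  assumes "nats s ''n'' 0 0 < M" "nats s ''N'' 0 0 < M"
    and post: "\<And>s' t. frame {''w'', ''sub'', ''x'', ''found''} s s' \<Longrightarrow>
      (1 \<le> nats s' ''found'' 0 0 \<longleftrightarrow> (\<exists>i<nats s ''N'' 0 0. row s i = row s (nats s ''N'' 0 0))) \<Longrightarrow>
      t \<le> 300 * M\<^sup>2 \<Longrightarrow> Q s' t"
  shows "wp sub Find s Q"
proof -
  let ?W = "{''w'', ''sub'', ''x'', ''found''}" and ?N = "nats s ''N'' 0 0"
  let ?I = "\<lambda>k s'. frame ?W s s' \<and> (1 \<le> nats s' ''found'' 0 0 \<longleftrightarrow> (\<exists>i<k. row s i = row s ?N))"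
  show ?thesis
    unfolding Find_def wp_Seq wp_NSet
  proof (rule wp_For[where I = ?I and a = 250 and d = 1 and n = ?N])
    fix k s1 assume I: "?I k s1" "nats s1 ''x'' 0 0 = k" and k: "k < ?N"
    note [simp] = frame_nats[OF conjunct1[OF I(1)]] row_frame[OF conjunct1[OF I(1)]]
    let ?Q = "\<lambda>s' t. t \<le> 250 * M ^ 1 \<and> nats s' ''x'' 0 0 = k \<and> nats s' ''N'' 0 0 = ?N \<and>
        ?I (Suc k) (set_nat ''x'' 0 0 (Suc k) s')"
    show "wp sub (Seq (Subset ''x'' ''N'') (If (NLe (NConst 1) (NVar ''sub''))
        (Seq (Subset ''N'' ''x'') (If (NLe (NConst 1) (NVar ''sub''))
           (Assign ''found'' (NConst 1)) Skip))
        Skip)) s1 ?Q"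
      unfolding wp_Seq
    proof (rule wp_Subset)
      fix s2 t2 assume fr: "frame {''w'', ''sub''} s1 s2" and t2: "t2 \<le> 100 * M"
        and sub: "nats s2 ''sub'' 0 0 = (if row s1 (nats s1 ''x'' 0 0) \<subseteq> row s1 (nats s1 ''N'' 0 0) then 1 else 0)"
      note [simp] = frame_nats[OF fr] row_frame[OF fr]
      have fr2: "frame ?W s s2" by (rule frame_trans[OF conjunct1[OF I(1)] fr]) auto
      show "wp sub (If (NLe (NConst 1) (NVar ''sub''))
        (Seq (Subset ''N'' ''x'') (If (NLe (NConst 1) (NVar ''sub''))
           (Assign ''found'' (NConst 1)) Skip))
        Skip) s2 (\<lambda>s' t'. ?Q s' (t2 + t'))"
      proof (cases "row s k \<subseteq> row s ?N")
        case True
        then have 1: "bval (NLe (NConst 1) (NVar ''sub'')) s2" using sub I by simp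
        show ?thesis
        proof (rule wp_If_True[OF 1], unfold wp_Seq, rule wp_Subset)
          fix s3 t3 assume fr: "frame {''w'', ''sub''} s2 s3" and t3: "t3 \<le> 100 * M"
            and sub: "nats s3 ''sub'' 0 0 = (if row s2 (nats s2 ''N'' 0 0) \<subseteq> row s2 (nats s2 ''x'' 0 0) then 1 else 0)"
          note [simp] = frame_nats[OF fr] row_frame[OF fr]
          have fr3: "frame ?W s s3" by (rule frame_trans[OF fr2 fr]) auto
          show "wp sub (If (NLe (NConst 1) (NVar ''sub'')) (Assign ''found'' (NConst 1)) Skip) s3
             (\<lambda>s' t'. ?Q s' (t2 + (bcost (NLe (NConst 1) (NVar ''sub'')) + (t3 + t'))))"
            using sub I True fr3 t2 t3 M_ge_1 by (auto simp: less_Suc_eq)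
        qed (use assms in auto)
      next
        case False
        then have "row s k \<noteq> row s ?N" by auto
        then show ?thesis
          using sub I False fr2 t2 M_ge_1 by (auto simp: less_Suc_eq)
      qed
    qed (use assms in auto)
  next
    fix s' t assume "?I ?N s'" and t: "t \<le> (250 + 20) * M ^ (1 + 1)"
    moreover have "t \<le> 270 * M\<^sup>2" using t by (simp add: power2_eq_square)
    ultimately show "Q s' (1 + ncost (NConst 0) + ncost (NConst 0) + ncost (NConst 0) + t)"
      using M_powers by (intro post) auto
  qed (use assms in auto)
qed

text \<open>Distinctness of the rows makes \<open>N\<close> the cardinality of \<open>X\<close>.
  This bounds the loops over the table and turns sums over rows into sums over sets.\<close>

definition table :: "state \<Rightarrow> nat set set \<Rightarrow> bool" where
  "table s X \<longleftrightarrow> inj_on (row s) {..<nats s ''N'' 0 0} \<and> row s ` {..<nats s ''N'' 0 0} = X"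

lemma table_card: "table s X \<Longrightarrow> card X = nats s ''N'' 0 0"
  unfolding table_def by (metis card_image card_lessThan)

lemma table_cong:
  "row s' = row s \<Longrightarrow> nats s' ''N'' 0 0 = nats s ''N'' 0 0 \<Longrightarrow> table s' X \<longleftrightarrow> table s X"
  by (simp add: table_def)

abbreviation "extend_vars \<equiv> {''w'', ''cnt'', ''touch'', ''F'', ''sub'', ''x'', ''found'', ''N''}"

text \<open>The predicate \<open>P\<close> abstracts the test \<open>b\<close> to a condition on a
  set and a vertex. Rows below the old \<open>N\<close> are kept, so a tabulated set never changes
  its index.\<close>

lemma wp_Extend:
  assumes n: "nats s ''n'' 0 0 < M" and N: "nats s ''N'' 0 0 < M"
    and r: "nats s ''r'' 0 0 < nats s ''N'' 0 0" and u: "nats s ''u'' 0 0 < nats s ''n'' 0 0"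
    and b: "\<And>s'. frame {''w'', ''cnt'', ''touch''} s s' \<Longrightarrow>
      nats s' ''cnt'' 0 0 = card (row s (nats s ''r'' 0 0)) \<Longrightarrow>
      (1 \<le> nats s' ''touch'' 0 0 \<longleftrightarrow>
        (\<exists>v\<in>row s (nats s ''r'' 0 0). 1 \<le> nats s ''adj'' v (nats s ''u'' 0 0))) \<Longrightarrow>
      bval b s' \<longleftrightarrow> P (row s (nats s ''r'' 0 0)) (nats s ''u'' 0 0)"
    and cost: "bcost b \<le> 100"
    and table: "table s X"
    and post: "\<And>s' t. frame extend_vars s s' \<Longrightarrow>
      (\<And>i. i < nats s ''N'' 0 0 \<Longrightarrow> row s' i = row s i) \<Longrightarrow>
      table s' (if P (row s (nats s ''r'' 0 0)) (nats s ''u'' 0 0)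
        then insert (flip (row s (nats s ''r'' 0 0)) (nats s ''u'' 0 0)) X else X) \<Longrightarrow>
      nats s ''N'' 0 0 \<le> nats s' ''N'' 0 0 \<Longrightarrow> t \<le> 700 * M\<^sup>2 \<Longrightarrow> Q s' t"
  shows "wp sub (Extend b) s Q"
  unfolding Extend_def wp_Seq
proof (rule wp_Scan[OF n])
  let ?N = "nats s ''N'' 0 0" and ?R = "row s (nats s ''r'' 0 0)" and ?u = "nats s ''u'' 0 0"
  fix s1 t1 assume fr1: "frame {''w'', ''cnt'', ''touch''} s s1" and t1: "t1 \<le> 100 * M"
    and cnt: "nats s1 ''cnt'' 0 0 = card ?R"
    and touch: "1 \<le> nats s1 ''touch'' 0 0 \<longleftrightarrow> (\<exists>v\<in>?R. 1 \<le> nats s ''adj'' v ?u)"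
  note b1 = b[OF fr1 cnt touch]
  have fr1': "frame extend_vars s s1" using fr1 by (auto simp: frame_def)
  note [simp] = frame_nats[OF fr1] row_frame[OF fr1]
  show "wp sub (If b (Seq Flip (Seq Find (If (NLe (NVar ''found'') (NConst 0))
     (Assign ''N'' (NAdd (NVar ''N'') (NConst 1))) Skip))) Skip) s1 (\<lambda>s' t'. Q s' (t1 + t'))"
  proof (cases "bval b s1")
    case False
    moreover have "Q s1 (t1 + (bcost b + 1))"
      by (rule post) (use fr1' b1 False table t1 cost M_powers in \<open>auto simp: table_def\<close>)
    ultimately show ?thesis by simp
  next
    case True
    show ?thesis
    proof (rule wp_If_True[OF True], unfold wp_Seq, rule wp_Flip)
      fix s2 t2 assume fr: "frame {''w'', ''F''} s1 s2" and t2: "t2 \<le> 100 * M"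
        and row2: "\<And>i. row s2 i = (if i = nats s1 ''N'' 0 0
          then flip (row s1 (nats s1 ''r'' 0 0)) (nats s1 ''u'' 0 0) else row s1 i)"
      have fr2: "frame extend_vars s s2" by (rule frame_trans[OF fr1' fr]) auto
      note [simp] = frame_nats[OF fr]
      have row2': "row s2 i = (if i = ?N then flip ?R ?u else row s i)" for i
        using row2 by simp
      show "wp sub Find s2 (\<lambda>s3 t3. wp sub (If (NLe (NVar ''found'') (NConst 0))
          (Assign ''N'' (NAdd (NVar ''N'') (NConst 1))) Skip) s3
          (\<lambda>s4 t4. Q s4 (t1 + (bcost b + (t2 + (t3 + t4))))))"
      proof (rule wp_Find)
        fix s3 t3 assume fr: "frame {''w'', ''sub'', ''x'', ''found''} s2 s3" and t3: "t3 \<le> 300 * M\<^sup>2"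
          and found: "1 \<le> nats s3 ''found'' 0 0 \<longleftrightarrow>
            (\<exists>i<nats s2 ''N'' 0 0. row s2 i = row s2 (nats s2 ''N'' 0 0))"
        have fr3: "frame extend_vars s s3" by (rule frame_trans[OF fr2 fr]) auto
        note [simp] = frame_nats[OF fr]
        have row3: "row s3 = row s2" by (rule row_frame[OF fr]) auto
        have found': "1 \<le> nats s3 ''found'' 0 0 \<longleftrightarrow> flip ?R ?u \<in> X"
        proof -
          have "(\<exists>i<?N. row s2 i = row s2 ?N) \<longleftrightarrow> flip ?R ?u \<in> row s ` {..<?N}"
            unfolding row2' image_iff by (metis lessThan_iff less_irrefl)
          then show ?thesis using found table by (simp add: table_def)
        qed
        have img: "row s2 ` {..<?N} = X" "inj_on (row s2) {..<?N}"
          using table by (auto simp: table_def row2' inj_on_def image_iff)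
        have N3: "nats s3 ''N'' 0 0 = ?N" by simp
        have P: "P ?R ?u" using b1 True by simp
        show "wp sub (If (NLe (NVar ''found'') (NConst 0))
          (Assign ''N'' (NAdd (NVar ''N'') (NConst 1))) Skip) s3
          (\<lambda>s4 t4. Q s4 (t1 + (bcost b + (t2 + (t3 + t4)))))"
        proof (cases "flip ?R ?u \<in> X")
          case in_X: True
          \<comment> \<open>The test of \<open>found\<close> costs 5 and \<open>Skip\<close> 1;
            below, the assignment to \<open>N\<close> costs 8, which gives 13.\<close>
          have "Q s3 (t1 + (bcost b + (t2 + (t3 + 6))))"
          proof (rule post)
            show "table s3 (if P ?R ?u then insert (flip ?R ?u) X else X)"
              using img in_X P by (simp add: table_def row3 N3 insert_absorb)
          qed (use fr3 row3 row2' t1 t2 t3 cost M_powers in auto)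
          then show ?thesis using in_X found' by (simp add: eval_nat_numeral)
        next
          case not_X: False
          let ?s = "set_nat ''N'' 0 0 (Suc ?N) s3"
          have row4: "row ?s = row s3" by (rule row_cong) auto
          have "Q ?s (t1 + (bcost b + (t2 + (t3 + 13))))"
          proof (rule post)
            have "inj_on (row s2) (insert ?N {..<?N})"
              using img not_X by (auto simp: row2')
            then show "table ?s (if P ?R ?u then insert (flip ?R ?u) X else X)"
              using img P by (simp add: table_def row4 row3 lessThan_Suc row2'[of ?N])
          qed (use fr3 row3 row4 row2' t1 t2 t3 cost M_powers in auto)
          then show ?thesis using not_X found' by (simp add: eval_nat_numeral)
        qed
      qed (use n N in auto)
    qed (use n r u in auto)
  qed
qed

abbreviation "saturate_vars \<equiv> insert ''r'' (insert ''u'' extend_vars)"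

text \<open>The family \<open>Fam\<close> is never computed. Being closed under the permitted flips
  it contains every tabulated set, so its size limits the length of the queue and yields
  termination.\<close>

lemma wp_Saturate:
  assumes n: "nats s ''n'' 0 0 < M" and X: "table s X" "X \<subseteq> Fam"
    and Fam: "finite Fam" "card Fam < M"
    and closed: "\<And>S u. S \<in> Fam \<Longrightarrow> u < nats s ''n'' 0 0 \<Longrightarrow> P S u \<Longrightarrow> flip S u \<in> Fam"
    and b: "\<And>s' R u. frame saturate_vars s s' \<Longrightarrow> R = row s' (nats s' ''r'' 0 0) \<Longrightarrow>
      u = nats s' ''u'' 0 0 \<Longrightarrow> u < nats s ''n'' 0 0 \<Longrightarrow> nats s' ''cnt'' 0 0 = card R \<Longrightarrow>
      (1 \<le> nats s' ''touch'' 0 0 \<longleftrightarrow> (\<exists>v\<in>R. 1 \<le> nats s ''adj'' v u)) \<Longrightarrow>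
      bval b s' \<longleftrightarrow> P R u"
    and cost: "bcost b \<le> 100"
    and post: "\<And>s' t X'. frame saturate_vars s s' \<Longrightarrow> table s' X' \<Longrightarrow> X \<subseteq> X' \<Longrightarrow> X' \<subseteq> Fam \<Longrightarrow>
      (\<And>S u. S \<in> X' \<Longrightarrow> u < nats s ''n'' 0 0 \<Longrightarrow> P S u \<Longrightarrow> flip S u \<in> X') \<Longrightarrow>
      t \<le> 1000 * M ^ 4 \<Longrightarrow> Q s' t"
  shows "wp sub (Saturate b) s Q"
proof -
  let ?n = "nats s ''n'' 0 0"
  \<comment> \<open>Rows before \<open>r\<close> are finished: all flips permitted for them are
    already in the table.\<close>
  define J where "J s' \<longleftrightarrow> frame saturate_vars s s' \<and> nats s' ''r'' 0 0 \<le> nats s' ''N'' 0 0 \<and>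
    (\<exists>X'. table s' X' \<and> X \<subseteq> X' \<and> X' \<subseteq> Fam \<and>
      (\<forall>i<nats s' ''r'' 0 0. \<forall>v<?n. P (row s' i) v \<longrightarrow> flip (row s' i) v \<in> X'))" for s'
  let ?b = "NLess (NVar ''r'') (NVar ''N'')"
  let ?body = "Seq (For ''u'' ''n'' (Extend b)) (Assign ''r'' (NAdd (NVar ''r'') (NConst 1)))"
  let ?s = "set_nat ''r'' 0 0 0 s"
  have "J ?s"
    using X table_cong[of ?s s] row_cong[of ?s s] by (auto simp: J_def)
  have wp: "wp sub (While ?b ?body) ?s (\<lambda>s' t. J s' \<and> \<not> bval ?b s' \<and>
      t \<le> (card Fam - nats ?s ''r'' 0 0) * (bcost ?b + 730 * M ^ 3) + bcost ?b)"
  proof (rule wp_While)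
    fix s1 assume J1: "J s1" and "bval ?b s1"
    then have r1: "nats s1 ''r'' 0 0 < nats s1 ''N'' 0 0" by simp
    obtain X1 where fr1: "frame saturate_vars s s1" and X1: "table s1 X1" "X \<subseteq> X1" "X1 \<subseteq> Fam"
      "\<forall>i<nats s1 ''r'' 0 0. \<forall>v<?n. P (row s1 i) v \<longrightarrow> flip (row s1 i) v \<in> X1"
      using J1 by (auto simp: J_def)
    have n1: "nats s1 ''n'' 0 0 = ?n" by (simp add: frame_nats[OF fr1])
    let ?r = "nats s1 ''r'' 0 0" and ?N = "nats s1 ''N'' 0 0"
    let ?R = "row s1 ?r"
    have R_in: "?R \<in> X1" using X1(1) r1 by (auto simp: table_def)
    \<comment> \<open>Row \<open>r\<close> stays fixed while the table grows; the first
      \<open>k\<close> vertices have been tried on it.\<close>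
    let ?I = "\<lambda>k s'. frame (insert ''u'' extend_vars) s1 s' \<and> (\<forall>i<?N. row s' i = row s1 i) \<and>
      ?N \<le> nats s' ''N'' 0 0 \<and>
      (\<exists>X'. table s' X' \<and> X1 \<subseteq> X' \<and> X' \<subseteq> Fam \<and> (\<forall>v<k. P ?R v \<longrightarrow> flip ?R v \<in> X'))"
    show "wp sub ?body s1 (\<lambda>s' t. t \<le> 730 * M ^ 3 \<and> J s' \<and>
        card Fam - nats s' ''r'' 0 0 < card Fam - nats s1 ''r'' 0 0)"
      unfolding wp_Seq
    proof (rule wp_For[where I = ?I and a = 700 and d = 2 and n = ?n])
      show "?I 0 (set_nat ''u'' 0 0 0 s1)"
        using X1 table_cong[of "set_nat ''u'' 0 0 0 s1" s1] row_cong[of "set_nat ''u'' 0 0 0 s1" s1]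
        by auto
    next
      fix k s2 assume k: "k < ?n" and I: "?I k s2" "nats s2 ''u'' 0 0 = k"
      then obtain X2 where fr: "frame (insert ''u'' extend_vars) s1 s2" and
        row2: "\<And>i. i < ?N \<Longrightarrow> row s2 i = row s1 i" and N2: "?N \<le> nats s2 ''N'' 0 0" and
        X2: "table s2 X2" "X1 \<subseteq> X2" "X2 \<subseteq> Fam" "\<And>v. v < k \<Longrightarrow> P ?R v \<Longrightarrow> flip ?R v \<in> X2"
        by auto
      have fr2: "frame saturate_vars s s2" by (rule frame_trans[OF fr1 fr]) auto
      have r2: "nats s2 ''r'' 0 0 = ?r" by (simp add: frame_nats[OF fr])
      have n2: "nats s2 ''n'' 0 0 = ?n" by (simp add: frame_nats[OF fr2])
      have adj2: "nats s2 ''adj'' = nats s ''adj''" by (simp add: frame_nats[OF fr2])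
      have R2: "row s2 ?r = ?R" using row2 r1 by simp
      have "card X2 \<le> card Fam" using X2 Fam by (intro card_mono)
      then have NM: "nats s2 ''N'' 0 0 < M" using table_card[OF X2(1)] Fam by simp
      show "wp sub (Extend b) s2 (\<lambda>s' t. t \<le> 700 * M\<^sup>2 \<and> nats s' ''u'' 0 0 = k \<and>
          nats s' ''n'' 0 0 = ?n \<and> ?I (Suc k) (set_nat ''u'' 0 0 (Suc k) s'))"
      proof (rule wp_Extend[where P = P and X = X2])
        fix s3 assume fr: "frame {''w'', ''cnt'', ''touch''} s2 s3"
          and cnt: "nats s3 ''cnt'' 0 0 = card (row s2 (nats s2 ''r'' 0 0))"
          and touch: "1 \<le> nats s3 ''touch'' 0 0 \<longleftrightarrow>
            (\<exists>v\<in>row s2 (nats s2 ''r'' 0 0). 1 \<le> nats s2 ''adj'' v (nats s2 ''u'' 0 0))"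
        have row3: "row s3 = row s2" by (rule row_frame[OF fr]) auto
        have r3: "nats s3 ''r'' 0 0 = ?r" "nats s3 ''u'' 0 0 = k"
          using I(2) r2 by (simp_all add: frame_nats[OF fr])
        have fr3: "frame saturate_vars s s3" by (rule frame_trans[OF fr2 fr]) auto
        show "bval b s3 \<longleftrightarrow> P (row s2 (nats s2 ''r'' 0 0)) (nats s2 ''u'' 0 0)"
          by (rule b[OF fr3]) (use cnt touch k I(2) in \<open>simp_all add: r2 r3 adj2 row3\<close>)
      next
        fix s3 t assume fr: "frame extend_vars s2 s3"
          and row3: "\<And>i. i < nats s2 ''N'' 0 0 \<Longrightarrow> row s3 i = row s2 i"
          and X3: "table s3 (if P (row s2 (nats s2 ''r'' 0 0)) (nats s2 ''u'' 0 0)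
            then insert (flip (row s2 (nats s2 ''r'' 0 0)) (nats s2 ''u'' 0 0)) X2 else X2)"
          and N3: "nats s2 ''N'' 0 0 \<le> nats s3 ''N'' 0 0" and t: "t \<le> 700 * M\<^sup>2"
        have fr3: "frame (insert ''u'' extend_vars) s1 s3"
          by (rule frame_trans[OF \<open>frame (insert ''u'' extend_vars) s1 s2\<close> fr]) auto
        have s3: "nats s3 ''u'' 0 0 = k" "nats s3 ''n'' 0 0 = ?n"
          using I(2) n2 by (simp_all add: frame_nats[OF fr])
        let ?s3 = "set_nat ''u'' 0 0 (Suc k) s3"
        let ?X3 = "if P ?R k then insert (flip ?R k) X2 else X2"
        have row3': "row ?s3 = row s3" by (rule row_cong) auto
        have "table ?s3 ?X3"
          using X3 table_cong[OF row3'] unfolding r2 R2 I(2) by simp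
        moreover have "?X3 \<subseteq> Fam"
          using X2(3) closed[of ?R k] R_in X1(3) k by auto
        moreover have "\<forall>v<Suc k. P ?R v \<longrightarrow> flip ?R v \<in> ?X3"
          using X2(4) by (auto simp: less_Suc_eq)
        moreover have "X1 \<subseteq> ?X3" using X2(2) by auto
        moreover have "\<forall>i<?N. row ?s3 i = row s1 i" using row2 row3 N2 row3' by auto
        ultimately have "?I (Suc k) ?s3" using fr3 N2 N3 by auto
        then show "t \<le> 700 * M\<^sup>2 \<and> nats s3 ''u'' 0 0 = k \<and> nats s3 ''n'' 0 0 = ?n \<and> ?I (Suc k) ?s3"
          using t s3 by blast
      qed (use n n2 NM r1 r2 N2 k I(2) cost X2(1) in auto)
    next
      fix s2 t assume I: "?I ?n s2" and t: "t \<le> (700 + 20) * M ^ (2 + 1)"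
      then obtain X2 where fr: "frame (insert ''u'' extend_vars) s1 s2" and
        row2: "\<And>i. i < ?N \<Longrightarrow> row s2 i = row s1 i" and N2: "?N \<le> nats s2 ''N'' 0 0" and
        X2: "table s2 X2" "X1 \<subseteq> X2" "X2 \<subseteq> Fam" "\<And>v. v < ?n \<Longrightarrow> P ?R v \<Longrightarrow> flip ?R v \<in> X2"
        by auto
      have fr2: "frame saturate_vars s s2" by (rule frame_trans[OF fr1 fr]) auto
      have r2: "nats s2 ''r'' 0 0 = ?r" by (simp add: frame_nats[OF fr])
      let ?s2 = "set_nat ''r'' 0 0 (Suc ?r) s2"
      have row2': "row ?s2 = row s2" by (rule row_cong) auto
      have "table ?s2 X2" using X2(1) table_cong[OF row2'] by simp
      moreover have "flip (row ?s2 i) v \<in> X2" if "i < Suc ?r" "v < ?n" "P (row ?s2 i) v" for i v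
      proof (cases "i = ?r")
        case True
        then show ?thesis using that X2(4) row2 r1 row2' by auto
      next
        case False
        then show ?thesis using that X1(4) X2(2) row2 r1 row2' by auto
      qed
      ultimately have J2: "J ?s2"
        unfolding J_def using fr2 X1(2) X2(2,3) r1 N2 by (intro conjI exI[of _ X2]) auto
      \<comment> \<open>Row \<open>r\<close> exists, hence \<open>r\<close> is below the size of the
        table and so below \<open>card Fam\<close>: the measure strictly decreases.\<close>
      have "card X1 \<le> card Fam" using X1 Fam by (intro card_mono)
      then have "?r < card Fam" using table_card[OF X1(1)] r1 by simp
      then show "wp sub (Assign ''r'' (NAdd (NVar ''r'') (NConst 1))) s2 (\<lambda>s' t'. t + t' \<le> 730 * M ^ 3 \<and>
          J s' \<and> card Fam - nats s' ''r'' 0 0 < card Fam - ?r)"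
        using J2 r2 t M_powers by auto
    qed (use n n1 in auto)
  qed (rule \<open>J ?s\<close>)
  show ?thesis
    unfolding Saturate_def wp_Seq wp_NSet
  proof (rule wp_mono, simp only: nval.simps, rule wp, elim conjE)
    fix s' t assume J': "J s'" "\<not> bval ?b s'"
      and t: "t \<le> (card Fam - nats ?s ''r'' 0 0) * (bcost ?b + 730 * M ^ 3) + bcost ?b"
    then obtain X' where X': "frame saturate_vars s s'" "table s' X'" "X \<subseteq> X'" "X' \<subseteq> Fam"
      "\<forall>i<nats s' ''r'' 0 0. \<forall>v<?n. P (row s' i) v \<longrightarrow> flip (row s' i) v \<in> X'"
      and "nats s' ''r'' 0 0 = nats s' ''N'' 0 0"
      by (auto simp: J_def)
    then have "flip S u \<in> X'" if "S \<in> X'" "u < ?n" "P S u" for S u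
      using that by (auto simp: table_def)
    moreover have "1 + ncost (NConst 0) + ncost (NConst 0) + ncost (NConst 0) + t \<le> 1000 * M ^ 4"
    proof -
      have "t \<le> card Fam * (730 * M ^ 3 + 8) + 8" using t by (simp add: algebra_simps)
      also have "card Fam * (730 * M ^ 3 + 8) \<le> M * (738 * M ^ 3)"
        using Fam(2) M_powers by (intro mult_mono) auto
      also have "\<dots> = 738 * M ^ 4" using power_add[of M 1 3] by simp
      finally show ?thesis using M_powers by simp
    qed
    ultimately show "Q s' (1 + ncost (NConst 0) + ncost (NConst 0) + ncost (NConst 0) + t)"
      using X' by (intro post) auto
  qed
qed

end

section \<open>Evaluating the coefficients\<close>

text \<open>The language does not multiply natural numbers; for the constant \<open>\<alpha>\<close>
  repeated addition does it in constant time.\<close>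

fun nmul :: "nat \<Rightarrow> nexp \<Rightarrow> nexp" where
  "nmul 0 e = NConst 0"
| "nmul (Suc a) e = NAdd e (nmul a e)"

lemma nval_nmul [simp]: "nval (nmul a e) s = a * nval e s"
  by (induction a) simp_all

lemma ncost_nmul [simp]: "ncost (nmul a e) = 1 + a * (1 + ncost e)"
  by (induction a) simp_all

text \<open>Besides listing the row, this tabulates its sign by one negation per element. The
  factors \<open>(-1) ^ card S\<close> and \<open>(-1) ^ card T\<close> of the transform are
  separate, so one sign per row suffices.\<close>

definition Compact :: com where
  "Compact = Seq (Assign ''cnt'' (NConst 0)) (Seq (CSet ''sg'' (NVar ''x'') (NConst 0) (CConst 1))
     (For ''w'' ''n'' (If (NLe (NConst 1) (NCell ''F'' (NVar ''x'') (NVar ''w'')))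
        (Seq (NSet ''vl'' (NVar ''cnt'') (NConst 0) (NVar ''w''))
        (Seq (Assign ''cnt'' (NAdd (NVar ''cnt'') (NConst 1)))
             (CSet ''sg'' (NVar ''x'') (NConst 0)
                (CSub (CConst 0) (CCell ''sg'' (NVar ''x'') (NConst 0))))))
        Skip)))"

definition Submatrix :: com where
  "Submatrix = For ''a'' ''cnt'' (For ''b'' ''cnt'' (NSet ''H'' (NVar ''a'') (NVar ''b'')
     (NCell ''adj'' (NCell ''vl'' (NVar ''a'') (NConst 0)) (NCell ''vl'' (NVar ''b'') (NConst 0)))))"

definition Coefficients :: "nat \<Rightarrow> com" where
  "Coefficients \<alpha> = For ''i'' ''m'' (If (NLe (NVar ''cnt'') (nmul \<alpha> (NAdd (NVar ''i'') (NConst 1))))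
     (Seq (Call ''H'' (NVar ''cnt'') (NAdd (NVar ''i'') (NConst 1)) ''res'')
        (CSet ''mu'' (NVar ''x'') (NAdd (NVar ''i'') (NConst 1)) (CVar ''res'')))
     (CSet ''mu'' (NVar ''x'') (NAdd (NVar ''i'') (NConst 1)) (CConst 0)))"

definition AllCoefficients :: "nat \<Rightarrow> com" where
  "AllCoefficients \<alpha> = For ''x'' ''N'' (Seq Compact (Seq Submatrix (Coefficients \<alpha>)))"

text \<open>The subroutine expects the vertices \<open>{..<c}\<close>; this is the induced subgraph
  pulled back along an enumeration \<open>f\<close> of its vertices.\<close>

definition relabelled :: "graph \<Rightarrow> nat \<Rightarrow> (nat \<Rightarrow> nat) \<Rightarrow> graph" where
  "relabelled G c f = \<lparr>verts = {..<c},
     edges = {{a, b} | a b. a < c \<and> b < c \<and> {f a, f b} \<in> edges G}\<rparr>"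

lemma edge_relabelled:
  "{a, b} \<in> edges (relabelled G c f) \<longleftrightarrow> a < c \<and> b < c \<and> {f a, f b} \<in> edges G"
  by (auto simp: relabelled_def doubleton_eq_iff insert_commute)

lemma adjacency_relabelled:
  "adjacency (relabelled G c f) = restrict_matrix c (\<lambda>a b. adjacency G (f a) (f b))"
  by (intro ext) (simp add: adjacency_def restrict_matrix_def edge_relabelled)

lemma fin_graph_relabelled:
  assumes "fin_graph G"
  shows "fin_graph (relabelled G c f)"
proof -
  \<comment> \<open>An edge of \<open>G\<close> has two distinct ends, so \<open>f a\<close> and
    \<open>f b\<close> differ and hence \<open>a\<close> and \<open>b\<close> do.\<close>
  have "card {a, b} = 2" if "{f a, f b} \<in> edges G" for a b
  proof -
    have "card {f a, f b} = 2" using that assms by (auto simp: fin_graph_def)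
    then have "a \<noteq> b" by auto
    then show ?thesis by simp
  qed
  then show ?thesis by (auto simp: fin_graph_def relabelled_def)
qed

lemma isomorphic_relabelled:
  assumes "fin_graph G" "bij_betw f {..<c} U"
  shows "isomorphic (relabelled G c f) (induced G U)"
  unfolding isomorphic_def
proof (intro exI conjI)
  show "bij_betw f (verts (relabelled G c f)) (verts (induced G U))"
    using assms(2) by (simp add: relabelled_def)
  have U: "U = f ` {..<c}" using assms(2) by (simp add: bij_betw_def)
  show "edges (induced G U) = (\<lambda>e. f ` e) ` edges (relabelled G c f)"
  proof (intro equalityI subsetI)
    fix e assume "e \<in> edges (induced G U)"
    then have e: "e \<in> edges G" "e \<subseteq> U" by (auto simp: induced_def)
    then have "card e = 2" using assms(1) by (auto simp: fin_graph_def)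
    then obtain u v where uv: "e = {u, v}" by (auto simp: card_2_iff)
    then obtain a b where ab: "a < c" "b < c" "u = f a" "v = f b" using e(2) U by auto
    then have "{a, b} \<in> edges (relabelled G c f)" using e(1) uv by (simp add: edge_relabelled)
    moreover have "e = f ` {a, b}" using uv ab by simp
    ultimately show "e \<in> (\<lambda>e. f ` e) ` edges (relabelled G c f)" by blast
  next
    fix e assume "e \<in> (\<lambda>e. f ` e) ` edges (relabelled G c f)"
    then show "e \<in> edges (induced G U)" using U by (auto simp: relabelled_def induced_def)
  qed
qed

lemma bij_betw_fun_upd_insert:
  assumes "bij_betw f A B" "a \<notin> A" "b \<notin> B"
  shows "bij_betw (f(a := b)) (insert a A) (insert b B)"
proof -
  have "bij_betw (f(a := b)) A B"
    using assms(1,2) by (subst bij_betw_cong[of A "f(a := b)" f]) auto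
  then show ?thesis using notIn_Un_bij_betw[of a A "f(a := b)" B] assms by simp
qed

section \<open>Correctness of the evaluation of coefficients\<close>

context machine
begin

abbreviation "compact_vars \<equiv> {''w'', ''cnt'', ''vl'', ''sg''}"

lemma wp_Compact:
  assumes "nats s ''n'' 0 0 < M"
    and post: "\<And>s' t. frame compact_vars s s' \<Longrightarrow>
      nats s' ''cnt'' 0 0 = card (row s (nats s ''x'' 0 0)) \<Longrightarrow>
      bij_betw (\<lambda>a. nats s' ''vl'' a 0) {..<nats s' ''cnt'' 0 0} (row s (nats s ''x'' 0 0)) \<Longrightarrow>
      nums s' ''sg'' (nats s ''x'' 0 0) 0 = (-1) ^ card (row s (nats s ''x'' 0 0)) \<Longrightarrow>
      (\<And>i. i \<noteq> nats s ''x'' 0 0 \<Longrightarrow> nums s' ''sg'' i = nums s ''sg'' i) \<Longrightarrow>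
      t \<le> 100 * M \<Longrightarrow> Q s' t"
  shows "wp sub Compact s Q"
proof -
  let ?x = "nats s ''x'' 0 0" and ?n = "nats s ''n'' 0 0"
  let ?R = "\<lambda>k. {v. v < k \<and> 1 \<le> nats s ''F'' ?x v}"
  let ?I = "\<lambda>k s'. frame compact_vars s s' \<and> nats s' ''cnt'' 0 0 = card (?R k) \<and>
    bij_betw (\<lambda>a. nats s' ''vl'' a 0) {..<card (?R k)} (?R k) \<and>
    nums s' ''sg'' ?x 0 = (-1) ^ card (?R k) \<and> (\<forall>i. i \<noteq> ?x \<longrightarrow> nums s' ''sg'' i = nums s ''sg'' i)"
  have R: "?R (Suc k) = (if 1 \<le> nats s ''F'' ?x k then insert k (?R k) else ?R k)" for k
    by (auto simp: less_Suc_eq)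
  have fin: "finite (?R k)" for k by simp
  show ?thesis
    unfolding Compact_def wp_Seq wp_NSet wp_CSet
  proof (rule wp_For[where I = ?I and a = 70 and d = 0 and n = ?n])
    fix k s' assume I: "?I k s'" "nats s' ''w'' 0 0 = k" "nats s' ''n'' 0 0 = ?n"
    note [simp] = frame_nats[OF conjunct1[OF I(1)]]
    let ?Q = "\<lambda>s' t. t \<le> 70 * M ^ 0 \<and> nats s' ''w'' 0 0 = k \<and> nats s' ''n'' 0 0 = ?n \<and>
        ?I (Suc k) (set_nat ''w'' 0 0 (Suc k) s')"
    show "wp sub (If (NLe (NConst 1) (NCell ''F'' (NVar ''x'') (NVar ''w'')))
        (Seq (NSet ''vl'' (NVar ''cnt'') (NConst 0) (NVar ''w''))
        (Seq (Assign ''cnt'' (NAdd (NVar ''cnt'') (NConst 1)))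
             (CSet ''sg'' (NVar ''x'') (NConst 0)
                (CSub (CConst 0) (CCell ''sg'' (NVar ''x'') (NConst 0))))))
        Skip) s' ?Q"
    proof (cases "1 \<le> nats s ''F'' ?x k")
      case True
      \<comment> \<open>All vertices listed so far are smaller than \<open>k\<close>, so appending
        \<open>k\<close> keeps the enumeration injective.\<close>
      have "bij_betw ((\<lambda>a. nats s' ''vl'' a 0)(card (?R k) := k)) (insert (card (?R k)) {..<card (?R k)})
          (insert k (?R k))"
        using I by (intro bij_betw_fun_upd_insert) auto
      moreover have "(\<lambda>a. nats s' ''vl'' a 0)(card (?R k) := k) =
          (\<lambda>a. ((nats s' ''vl'')(card (?R k) := (nats s' ''vl'' (card (?R k)))(0 := k))) a 0)"
        by auto
      ultimately show ?thesis
        using True I unfolding R by (auto simp: lessThan_Suc)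
    next
      case False
      then show ?thesis using I unfolding R by auto
    qed
  next
    fix s' t assume "?I ?n s'" "t \<le> (70 + 20) * M ^ (0 + 1)"
    then show "Q s' (1 + ncost (NConst 0) + ncost (NConst 0) + ncost (NConst 0) +
        (1 + ncost (NVar ''x'') + ncost (NConst 0) + ccost (CConst 1) + t))"
      using M_ge_1 by (intro post) (auto simp: row_def)
  qed (use assms in \<open>auto simp: bij_betw_def\<close>)
qed

lemma wp_Submatrix:
  assumes "nats s ''cnt'' 0 0 < M"
    and post: "\<And>s' t. frame {''a'', ''b'', ''H''} s s' \<Longrightarrow>
      (\<And>a b. a < nats s ''cnt'' 0 0 \<Longrightarrow> b < nats s ''cnt'' 0 0 \<Longrightarrow>
        nats s' ''H'' a b = nats s ''adj'' (nats s ''vl'' a 0) (nats s ''vl'' b 0)) \<Longrightarrow>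
      t \<le> 100 * M\<^sup>2 \<Longrightarrow> Q s' t"
  shows "wp sub Submatrix s Q"
proof -
  let ?W = "{''a'', ''b'', ''H''}" and ?c = "nats s ''cnt'' 0 0"
  let ?A = "\<lambda>a b. nats s ''adj'' (nats s ''vl'' a 0) (nats s ''vl'' b 0)"
  let ?I = "\<lambda>k s'. frame ?W s s' \<and> (\<forall>a<k. \<forall>b<?c. nats s' ''H'' a b = ?A a b)"
  show ?thesis
    unfolding Submatrix_def
  proof (rule wp_For[where I = ?I and a = 60 and d = 1 and n = ?c])
    fix k s1 assume I1: "?I k s1" "nats s1 ''a'' 0 0 = k" "nats s1 ''cnt'' 0 0 = ?c"
    let ?J = "\<lambda>l s'. frame ?W s s' \<and> nats s' ''a'' 0 0 = k \<and> (\<forall>a<k. \<forall>b<?c. nats s' ''H'' a b = ?A a b) \<and>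
      (\<forall>b<l. nats s' ''H'' k b = ?A k b)"
    show "wp sub (For ''b'' ''cnt'' (NSet ''H'' (NVar ''a'') (NVar ''b'')
        (NCell ''adj'' (NCell ''vl'' (NVar ''a'') (NConst 0)) (NCell ''vl'' (NVar ''b'') (NConst 0))))) s1
      (\<lambda>s' t. t \<le> 60 * M ^ 1 \<and> nats s' ''a'' 0 0 = k \<and> nats s' ''cnt'' 0 0 = ?c \<and>
        ?I (Suc k) (set_nat ''a'' 0 0 (Suc k) s'))"
    proof (rule wp_For[where I = ?J and a = 40 and d = 0 and n = ?c])
      fix l s2 assume I2: "?J l s2" "nats s2 ''b'' 0 0 = l" "nats s2 ''cnt'' 0 0 = ?c"
      note [simp] = frame_nats[OF conjunct1[OF I2(1)]]
      show "wp sub (NSet ''H'' (NVar ''a'') (NVar ''b'')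
          (NCell ''adj'' (NCell ''vl'' (NVar ''a'') (NConst 0)) (NCell ''vl'' (NVar ''b'') (NConst 0)))) s2
        (\<lambda>s' t. t \<le> 40 * M ^ 0 \<and> nats s' ''b'' 0 0 = l \<and> nats s' ''cnt'' 0 0 = ?c \<and>
          ?J (Suc l) (set_nat ''b'' 0 0 (Suc l) s'))"
        using I2 by (auto simp: less_Suc_eq)
    next
      fix s' t assume I2: "?J ?c s'" and t: "t \<le> (40 + 20) * M ^ (0 + 1)"
      have "nats s' ''cnt'' 0 0 = ?c" by (simp add: frame_nats[OF conjunct1[OF I2]])
      then show "t \<le> 60 * M ^ 1 \<and> nats s' ''a'' 0 0 = k \<and> nats s' ''cnt'' 0 0 = ?c \<and>
        ?I (Suc k) (set_nat ''a'' 0 0 (Suc k) s')"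
        using I2 t by (auto simp: less_Suc_eq)
    qed (use I1 assms in auto)
  next
    fix s' t assume "?I ?c s'" and t: "t \<le> (60 + 20) * M ^ (1 + 1)"
    moreover have "t \<le> 80 * M\<^sup>2" using t by (simp add: power2_eq_square)
    ultimately show "Q s' t" by (intro post) auto
  qed (use assms in auto)
qed

lemma wp_Coefficients:
  assumes "nats s ''m'' 0 0 < M" "nats s ''cnt'' 0 0 = c" "c < M"
    and call: "\<And>i. c \<le> \<alpha> * i \<Longrightarrow> \<exists>t\<le>M. sub c (restrict_matrix c (nats s ''H'')) i (z i) t"
    and post: "\<And>s' t. frame {''i'', ''res'', ''mu''} s s' \<Longrightarrow>
      (\<And>i. 1 \<le> i \<Longrightarrow> i \<le> nats s ''m'' 0 0 \<Longrightarrow>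
        nums s' ''mu'' (nats s ''x'' 0 0) i = (if c \<le> \<alpha> * i then z i else 0)) \<Longrightarrow>
      (\<And>x. x \<noteq> nats s ''x'' 0 0 \<Longrightarrow> nums s' ''mu'' x = nums s ''mu'' x) \<Longrightarrow>
      t \<le> (6 * \<alpha> + 100) * M ^ 3 \<Longrightarrow> Q s' t"
  shows "wp sub (Coefficients \<alpha>) s Q"
proof -
  let ?W = "{''i'', ''res'', ''mu''}" and ?m = "nats s ''m'' 0 0" and ?x = "nats s ''x'' 0 0"
  let ?I = "\<lambda>k s'. frame ?W s s' \<and>
    (\<forall>i. 1 \<le> i \<longrightarrow> i \<le> k \<longrightarrow> nums s' ''mu'' ?x i = (if c \<le> \<alpha> * i then z i else 0)) \<and>
    (\<forall>x. x \<noteq> ?x \<longrightarrow> nums s' ''mu'' x = nums s ''mu'' x)"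
  let ?call = "Seq (Call ''H'' (NVar ''cnt'') (NAdd (NVar ''i'') (NConst 1)) ''res'')
        (CSet ''mu'' (NVar ''x'') (NAdd (NVar ''i'') (NConst 1)) (CVar ''res''))"
  show ?thesis
    unfolding Coefficients_def
  proof (rule wp_For[where I = ?I and a = "6 * \<alpha> + 80" and d = 2 and n = ?m])
    fix k s1 assume I: "?I k s1" "nats s1 ''i'' 0 0 = k" "nats s1 ''m'' 0 0 = ?m"
    note [simp] = frame_nats[OF conjunct1[OF I(1)]]
    let ?Q = "\<lambda>s' t. t \<le> (6 * \<alpha> + 80) * M\<^sup>2 \<and> nats s' ''i'' 0 0 = k \<and> nats s' ''m'' 0 0 = ?m \<and>
        ?I (Suc k) (set_nat ''i'' 0 0 (Suc k) s')"
    let ?b = "NLe (NVar ''cnt'') (nmul \<alpha> (NAdd (NVar ''i'') (NConst 1)))"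
    \<comment> \<open>The term \<open>6 * \<alpha>\<close> comes from the repeated additions in the
      size test, and \<open>c * c\<close> is the charge for copying the matrix.\<close>
    have M2: "6 * \<alpha> \<le> 6 * \<alpha> * M\<^sup>2" "c * c \<le> M\<^sup>2"
      using M_ge_1 assms(3) by (auto simp: power2_eq_square intro!: mult_le_mono)
    have IS: "?I (Suc k) (set_nat ''i'' 0 0 (Suc k) s')"
      if "frame ?W s s'" "nums s' ''mu'' = (nums s1 ''mu'')(?x := (nums s1 ''mu'' ?x)(Suc k := v))"
        "v = (if c \<le> \<alpha> * Suc k then z (Suc k) else 0)" for s' v
      using that I by (auto simp: le_Suc_eq)
    show "wp sub (If ?b ?call
       (CSet ''mu'' (NVar ''x'') (NAdd (NVar ''i'') (NConst 1)) (CConst 0))) s1 ?Q"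
    proof (cases "c \<le> \<alpha> * Suc k")
      case True
      then have b: "bval ?b s1" using I assms(2) by simp
      obtain t where t: "t \<le> M" "sub c (restrict_matrix c (nats s ''H'')) (Suc k) (z (Suc k)) t"
        using call[OF True] by blast
      show ?thesis
      proof (rule wp_If_True[OF b], unfold wp_Seq, rule wp_Call)
        show "sub (nval (NVar ''cnt'') s1) (restrict_matrix (nval (NVar ''cnt'') s1) (nats s1 ''H''))
            (nval (NAdd (NVar ''i'') (NConst 1)) s1) (z (Suc k)) t"
          using t(2) I(2) assms(2) by simp
        let ?s = "set_num ''mu'' ?x (Suc k) (z (Suc k)) (set_num ''res'' 0 0 (z (Suc k)) s1)"
        have "?I (Suc k) (set_nat ''i'' 0 0 (Suc k) ?s)"
          by (rule IS[where v = "z (Suc k)"]) (use I True in auto)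
        moreover have "6 * \<alpha> + c * c + t + 40 \<le> (6 * \<alpha> + 80) * M\<^sup>2"
          unfolding distrib_right using t(1) M2 M_powers by linarith
        ultimately show "wp sub (CSet ''mu'' (NVar ''x'') (NAdd (NVar ''i'') (NConst 1)) (CVar ''res''))
          (set_num ''res'' 0 0 (z (Suc k)) s1) (\<lambda>s' t'. ?Q s' (bcost ?b + (1 + ncost (NVar ''cnt'') +
            ncost (NAdd (NVar ''i'') (NConst 1)) + nval (NVar ''cnt'') s1 * nval (NVar ''cnt'') s1 + t + t')))"
          using I(2,3) assms(2) by (simp del: frame_set_nat)
      qed
    next
      case False
      let ?s = "set_num ''mu'' ?x (Suc k) 0 s1"
      have "?I (Suc k) (set_nat ''i'' 0 0 (Suc k) ?s)"
        by (rule IS[where v = 0]) (use I False in auto)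
      moreover have "6 * \<alpha> + 40 \<le> (6 * \<alpha> + 80) * M\<^sup>2"
        unfolding distrib_right using M2 M_powers by linarith
      ultimately show ?thesis
        using I(2,3) assms(2) False by (simp del: frame_set_nat)
    qed
  next
    fix s' t assume "?I ?m s'" and t: "t \<le> (6 * \<alpha> + 80 + 20) * M ^ (2 + 1)"
    moreover have "6 * \<alpha> + 80 + 20 = 6 * \<alpha> + 100" "2 + 1 = (3::nat)" by simp_all
    ultimately show "Q s' t" by (intro post) (auto simp only:)
  qed (use assms in auto)
qed

abbreviation "coefficient_vars \<equiv>
  {''x'', ''w'', ''cnt'', ''vl'', ''sg'', ''a'', ''b'', ''H'', ''i'', ''res'', ''mu''}"

lemma wp_AllCoefficients:
  assumes G: "fin_graph G" "verts G = {..<nats s ''n'' 0 0}" "nats s ''adj'' = adjacency G"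
    and M: "nats s ''n'' 0 0 < M" "nats s ''m'' 0 0 < M" "nats s ''N'' 0 0 < M"
    and card: "\<And>x. x < nats s ''N'' 0 0 \<Longrightarrow> card (row s x) \<le> k" "k < M"
    and inv: "\<And>i. graph_invariant (\<lambda>H. lam H i)"
    and call: "\<And>H c i. fin_graph H \<Longrightarrow> verts H = {..<c} \<Longrightarrow> c \<le> \<alpha> * i \<Longrightarrow> c \<le> k \<Longrightarrow>
      \<exists>t\<le>M. sub c (adjacency H) i (lam H i) t"
    and post: "\<And>s' t. frame coefficient_vars s s' \<Longrightarrow>
      (\<And>x i. x < nats s ''N'' 0 0 \<Longrightarrow> 1 \<le> i \<Longrightarrow> i \<le> nats s ''m'' 0 0 \<Longrightarrow> nums s' ''mu'' x i =
        (if card (row s x) \<le> \<alpha> * i then lam (induced G (row s x)) i else 0)) \<Longrightarrow>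
      (\<And>x. x < nats s ''N'' 0 0 \<Longrightarrow> nums s' ''sg'' x 0 = (-1) ^ card (row s x)) \<Longrightarrow>
      t \<le> (6 * \<alpha> + 500) * M ^ 4 \<Longrightarrow> Q s' t"
  shows "wp sub (AllCoefficients \<alpha>) s Q"
proof -
  let ?m = "nats s ''m'' 0 0" and ?N = "nats s ''N'' 0 0"
  let ?mu = "\<lambda>x i. if card (row s x) \<le> \<alpha> * i then lam (induced G (row s x)) i else 0"
  let ?I = "\<lambda>l s'. frame coefficient_vars s s' \<and>
    (\<forall>x<l. \<forall>i. 1 \<le> i \<longrightarrow> i \<le> ?m \<longrightarrow> nums s' ''mu'' x i = ?mu x i) \<and>
    (\<forall>x<l. nums s' ''sg'' x 0 = (-1) ^ card (row s x))"
  show ?thesis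
    unfolding AllCoefficients_def
  proof (rule wp_For[where I = ?I and a = "6 * \<alpha> + 400" and d = 3 and n = ?N])
    fix l s1 assume l: "l < ?N" and I: "?I l s1" "nats s1 ''x'' 0 0 = l"
    note fr1 = conjunct1[OF I(1)]
    have n1: "nats s1 ''n'' 0 0 = nats s ''n'' 0 0" and m1: "nats s1 ''m'' 0 0 = ?m"
      by (simp_all add: frame_nats[OF fr1])
    have row1: "row s1 = row s" by (rule row_frame[OF fr1]) auto
    let ?R = "row s l"
    let ?Q = "\<lambda>s' t. t \<le> (6 * \<alpha> + 400) * M ^ 3 \<and> nats s' ''x'' 0 0 = l \<and> nats s' ''N'' 0 0 = ?N \<and>
        ?I (Suc l) (set_nat ''x'' 0 0 (Suc l) s')"
    show "wp sub (Seq Compact (Seq Submatrix (Coefficients \<alpha>))) s1 ?Q"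
      unfolding wp_Seq
    proof (rule wp_Compact, unfold I(2) row1 n1)
      fix s2 t2 assume fr: "frame compact_vars s1 s2" and t2: "t2 \<le> 100 * M"
        and cnt: "nats s2 ''cnt'' 0 0 = card ?R"
        and bij: "bij_betw (\<lambda>a. nats s2 ''vl'' a 0) {..<nats s2 ''cnt'' 0 0} ?R"
        and sg: "nums s2 ''sg'' l 0 = (-1) ^ card ?R" "\<And>i. i \<noteq> l \<Longrightarrow> nums s2 ''sg'' i = nums s1 ''sg'' i"
      have fr2: "frame coefficient_vars s s2" by (rule frame_trans[OF fr1 fr]) auto
      have s2: "nats s2 ''x'' 0 0 = l" "nats s2 ''N'' 0 0 = ?N" "nats s2 ''m'' 0 0 = ?m"
        "nums s2 ''mu'' = nums s1 ''mu''" "nats s2 ''adj'' = adjacency G"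
        using I(2) G(3) by (simp_all add: frame_nats[OF fr] frame_nats[OF fr1] frame_nums[OF fr])
      have cM: "card ?R < M" using card l by (meson le_less_trans)
      show "wp sub Submatrix s2 (\<lambda>s' t. wp sub (Coefficients \<alpha>) s' (\<lambda>s' t'. ?Q s' (t2 + (t + t'))))"
      proof (rule wp_Submatrix, unfold cnt)
        fix s3 t3 assume fr: "frame {''a'', ''b'', ''H''} s2 s3" and t3: "t3 \<le> 100 * M\<^sup>2"
          and H: "\<And>a b. a < card ?R \<Longrightarrow> b < card ?R \<Longrightarrow>
            nats s3 ''H'' a b = nats s2 ''adj'' (nats s2 ''vl'' a 0) (nats s2 ''vl'' b 0)"
        have fr3: "frame coefficient_vars s s3" by (rule frame_trans[OF fr2 fr]) auto
        have s3: "nats s3 ''x'' 0 0 = l" "nats s3 ''N'' 0 0 = ?N" "nats s3 ''m'' 0 0 = ?m"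
          "nums s3 ''mu'' = nums s1 ''mu''" "nums s3 ''sg'' = nums s2 ''sg''" "nats s3 ''cnt'' 0 0 = card ?R"
          using s2 cnt by (simp_all add: frame_nats[OF fr] frame_nums[OF fr])
        let ?f = "\<lambda>a. nats s2 ''vl'' a 0"
        let ?H = "relabelled G (card ?R) ?f"
        \<comment> \<open>Entries of \<open>H\<close> left over from earlier, larger rows are cut
          off by \<open>restrict_matrix\<close>.\<close>
        have adj: "restrict_matrix (card ?R) (nats s3 ''H'') = adjacency ?H"
          unfolding adjacency_relabelled by (intro ext) (simp add: restrict_matrix_def H s2)
        have fin: "fin_graph ?H" "fin_graph (induced G ?R)"
          using G by (auto intro!: fin_graph_relabelled fin_graph_induced simp: row_def)
        \<comment> \<open>The labelling of the row is arbitrary; invariance of \<open>lam\<close>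
          makes the returned value that of the induced subgraph.\<close>
        have lam: "lam ?H i = lam (induced G ?R) i" for i
          using inv[of i] fin isomorphic_relabelled[OF G(1), of ?f "card ?R" ?R] bij cnt
          by (auto simp: graph_invariant_def)
        show "wp sub (Coefficients \<alpha>) s3 (\<lambda>s' t'. ?Q s' (t2 + (t3 + t')))"
        proof (rule wp_Coefficients[where c = "card ?R" and z = "lam (induced G ?R)"], unfold s3)
          fix i assume "card ?R \<le> \<alpha> * i"
          then show "\<exists>t\<le>M. sub (card ?R) (restrict_matrix (card ?R) (nats s3 ''H'')) i (lam (induced G ?R) i) t"
            using call[of ?H "card ?R" i] fin(1) card(1)[OF l] unfolding adj lam
            by (simp add: relabelled_def)
        next
          fix s4 t4 assume fr: "frame {''i'', ''res'', ''mu''} s3 s4"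
            and mu: "\<And>i. 1 \<le> i \<Longrightarrow> i \<le> ?m \<Longrightarrow> nums s4 ''mu'' l i = ?mu l i"
              "\<And>x. x \<noteq> l \<Longrightarrow> nums s4 ''mu'' x = nums s1 ''mu'' x"
            and t4: "t4 \<le> (6 * \<alpha> + 100) * M ^ 3"
          have fr4: "frame coefficient_vars s s4" by (rule frame_trans[OF fr3 fr]) auto
          have s4: "nats s4 ''x'' 0 0 = l" "nats s4 ''N'' 0 0 = ?N" "nums s4 ''sg'' = nums s2 ''sg''"
            using s3 by (simp_all add: frame_nats[OF fr] frame_nums[OF fr])
          have "?I (Suc l) (set_nat ''x'' 0 0 (Suc l) s4)"
            using fr4 mu sg s4 I(1) by (auto simp: less_Suc_eq)
          moreover have "t2 + (t3 + t4) \<le> (6 * \<alpha> + 400) * M ^ 3"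
            using t2 t3 t4 M_powers by (simp add: distrib_right)
          ultimately show "?Q s4 (t2 + (t3 + t4))" using s4 by blast
        qed (use M cM in auto)
      qed (use cM in auto)
    qed (use M in auto)
  next
    fix s' t assume I: "?I ?N s'" and t: "t \<le> (6 * \<alpha> + 400 + 20) * M ^ (3 + 1)"
    then show "Q s' t" by (intro post) (auto simp: distrib_right)
  qed (use M in auto)
qed

end

section \<open>Power sums and their Moebius transforms\<close>

text \<open>A common pattern for subset sums over the table, run for all indices \<open>i\<close> at
  once: it yields the coefficients from \<open>mu\<close>, and the transforms from the power
  sums.\<close>

definition Accumulate :: "string \<Rightarrow> nexp \<Rightarrow> nexp \<Rightarrow> cexp \<Rightarrow> com" where
  "Accumulate T ix iy g = For ''y'' ''N'' (Seq (Subset ''y'' ''x'') (If (NLe (NConst 1) (NVar ''sub''))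
     (For ''i'' ''m'' (CSet T ix iy (CAdd (CCell T ix iy) g))) Skip))"

text \<open>Both counters are one below their indices, so the power sum of index
  \<open>(j + 1) - (i + 1)\<close> is found at \<open>j - i\<close>.\<close>

definition Newton :: com where
  "Newton = For ''j'' ''m'' (Seq
     (CAssign ''acc'' (CMul (COfNat (NAdd (NVar ''j'') (NConst 1)))
        (CCell ''e'' (NVar ''x'') (NAdd (NVar ''j'') (NConst 1)))))
     (Seq (For ''i'' ''j'' (CAssign ''acc'' (CAdd (CVar ''acc'')
        (CMul (CCell ''e'' (NVar ''x'') (NAdd (NVar ''i'') (NConst 1)))
          (CCell ''p'' (NVar ''x'') (NSub (NVar ''j'') (NVar ''i'')))))))
     (CSet ''p'' (NVar ''x'') (NAdd (NVar ''j'') (NConst 1)) (CSub (CConst 0) (CVar ''acc'')))))"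

definition PowerSums :: com where
  "PowerSums = For ''x'' ''N'' (Seq
     (Accumulate ''e'' (NVar ''x'') (NAdd (NVar ''i'') (NConst 1))
        (CCell ''mu'' (NVar ''y'') (NAdd (NVar ''i'') (NConst 1))))
     Newton)"

text \<open>The transforms of the individual rows are not stored; all their terms go straight into
  the output, where cell \<open>i\<close> belongs to the power sum of index
  \<open>i + 1\<close>.\<close>

definition Totals :: com where
  "Totals = For ''x'' ''N'' (Accumulate ''out'' (NVar ''i'') (NConst 0)
     (CMul (CMul (CCell ''sg'' (NVar ''x'') (NConst 0)) (CCell ''sg'' (NVar ''y'') (NConst 0)))
        (CCell ''p'' (NVar ''y'') (NAdd (NVar ''i'') (NConst 1)))))"

section \<open>Correctness of the power sums\<close>

context machine
begin

text \<open>The premise \<open>idx\<close> holds in all states that differ from \<open>s\<close>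
  only in arrays of the loop, \<open>T\<close> among them; hence the added terms cannot depend on
  the sums being accumulated.\<close>

lemma wp_Accumulate:
  assumes M: "nats s ''n'' 0 0 < M" "nats s ''m'' 0 0 < M" "nats s ''N'' 0 0 < M"
    and T: "T \<notin> {''n'', ''m'', ''N'', ''x'', ''y'', ''i'', ''w'', ''sub'', ''F''}"
    and idx: "\<And>s'. frame {''y'', ''i'', ''w'', ''sub'', T} s s' \<Longrightarrow>
      nval ix s' = A (nats s' ''i'' 0 0) \<and> nval iy s' = B (nats s' ''i'' 0 0) \<and>
      cval g s' = h (nats s' ''y'' 0 0) (nats s' ''i'' 0 0)"
    and cost: "2 * ncost ix + 2 * ncost iy + ccost g \<le> 60"
    and post: "\<And>s' t. frame {''y'', ''i'', ''w'', ''sub'', T} s s' \<Longrightarrow>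
      nums s' T = (\<lambda>a b. nums s T a b + (\<Sum>y<nats s ''N'' 0 0.
        if row s y \<subseteq> row s (nats s ''x'' 0 0)
        then \<Sum>i<nats s ''m'' 0 0. if A i = a \<and> B i = b then h y i else 0 else 0)) \<Longrightarrow>
      t \<le> 300 * M\<^sup>2 \<Longrightarrow> Q s' t"
  shows "wp sub (Accumulate T ix iy g) s Q"
proof -
  let ?W = "{''y'', ''i'', ''w'', ''sub'', T}"
  let ?N = "nats s ''N'' 0 0" and ?m = "nats s ''m'' 0 0" and ?x = "nats s ''x'' 0 0"
  have T' [simp]: "''n'' \<noteq> T" "''m'' \<noteq> T" "''N'' \<noteq> T" "''x'' \<noteq> T" "''F'' \<noteq> T"
    using T by auto
  \<comment> \<open>The contribution of the first \<open>l\<close> rounds for row \<open>y\<close>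
    to cell \<open>(a, b)\<close>; summing over matching indices allows any functions
    \<open>A\<close> and \<open>B\<close>.\<close>
  define D where "D y l a b = (\<Sum>i<l. if A i = a \<and> B i = b then h y i else 0)" for y l a b
  let ?I = "\<lambda>k s'. frame ?W s s' \<and> nums s' T = (\<lambda>a b. nums s T a b +
    (\<Sum>y<k. if row s y \<subseteq> row s ?x then D y ?m a b else 0))"
  show ?thesis
    unfolding Accumulate_def
  proof (rule wp_For[where I = ?I and a = 250 and d = 1 and n = ?N])
    fix k s1 assume I: "?I k s1" "nats s1 ''y'' 0 0 = k" "nats s1 ''N'' 0 0 = ?N"
    note fr1 = conjunct1[OF I(1)]
    have s1: "nats s1 ''x'' 0 0 = ?x" "nats s1 ''n'' 0 0 = nats s ''n'' 0 0"
      using T by (simp_all add: frame_nats[OF fr1])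
    have row1: "row s1 = row s" by (rule row_frame[OF fr1]) (use T in auto)
    let ?Q = "\<lambda>s' t. t \<le> 250 * M ^ 1 \<and> nats s' ''y'' 0 0 = k \<and> nats s' ''N'' 0 0 = ?N \<and>
        ?I (Suc k) (set_nat ''y'' 0 0 (Suc k) s')"
    show "wp sub (Seq (Subset ''y'' ''x'') (If (NLe (NConst 1) (NVar ''sub''))
        (For ''i'' ''m'' (CSet T ix iy (CAdd (CCell T ix iy) g))) Skip)) s1 ?Q"
      unfolding wp_Seq
    proof (rule wp_Subset, unfold row1 s1 I(2))
      fix s2 t2 assume fr: "frame {''w'', ''sub''} s1 s2" and t2: "t2 \<le> 100 * M"
        and sb: "nats s2 ''sub'' 0 0 = (if row s k \<subseteq> row s ?x then 1 else 0)"
      have fr2: "frame ?W s s2" by (rule frame_trans[OF fr1 fr]) auto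
      have s2: "nats s2 ''y'' 0 0 = k" "nats s2 ''N'' 0 0 = ?N" "nats s2 ''m'' 0 0 = ?m"
        "nums s2 T = nums s1 T"
        using I(2,3) T by (simp_all add: frame_nats[OF fr] frame_nums[OF fr] frame_nats[OF fr1])
      show "wp sub (If (NLe (NConst 1) (NVar ''sub''))
          (For ''i'' ''m'' (CSet T ix iy (CAdd (CCell T ix iy) g))) Skip) s2 (\<lambda>s' t'. ?Q s' (t2 + t'))"
      proof (cases "row s k \<subseteq> row s ?x")
        case True
        then have b: "bval (NLe (NConst 1) (NVar ''sub'')) s2" using sb by simp
        let ?J = "\<lambda>l s'. frame ?W s s' \<and> nats s' ''y'' 0 0 = k \<and>
          nums s' T = (\<lambda>a b. nums s1 T a b + D k l a b)"
        show ?thesis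
        proof (rule wp_If_True[OF b], rule wp_For[where I = ?J and a = 90 and d = 0 and n = ?m])
          fix l s3 assume J: "?J l s3" "nats s3 ''i'' 0 0 = l" "nats s3 ''m'' 0 0 = ?m"
          have v: "nval ix s3 = A l" "nval iy s3 = B l" "cval g s3 = h k l"
            using idx[OF conjunct1[OF J(1)]] J by auto
          have "nums (set_num T (A l) (B l) (nums s3 T (A l) (B l) + h k l) s3) T =
              (\<lambda>a b. nums s1 T a b + D k (Suc l) a b)"
            using J(1) by (auto simp: fun_eq_iff D_def)
          then show "wp sub (CSet T ix iy (CAdd (CCell T ix iy) g)) s3 (\<lambda>s' t. t \<le> 90 * M ^ 0 \<and>
              nats s' ''i'' 0 0 = l \<and> nats s' ''m'' 0 0 = ?m \<and> ?J (Suc l) (set_nat ''i'' 0 0 (Suc l) s'))"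
            using J v cost by simp
        next
          fix s3 t3 assume J: "?J ?m s3" and t3: "t3 \<le> (90 + 20) * M ^ (0 + 1)"
          have "nums s3 T = (\<lambda>a b. nums s T a b +
              (\<Sum>y<Suc k. if row s y \<subseteq> row s ?x then D y ?m a b else 0))"
            using J I(1) True by (auto simp: fun_eq_iff)
          moreover have "nats s3 ''N'' 0 0 = ?N"
            using T by (simp add: frame_nats[OF conjunct1[OF J]])
          ultimately show "?Q s3 (t2 + (bcost (NLe (NConst 1) (NVar ''sub'')) + t3))"
            using J t2 t3 M_ge_1 by simp
        next
          show "?J 0 (set_nat ''i'' 0 0 0 s2)" using fr2 s2 by (simp add: D_def)
        qed (use M s2 in auto)
      next
        case False
        then have "?I (Suc k) (set_nat ''y'' 0 0 (Suc k) s2)" using fr2 s2 I(1) by simp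
        then show ?thesis using False sb s2 t2 M_ge_1 by simp
      qed
    qed (use M in auto)
  next
    fix s' t assume "?I ?N s'" and t: "t \<le> (250 + 20) * M ^ (1 + 1)"
    moreover have "t \<le> 300 * M\<^sup>2" using t by (simp add: power2_eq_square)
    ultimately show "Q s' t" by (intro post) (auto simp: D_def cong: if_cong)
  qed (use M T in auto)
qed

text \<open>\<open>P\<close> is any sequence satisfying the recursion with the tabulated
  coefficients; roots of polynomials enter only when it is instantiated.\<close>

lemma wp_Newton:
  assumes M: "nats s ''m'' 0 0 < M"
    and P: "\<And>j. 1 \<le> j \<Longrightarrow> j \<le> nats s ''m'' 0 0 \<Longrightarrow>
      P j = - (of_nat j * nums s ''e'' (nats s ''x'' 0 0) j +
        (\<Sum>i\<in>{1..<j}. nums s ''e'' (nats s ''x'' 0 0) i * P (j - i)))"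
    and post: "\<And>s' t. frame {''j'', ''i'', ''acc'', ''p''} s s' \<Longrightarrow>
      (\<And>j. 1 \<le> j \<Longrightarrow> j \<le> nats s ''m'' 0 0 \<Longrightarrow> nums s' ''p'' (nats s ''x'' 0 0) j = P j) \<Longrightarrow>
      (\<And>x. x \<noteq> nats s ''x'' 0 0 \<Longrightarrow> nums s' ''p'' x = nums s ''p'' x) \<Longrightarrow>
      t \<le> 200 * M\<^sup>2 \<Longrightarrow> Q s' t"
  shows "wp sub Newton s Q"
proof -
  let ?W = "{''j'', ''i'', ''acc'', ''p''}"
  let ?m = "nats s ''m'' 0 0" and ?x = "nats s ''x'' 0 0" and ?e = "nums s ''e'' (nats s ''x'' 0 0)"
  let ?I = "\<lambda>k s'. frame ?W s s' \<and> (\<forall>j. 1 \<le> j \<longrightarrow> j \<le> k \<longrightarrow> nums s' ''p'' ?x j = P j) \<and>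
    (\<forall>x. x \<noteq> ?x \<longrightarrow> nums s' ''p'' x = nums s ''p'' x)"
  show ?thesis
    unfolding Newton_def
  proof (rule wp_For[where I = ?I and a = 150 and d = 1 and n = ?m])
    fix k s1 assume I: "?I k s1" "nats s1 ''j'' 0 0 = k" "nats s1 ''m'' 0 0 = ?m" and k: "k < ?m"
    note [simp] = frame_nats[OF conjunct1[OF I(1)]] frame_nums[OF conjunct1[OF I(1)]]
    let ?Q = "\<lambda>s' t. t \<le> 150 * M ^ 1 \<and> nats s' ''j'' 0 0 = k \<and> nats s' ''m'' 0 0 = ?m \<and>
        ?I (Suc k) (set_nat ''j'' 0 0 (Suc k) s')"
    let ?J = "\<lambda>l s'. ?I k s' \<and> nats s' ''j'' 0 0 = k \<and>
      nums s' ''acc'' 0 0 = of_nat (Suc k) * ?e (Suc k) + (\<Sum>i<l. ?e (Suc i) * P (k - i))"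
    show "wp sub (Seq
       (CAssign ''acc'' (CMul (COfNat (NAdd (NVar ''j'') (NConst 1)))
          (CCell ''e'' (NVar ''x'') (NAdd (NVar ''j'') (NConst 1)))))
       (Seq (For ''i'' ''j'' (CAssign ''acc'' (CAdd (CVar ''acc'')
          (CMul (CCell ''e'' (NVar ''x'') (NAdd (NVar ''i'') (NConst 1)))
            (CCell ''p'' (NVar ''x'') (NSub (NVar ''j'') (NVar ''i'')))))))
       (CSet ''p'' (NVar ''x'') (NAdd (NVar ''j'') (NConst 1)) (CSub (CConst 0) (CVar ''acc''))))) s1 ?Q"
      unfolding wp_Seq wp_CSet
    proof (rule wp_For[where I = ?J and a = 50 and d = 0 and n = k])
      fix l s2 assume l: "l < k" and J: "?J l s2" "nats s2 ''i'' 0 0 = l"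
      have fr2: "frame ?W s s2" using J by blast
      have v: "nats s2 ''x'' 0 0 = ?x" "nums s2 ''e'' ?x = ?e"
        by (simp_all add: frame_nats[OF fr2] frame_nums[OF fr2])
      have "nums s2 ''p'' ?x (k - l) = P (k - l)" using J(1) l by simp
      then show "wp sub (CAssign ''acc'' (CAdd (CVar ''acc'')
          (CMul (CCell ''e'' (NVar ''x'') (NAdd (NVar ''i'') (NConst 1)))
            (CCell ''p'' (NVar ''x'') (NSub (NVar ''j'') (NVar ''i'')))))) s2
        (\<lambda>s' t. t \<le> 50 * M ^ 0 \<and> nats s' ''i'' 0 0 = l \<and> nats s' ''j'' 0 0 = k \<and>
          ?J (Suc l) (set_nat ''i'' 0 0 (Suc l) s'))"
        using J v by simp
    next
      fix s2 t2 assume J: "?J k s2" and t2: "t2 \<le> (50 + 20) * M ^ (0 + 1)"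
      have fr2: "frame ?W s s2" using J by blast
      have v: "nats s2 ''x'' 0 0 = ?x" "nats s2 ''m'' 0 0 = ?m"
        by (simp_all add: frame_nats[OF fr2])
      \<comment> \<open>The shift between the counters of the program and the indices of the
        identity.\<close>
      have "(\<Sum>i\<in>{1..<Suc k}. ?e i * P (Suc k - i)) = (\<Sum>i<k. ?e (Suc i) * P (k - i))"
        by (rule sum.reindex_bij_witness[of _ Suc "\<lambda>i. i - 1"]) auto
      then have "P (Suc k) = 0 - nums s2 ''acc'' 0 0"
        using P[of "Suc k"] k J by simp
      then have "?I (Suc k) (set_nat ''j'' 0 0 (Suc k)
          (set_num ''p'' ?x (Suc k) (0 - nums s2 ''acc'' 0 0) s2))"
        using J by (auto simp: le_Suc_eq)
      then show "?Q (set_num ''p'' (nval (NVar ''x'') s2) (nval (NAdd (NVar ''j'') (NConst 1)) s2)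
           (cval (CSub (CConst 0) (CVar ''acc'')) s2) s2)
          (1 + ncost (NConst 0) + ncost (NConst 0) +
             ccost (CMul (COfNat (NAdd (NVar ''j'') (NConst 1)))
               (CCell ''e'' (NVar ''x'') (NAdd (NVar ''j'') (NConst 1)))) +
            (t2 + (1 + ncost (NVar ''x'') + ncost (NAdd (NVar ''j'') (NConst 1)) +
               ccost (CSub (CConst 0) (CVar ''acc'')))))"
        using v J t2 M_ge_1 by simp
    qed (use I k M in auto)
  next
    fix s' t assume "?I ?m s'" and t: "t \<le> (150 + 20) * M ^ (1 + 1)"
    moreover have "t \<le> 200 * M\<^sup>2" using t by (simp add: power2_eq_square)
    ultimately show "Q s' t" by (intro post) auto
  qed (use M in auto)
qed

text \<open>Distinct rows turn the sum over rows into one over sets, and closure under subsets makes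
  these sets all of \<open>Pow S\<close>.\<close>

lemma sum_table:
  assumes "table s X" "\<And>S T. S \<in> X \<Longrightarrow> T \<subseteq> S \<Longrightarrow> T \<in> X" "S \<in> X"
  shows "(\<Sum>y<nats s ''N'' 0 0. if row s y \<subseteq> S then g (row s y) else 0) = (\<Sum>U\<in>Pow S. g U)"
proof -
  have "(\<Sum>y<nats s ''N'' 0 0. if row s y \<subseteq> S then g (row s y) else 0) =
      (\<Sum>U\<in>X. if U \<subseteq> S then g U else 0)"
    using assms(1) sum.reindex[of "row s" "{..<nats s ''N'' 0 0}" "\<lambda>U. if U \<subseteq> S then g U else 0"]
    by (simp add: table_def)
  also have "\<dots> = (\<Sum>U\<in>{U\<in>X. U \<subseteq> S}. g U)"
    using assms(1) by (subst sum.inter_filter) (auto simp: table_def)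
  also have "{U\<in>X. U \<subseteq> S} = Pow S" using assms(2,3) by auto
  finally show ?thesis .
qed

abbreviation "power_sum_vars \<equiv> {''x'', ''y'', ''i'', ''w'', ''sub'', ''e'', ''j'', ''acc'', ''p''}"

lemma wp_PowerSums:
  assumes M: "nats s ''n'' 0 0 < M" "nats s ''m'' 0 0 < M" "nats s ''N'' 0 0 < M"
    and X: "table s X" "\<And>S T. S \<in> X \<Longrightarrow> T \<subseteq> S \<Longrightarrow> T \<in> X"
    and e: "nums s ''e'' = (\<lambda>_ _. 0)"
    and mu: "\<And>x i. x < nats s ''N'' 0 0 \<Longrightarrow> 1 \<le> i \<Longrightarrow> i \<le> nats s ''m'' 0 0 \<Longrightarrow>
      nums s ''mu'' x i = \<mu> i (row s x)"
    and P: "\<And>S j. S \<in> X \<Longrightarrow> 1 \<le> j \<Longrightarrow> j \<le> nats s ''m'' 0 0 \<Longrightarrow>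
      P j S = - (of_nat j * (\<Sum>U\<in>Pow S. \<mu> j U) +
        (\<Sum>i\<in>{1..<j}. (\<Sum>U\<in>Pow S. \<mu> i U) * P (j - i) S))"
    and post: "\<And>s' t. frame power_sum_vars s s' \<Longrightarrow>
      (\<And>x j. x < nats s ''N'' 0 0 \<Longrightarrow> 1 \<le> j \<Longrightarrow> j \<le> nats s ''m'' 0 0 \<Longrightarrow>
        nums s' ''p'' x j = P j (row s x)) \<Longrightarrow>
      t \<le> 600 * M ^ 3 \<Longrightarrow> Q s' t"
  shows "wp sub PowerSums s Q"
proof -
  let ?W = power_sum_vars
  let ?N = "nats s ''N'' 0 0" and ?m = "nats s ''m'' 0 0"
  \<comment> \<open>Rows of \<open>e\<close> not yet treated are still zero, as accumulation adds to
    what is there.\<close>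
  let ?I = "\<lambda>k s'. frame ?W s s' \<and> (\<forall>x\<ge>k. nums s' ''e'' x = (\<lambda>_. 0)) \<and>
    (\<forall>x<k. \<forall>j. 1 \<le> j \<longrightarrow> j \<le> ?m \<longrightarrow> nums s' ''p'' x j = P j (row s x))"
  show ?thesis
    unfolding PowerSums_def
  proof (rule wp_For[where I = ?I and a = 500 and d = 2 and n = ?N])
    fix k s1 assume I: "?I k s1" "nats s1 ''x'' 0 0 = k" "nats s1 ''N'' 0 0 = ?N" and k: "k < ?N"
    note fr1 = conjunct1[OF I(1)]
    have s1: "nats s1 ''m'' 0 0 = ?m" "nats s1 ''n'' 0 0 = nats s ''n'' 0 0"
      by (simp_all add: frame_nats[OF fr1])
    have row1: "row s1 = row s" by (rule row_frame[OF fr1]) auto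
    have kX: "row s k \<in> X" using X(1) k by (auto simp: table_def)
    let ?Q = "\<lambda>s' t. t \<le> 500 * M\<^sup>2 \<and> nats s' ''x'' 0 0 = k \<and> nats s' ''N'' 0 0 = ?N \<and>
        ?I (Suc k) (set_nat ''x'' 0 0 (Suc k) s')"
    show "wp sub (Seq (Accumulate ''e'' (NVar ''x'') (NAdd (NVar ''i'') (NConst 1))
        (CCell ''mu'' (NVar ''y'') (NAdd (NVar ''i'') (NConst 1)))) Newton) s1 ?Q"
      unfolding wp_Seq
    proof (rule wp_Accumulate[where A = "\<lambda>_. k" and B = Suc and h = "\<lambda>y i. nums s ''mu'' y (Suc i)"],
        unfold row1 s1 I(2,3))
      fix s' assume fr: "frame {''y'', ''i'', ''w'', ''sub'', ''e''} s1 s'"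
      show "nval (NVar ''x'') s' = k \<and> nval (NAdd (NVar ''i'') (NConst 1)) s' = Suc (nats s' ''i'' 0 0) \<and>
        cval (CCell ''mu'' (NVar ''y'') (NAdd (NVar ''i'') (NConst 1))) s' =
          nums s ''mu'' (nats s' ''y'' 0 0) (Suc (nats s' ''i'' 0 0))"
        using I(2) by (simp add: frame_nats[OF fr] frame_nums[OF fr] frame_nums[OF fr1])
    next
      fix s2 t2 assume fr: "frame {''y'', ''i'', ''w'', ''sub'', ''e''} s1 s2" and t2: "t2 \<le> 300 * M\<^sup>2"
        and e2: "nums s2 ''e'' = (\<lambda>a b. nums s1 ''e'' a b + (\<Sum>y<?N. if row s y \<subseteq> row s k
          then \<Sum>i<?m. if k = a \<and> Suc i = b then nums s ''mu'' y (Suc i) else 0 else 0))"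
      have fr2: "frame ?W s s2" by (rule frame_trans[OF fr1 fr]) auto
      have s2: "nats s2 ''x'' 0 0 = k" "nats s2 ''m'' 0 0 = ?m" "nats s2 ''N'' 0 0 = ?N"
        "nums s2 ''p'' = nums s1 ''p''"
        using I(2,3) s1 by (simp_all add: frame_nats[OF fr] frame_nums[OF fr])
      have e2k: "nums s2 ''e'' k j = (\<Sum>U\<in>Pow (row s k). \<mu> j U)" if j: "1 \<le> j" "j \<le> ?m" for j
      proof -
        obtain i where i: "j = Suc i" "i < ?m" using j by (cases j) auto
        have "nums s2 ''e'' k j = (\<Sum>y<?N. if row s y \<subseteq> row s k then nums s ''mu'' y j else 0)"
          unfolding e2 using I(1) i by (simp add: sum.delta' if_distrib cong: if_cong)
        also have "\<dots> = (\<Sum>y<?N. if row s y \<subseteq> row s k then \<mu> j (row s y) else 0)"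
          using mu j by (intro sum.cong) auto
        also have "\<dots> = (\<Sum>U\<in>Pow (row s k). \<mu> j U)" by (rule sum_table[OF X kX])
        finally show ?thesis .
      qed
      show "wp sub Newton s2 (\<lambda>s' t'. ?Q s' (t2 + t'))"
      proof (rule wp_Newton[where P = "\<lambda>j. P j (row s k)"], unfold s2)
        fix j assume j: "1 \<le> j" "j \<le> ?m"
        have "(\<Sum>i\<in>{1..<j}. nums s2 ''e'' k i * P (j - i) (row s k)) =
            (\<Sum>i\<in>{1..<j}. (\<Sum>U\<in>Pow (row s k). \<mu> i U) * P (j - i) (row s k))"
          using e2k j by (intro sum.cong) auto
        then show "P j (row s k) = - (of_nat j * nums s2 ''e'' k j +
            (\<Sum>i\<in>{1..<j}. nums s2 ''e'' k i * P (j - i) (row s k)))"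
          using P[OF kX j] e2k[OF j] by simp
      next
        fix s3 t3 assume fr: "frame {''j'', ''i'', ''acc'', ''p''} s2 s3" and t3: "t3 \<le> 200 * M\<^sup>2"
          and p3: "\<And>j. 1 \<le> j \<Longrightarrow> j \<le> ?m \<Longrightarrow> nums s3 ''p'' k j = P j (row s k)"
            "\<And>x. x \<noteq> k \<Longrightarrow> nums s3 ''p'' x = nums s1 ''p'' x"
        have fr3: "frame ?W s s3" by (rule frame_trans[OF fr2 fr]) auto
        have s3: "nats s3 ''x'' 0 0 = k" "nats s3 ''N'' 0 0 = ?N" "nums s3 ''e'' = nums s2 ''e''"
          using s2 by (simp_all add: frame_nats[OF fr] frame_nums[OF fr])
        have "nums s2 ''e'' x = (\<lambda>_. 0)" if "Suc k \<le> x" for x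
        proof -
        have "k \<noteq> x" using that by simp
        then show ?thesis using that I(1) by (simp add: e2 fun_eq_iff cong: if_cong)
      qed
        then have "?I (Suc k) (set_nat ''x'' 0 0 (Suc k) s3)"
          using fr3 s3 p3 I(1) by (auto simp: less_Suc_eq)
        then show "?Q s3 (t2 + t3)" using s3 t2 t3 by simp
      qed (use M in auto)
    qed (use M in auto)
  next
    fix s' t assume "?I ?N s'" and t: "t \<le> (500 + 20) * M ^ (2 + 1)"
    then show "Q s' t" by (intro post) auto
  qed (use M e in auto)
qed

lemma wp_Totals:
  assumes M: "nats s ''n'' 0 0 < M" "nats s ''m'' 0 0 < M" "nats s ''N'' 0 0 < M"
    and X: "table s X" "\<And>S T. S \<in> X \<Longrightarrow> T \<subseteq> S \<Longrightarrow> T \<in> X"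
    and out: "nums s ''out'' = (\<lambda>_ _. 0)"
    and sg: "\<And>x. x < nats s ''N'' 0 0 \<Longrightarrow> nums s ''sg'' x 0 = (-1) ^ card (row s x)"
    and p: "\<And>x j. x < nats s ''N'' 0 0 \<Longrightarrow> 1 \<le> j \<Longrightarrow> j \<le> nats s ''m'' 0 0 \<Longrightarrow>
        nums s ''p'' x j = P j (row s x)"
    and post: "\<And>s' t. frame {''x'', ''y'', ''i'', ''w'', ''sub'', ''out''} s s' \<Longrightarrow>
      (\<And>i. i < nats s ''m'' 0 0 \<Longrightarrow> nums s' ''out'' i 0 = (\<Sum>S\<in>X. moebius (P (Suc i)) S)) \<Longrightarrow>
      t \<le> 400 * M ^ 3 \<Longrightarrow> Q s' t"
  shows "wp sub Totals s Q"
proof -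
  let ?W = "{''x'', ''y'', ''i'', ''w'', ''sub'', ''out''}"
  let ?N = "nats s ''N'' 0 0" and ?m = "nats s ''m'' 0 0"
  let ?I = "\<lambda>k s'. frame ?W s s' \<and>
    (\<forall>i<?m. nums s' ''out'' i 0 = (\<Sum>x<k. moebius (P (Suc i)) (row s x)))"
  show ?thesis
    unfolding Totals_def
  proof (rule wp_For[where I = ?I and a = 300 and d = 2 and n = ?N])
    fix k s1 assume I: "?I k s1" "nats s1 ''x'' 0 0 = k" "nats s1 ''N'' 0 0 = ?N" and k: "k < ?N"
    note fr1 = conjunct1[OF I(1)]
    have s1: "nats s1 ''m'' 0 0 = ?m" "nats s1 ''n'' 0 0 = nats s ''n'' 0 0"
      by (simp_all add: frame_nats[OF fr1])
    have row1: "row s1 = row s" by (rule row_frame[OF fr1]) auto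
    have kX: "row s k \<in> X" using X(1) k by (auto simp: table_def)
    let ?h = "\<lambda>y i. nums s ''sg'' k 0 * nums s ''sg'' y 0 * nums s ''p'' y (Suc i)"
    let ?Q = "\<lambda>s' t. t \<le> 300 * M\<^sup>2 \<and> nats s' ''x'' 0 0 = k \<and> nats s' ''N'' 0 0 = ?N \<and>
        ?I (Suc k) (set_nat ''x'' 0 0 (Suc k) s')"
    show "wp sub (Accumulate ''out'' (NVar ''i'') (NConst 0)
       (CMul (CMul (CCell ''sg'' (NVar ''x'') (NConst 0)) (CCell ''sg'' (NVar ''y'') (NConst 0)))
        (CCell ''p'' (NVar ''y'') (NAdd (NVar ''i'') (NConst 1))))) s1 ?Q"
    proof (rule wp_Accumulate[where A = "\<lambda>i. i" and B = "\<lambda>_. 0" and h = ?h], unfold row1 s1 I(2,3))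
      fix s' assume fr: "frame {''y'', ''i'', ''w'', ''sub'', ''out''} s1 s'"
      show "nval (NVar ''i'') s' = nats s' ''i'' 0 0 \<and> nval (NConst 0) s' = 0 \<and>
        cval (CMul (CMul (CCell ''sg'' (NVar ''x'') (NConst 0)) (CCell ''sg'' (NVar ''y'') (NConst 0)))
          (CCell ''p'' (NVar ''y'') (NAdd (NVar ''i'') (NConst 1)))) s' =
          ?h (nats s' ''y'' 0 0) (nats s' ''i'' 0 0)"
        using I(2) by (simp add: frame_nats[OF fr] frame_nums[OF fr] frame_nums[OF fr1])
    next
      fix s2 t2 assume fr: "frame {''y'', ''i'', ''w'', ''sub'', ''out''} s1 s2" and t2: "t2 \<le> 300 * M\<^sup>2"
        and out2: "nums s2 ''out'' = (\<lambda>a b. nums s1 ''out'' a b + (\<Sum>y<?N. if row s y \<subseteq> row s k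
          then \<Sum>i<?m. if i = a \<and> 0 = b then ?h y i else 0 else 0))"
      have fr2: "frame ?W s s2" by (rule frame_trans[OF fr1 fr]) auto
      have s2: "nats s2 ''x'' 0 0 = k" "nats s2 ''N'' 0 0 = ?N"
        using I(2,3) by (simp_all add: frame_nats[OF fr])
      \<comment> \<open>The products of tabulated signs are the signs of the transform, so each row
        contributes its own transform.\<close>
      have "(\<Sum>y<?N. if row s y \<subseteq> row s k then ?h y i else 0) = moebius (P (Suc i)) (row s k)"
        if "i < ?m" for i
      proof -
        let ?g = "\<lambda>U. (-1) ^ card (row s k) * (-1) ^ card U * P (Suc i) U"
        have "(\<Sum>y<?N. if row s y \<subseteq> row s k then ?h y i else 0) =
            (\<Sum>y<?N. if row s y \<subseteq> row s k then ?g (row s y) else 0)"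
          using that k by (intro sum.cong) (auto simp: sg p)
        also have "\<dots> = (\<Sum>U\<in>Pow (row s k). ?g U)" by (rule sum_table[OF X kX])
        finally show ?thesis by (simp add: moebius_def)
      qed
      then have "?I (Suc k) (set_nat ''x'' 0 0 (Suc k) s2)"
        using fr2 I(1) by (auto simp: out2 sum.delta cong: if_cong)
      then show "?Q s2 t2" using s2 t2 by simp
    qed (use M in auto)
  next
    fix s' t assume I: "?I ?N s'" and t: "t \<le> (300 + 20) * M ^ (2 + 1)"
    have "(\<Sum>x<?N. moebius f (row s x)) = (\<Sum>S\<in>X. moebius f S)" for f
      using X(1) sum.reindex[of "row s" "{..<?N}" "moebius f"] by (simp add: table_def)
    then show "Q s' t" using I t by (intro post) auto
  qed (use M out in auto)
qed

end

section \<open>The algorithm\<close>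

text \<open>The number \<open>\<lfloor>C ln (n / \<epsilon>)\<rfloor>\<close> is found without logarithms: it is the largest \<open>m\<close> with
  \<open>exp (1 / C) ^ m * \<epsilon> \<le> n\<close>, and \<open>exp (1 / C)\<close> is a constant of the program.\<close>

definition Levels :: "real \<Rightarrow> nat \<Rightarrow> com" where
  "Levels C \<alpha> = Seq (CAssign ''q'' (CConst (of_real (exp (1 / C)))))
     (Seq (While (ReLe (CMul (CVar ''q'') (CVar ''eps'')) (COfNat (NVar ''n'')))
        (Seq (Assign ''m'' (NAdd (NVar ''m'') (NConst 1)))
             (CAssign ''q'' (CMul (CVar ''q'') (CConst (of_real (exp (1 / C))))))))
     (Assign ''k'' (nmul \<alpha> (NVar ''m''))))"

text \<open>The last conjunct fails only for a nonempty set without a neighbour of \<open>u\<close>,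
  so the empty set may take any vertex; \<open>k\<close> caps the size.\<close>

definition grow :: bexp where
  "grow = BAnd (NLe (NCell ''F'' (NVar ''r'') (NVar ''u'')) (NConst 0))
     (BAnd (NLess (NVar ''cnt'') (NVar ''k''))
       (BNot (BAnd (NLe (NVar ''touch'') (NConst 0)) (NLe (NConst 1) (NVar ''cnt'')))))"

definition shrink :: bexp where
  "shrink = NLe (NConst 1) (NCell ''F'' (NVar ''r'') (NVar ''u''))"

definition Program :: "real \<Rightarrow> nat \<Rightarrow> com" where
  "Program C \<alpha> = Seq (Levels C \<alpha>) (Seq (Assign ''N'' (NConst 1))
     (Seq (Saturate grow) (Seq (Saturate shrink) (Seq (AllCoefficients \<alpha>)
     (Seq PowerSums (Seq Totals (Assign ''len'' (NVar ''m''))))))))"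

text \<open>Taking logarithms is monotone, and \<open>nat\<close> does not matter since only
  positive integers are compared with the floor.\<close>

lemma level_test:
  assumes "C > 0" "\<epsilon> > 0"
  shows "exp (real (Suc j) / C) * \<epsilon> \<le> real n \<longleftrightarrow> Suc j \<le> nat \<lfloor>C * ln (real n / \<epsilon>)\<rfloor>"
proof (cases "n = 0")
  \<comment> \<open>By convention \<open>ln 0 = 0\<close>, so for \<open>n = 0\<close> the floor is
    0 and both sides are false.\<close>
  case True
  have "exp (real (Suc j) / C) * \<epsilon> > 0" using assms by simp
  then show ?thesis using True by simp
next
  case False
  have "exp (real (Suc j) / C) * \<epsilon> \<le> real n \<longleftrightarrow> exp (real (Suc j) / C) \<le> real n / \<epsilon>"
    using assms by (simp add: pos_le_divide_eq)
  also have "\<dots> \<longleftrightarrow> real (Suc j) / C \<le> ln (real n / \<epsilon>)"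
    using False assms by (simp add: ln_ge_iff)
  also have "\<dots> \<longleftrightarrow> real (Suc j) \<le> C * ln (real n / \<epsilon>)"
    using assms by (simp add: pos_divide_le_eq mult.commute)
  also have "\<dots> \<longleftrightarrow> Suc j \<le> nat \<lfloor>C * ln (real n / \<epsilon>)\<rfloor>"
    by linarith
  finally show ?thesis .
qed

lemma downward_closed:
  assumes "\<And>S u. S \<in> X \<Longrightarrow> u \<in> S \<Longrightarrow> S - {u} \<in> X" "S \<in> X" "finite S" "T \<subseteq> S"
  shows "T \<in> X"
proof -
  have "finite D \<Longrightarrow> D \<subseteq> S \<Longrightarrow> S - D \<in> X" for D
  proof (induction D rule: finite_induct)
    case (insert x D)
    then have "S - D \<in> X" "x \<in> S - D" by blast+
    then have "S - D - {x} \<in> X" by (rule assms(1))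
    then show ?case unfolding Diff_insert[of S x D] .
  qed (simp add: assms(2))
  from this[of "S - T"] have "S - (S - T) \<in> X" using assms(3) by blast
  then show ?thesis unfolding double_diff[OF assms(4) order_refl] .
qed

section \<open>Correctness of the whole program\<close>

context machine
begin

lemma wp_Levels:
  assumes "C > 0" "\<epsilon> > 0" and m: "m = nat \<lfloor>C * ln (real (nats s ''n'' 0 0) / \<epsilon>)\<rfloor>" "m < M"
    and s: "nums s ''eps'' 0 0 = complex_of_real \<epsilon>" "nats s ''m'' 0 0 = 0"
    and post: "\<And>s' t. frame {''q'', ''m'', ''k''} s s' \<Longrightarrow> nats s' ''m'' 0 0 = m \<Longrightarrow>
      nats s' ''k'' 0 0 = \<alpha> * m \<Longrightarrow> t \<le> (4 * \<alpha> + 200) * M \<Longrightarrow> Q s' t"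
  shows "wp sub (Levels C \<alpha>) s Q"
proof -
  let ?W = "{''q'', ''m'', ''k''}" and ?n = "nats s ''n'' 0 0"
  let ?b = "ReLe (CMul (CVar ''q'') (CVar ''eps'')) (COfNat (NVar ''n''))"
  let ?c = "Seq (Assign ''m'' (NAdd (NVar ''m'') (NConst 1)))
             (CAssign ''q'' (CMul (CVar ''q'') (CConst (of_real (exp (1 / C))))))"
  \<comment> \<open>The power in \<open>q\<close> is one ahead of \<open>m\<close>: the loop tests
    whether level \<open>m + 1\<close> is still admissible.\<close>
  let ?I = "\<lambda>s'. frame ?W s s' \<and> nats s' ''m'' 0 0 \<le> m \<and>
    nums s' ''q'' 0 0 = complex_of_real (exp (real (Suc (nats s' ''m'' 0 0)) / C))"
  let ?s = "set_num ''q'' 0 0 (of_real (exp (1 / C))) s"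
  have test: "bval ?b s' \<longleftrightarrow> Suc (nats s' ''m'' 0 0) \<le> m" if "?I s'" for s'
  proof -
    have "bval ?b s' \<longleftrightarrow> exp (real (Suc (nats s' ''m'' 0 0)) / C) * \<epsilon> \<le> real ?n"
      using that s by (simp add: frame_nats[of ?W s s'] frame_nums[of ?W s s'] flip: of_real_mult)
    then show ?thesis using level_test[OF assms(1,2)] m(1) by simp
  qed
  have I0: "?I ?s" using s by simp
  have wp: "wp sub (While ?b ?c) ?s (\<lambda>s' t. ?I s' \<and> \<not> bval ?b s' \<and>
      t \<le> (m - nats ?s ''m'' 0 0) * (bcost ?b + 30) + bcost ?b)"
  proof (rule wp_While[where I = ?I and f = "\<lambda>s. m - nats s ''m'' 0 0"])
    fix s' assume I: "?I s'" and b: "bval ?b s'"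
    have "exp (real (Suc (nats s' ''m'' 0 0)) / C) * exp (1 / C) =
        exp (real (Suc (Suc (nats s' ''m'' 0 0))) / C)"
      by (simp add: add_divide_distrib flip: exp_add)
    then have "complex_of_real (exp (real (Suc (nats s' ''m'' 0 0)) / C)) * complex_of_real (exp (1 / C)) =
        complex_of_real (exp (real (Suc (Suc (nats s' ''m'' 0 0))) / C))"
      by (metis of_real_mult)
    then show "wp sub ?c s' (\<lambda>s'' t. t \<le> 30 \<and> ?I s'' \<and> m - nats s'' ''m'' 0 0 < m - nats s' ''m'' 0 0)"
      using I test[OF I] b by (simp del: bval.simps)
  qed (rule I0)
  have cost: "4 * \<alpha> + 50 * m + 40 \<le> (4 * \<alpha> + 200) * M"
  proof -
    have "4 * \<alpha> \<le> 4 * \<alpha> * M" using M_ge_1 by simp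
    then show ?thesis unfolding distrib_right using m(2) M_ge_1 by linarith
  qed
  show ?thesis
    unfolding Levels_def wp_Seq wp_CSet
  proof (rule wp_mono, simp only: nval.simps cval.simps, rule wp, elim conjE)
    fix s' t
    assume I: "frame ?W s s'" "nats s' ''m'' 0 0 \<le> m"
      "nums s' ''q'' 0 0 = complex_of_real (exp (real (Suc (nats s' ''m'' 0 0)) / C))"
      and b: "\<not> bval ?b s'" and t: "t \<le> (m - nats ?s ''m'' 0 0) * (bcost ?b + 30) + bcost ?b"
    have "nats s' ''m'' 0 0 = m" using test[of s'] I b by simp
    then show "wp sub (Assign ''k'' (nmul \<alpha> (NVar ''m''))) s' (\<lambda>s'' t'. Q s''
        (1 + ncost (NConst 0) + ncost (NConst 0) + ccost (CConst (complex_of_real (exp (1 / C)))) + (t + t')))"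
      unfolding wp_NSet using I t s cost by (intro post) auto
  qed
qed

text \<open>The first saturation stays within the connected sets and reaches all of them; the second
  stays within their subsets and closes the table under deletion. Localisation then gives the power
  sums.\<close>

lemma wp_Program:
  assumes big: "bigcp \<alpha> \<beta> lam Qc p" and G: "fin_graph G" "verts G = {..<n}"
    and pos: "C > 0" "\<epsilon> > 0" and m: "m = nat \<lfloor>C * ln (real n / \<epsilon>)\<rfloor>"
    and M: "n < M" "m < M" "\<alpha> * m < M"
      "card {U. \<exists>S. connected_set G S \<and> card S \<le> \<alpha> * m \<and> U \<subseteq> S} < M"
    and call: "\<And>H c i. fin_graph H \<Longrightarrow> verts H = {..<c} \<Longrightarrow> c \<le> \<alpha> * i \<Longrightarrow> c \<le> \<alpha> * m \<Longrightarrow>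
      \<exists>t\<le>M. sub c (adjacency H) i (lam H i) t"
  shows "wp sub (Program C \<alpha>) (input n (adjacency G) 0 (complex_of_real \<epsilon>))
    (\<lambda>s' t. t \<le> (20 * \<alpha> + 5000) * M ^ 4 \<and>
      outputs s' (map (inverse_power_sum (p G)) [1..<m + 1]))"
  (is "wp _ _ ?s0 ?post")
proof -
  let ?k = "\<alpha> * m"
  let ?C = "{S. connected_set G S \<and> card S \<le> ?k}"
  let ?F = "{U. \<exists>S. connected_set G S \<and> card S \<le> ?k \<and> U \<subseteq> S}"
  have fin: "finite (verts G)" using G by (simp add: fin_graph_def)
  have F: "finite ?F" "?C \<subseteq> ?F" "?F \<subseteq> Pow (verts G)" "\<And>S. S \<in> ?F \<Longrightarrow> card S \<le> ?k"
  proof -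
    show "?F \<subseteq> Pow (verts G)" using connected_set_finite_subset by blast
    then show "finite ?F" by (rule finite_subset) (simp add: fin)
    show "card S \<le> ?k" if "S \<in> ?F" for S
    proof -
      obtain T where "connected_set G T" "card T \<le> ?k" "S \<subseteq> T" using \<open>S \<in> ?F\<close> by blast
      then show ?thesis using card_mono[of T S] connected_set_finite_subset[of G T] by linarith
    qed
  qed auto
  have C: "finite ?C" by (rule finite_subset[OF F(2,1)])
  have card_C: "card ?C < M" using card_mono[OF F(1,2)] M(4) by (rule le_less_trans)
  let ?s0n = "nats ?s0" and ?s0c = "nums ?s0"
  have s0: "?s0n ''n'' 0 0 = n" "?s0n ''adj'' = adjacency G" "?s0n ''F'' = (\<lambda>_ _. 0)"
    "?s0n ''m'' 0 0 = 0" "?s0c ''e'' = (\<lambda>_ _. 0)" "?s0c ''out'' = (\<lambda>_ _. 0)"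
    "?s0c ''eps'' 0 0 = complex_of_real \<epsilon>"
    by (simp_all add: input_def)
  let ?A1 = "{''q'', ''m'', ''k'', ''N''}"
  let ?A2 = "?A1 \<union> saturate_vars"
  let ?A3 = "?A2 \<union> coefficient_vars"
  let ?A4 = "?A3 \<union> power_sum_vars"
  define P where "P j S = inverse_power_sum (p (induced G S)) j" for j S
  define \<mu> where "\<mu> i S = (if card S \<le> \<alpha> * i then lam (induced G S) i else 0)" for i S
  show ?thesis
    unfolding Program_def wp_Seq
  proof (rule wp_Levels[OF pos], unfold s0)
    fix s1 t1 assume fr: "frame {''q'', ''m'', ''k''} ?s0 s1" and t1: "t1 \<le> (4 * \<alpha> + 200) * M"
      and m1: "nats s1 ''m'' 0 0 = m" "nats s1 ''k'' 0 0 = \<alpha> * m"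
    define s2 where "s2 = set_nat ''N'' 0 0 1 s1"
    have fr1: "frame ?A1 ?s0 s1" by (rule frame_trans[OF fr frame_refl[of "{}"]]) auto
    then have fr2: "frame ?A1 ?s0 s2" by (simp add: s2_def)
    have s2: "nats s2 ''n'' 0 0 = n" "nats s2 ''m'' 0 0 = m" "nats s2 ''k'' 0 0 = \<alpha> * m"
      "nats s2 ''adj'' = adjacency G" "nats s2 ''F'' = (\<lambda>_ _. 0)" "nats s2 ''N'' 0 0 = 1"
      using m1 s0 by (simp_all add: frame_nats[OF fr1] s2_def)
    have four: "1 + 1 + 1 + 1 = (4::nat)" by simp
    \<comment> \<open>With \<open>N = 1\<close> the table consists of row 0, and the zero array
      encodes the empty set.\<close>
    have tab2: "table s2 {{}}"
      by (simp add: table_def row_def s2 lessThan_Suc)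
    let ?P1 = "\<lambda>S u. u \<notin> S \<and> card S < ?k \<and> (S = {} \<or> (\<exists>v\<in>S. {v, u} \<in> edges G))"
    have "wp sub (Saturate grow) s2 (\<lambda>s3 t3. wp sub (Saturate shrink) s3
      (\<lambda>s4 t4. wp sub (AllCoefficients \<alpha>) s4 (\<lambda>s5 t5. wp sub PowerSums s5
      (\<lambda>s6 t6. wp sub Totals s6 (\<lambda>s7 t7. wp sub (Assign ''len'' (NVar ''m'')) s7
      (\<lambda>s8 t8. ?post s8 (t1 + (4 + (t3 + (t4 + (t5 + (t6 + (t7 + t8))))))))))))) "
    proof (rule wp_Saturate[where Fam = ?C and X = "{{}}" and P = ?P1], unfold s2)
      fix S u assume S: "S \<in> ?C" "u < n" "?P1 S u"
      then have "connected_set G (insert u S)" using G(2) by (intro connected_set.insert) auto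
      moreover have "card (insert u S) \<le> ?k"
        using S(3) card_insert_le_m1[of ?k S u] by (cases ?k) auto
      ultimately show "flip S u \<in> ?C" using S(3) by (simp add: flip_def)
    next
      fix s' R u
      assume fr: "frame saturate_vars s2 s'" and R: "R = row s' (nats s' ''r'' 0 0)"
        and u: "u = nats s' ''u'' 0 0" "u < n" and cnt: "nats s' ''cnt'' 0 0 = card R"
        and touch: "1 \<le> nats s' ''touch'' 0 0 \<longleftrightarrow> (\<exists>v\<in>R. 1 \<le> adjacency G v u)"
      have "nats s' ''k'' 0 0 = ?k" "nats s' ''n'' 0 0 = n"
        using s2 by (simp_all add: frame_nats[OF fr])
      moreover have "u \<in> R \<longleftrightarrow> 1 \<le> nats s' ''F'' (nats s' ''r'' 0 0) u"
        using u calculation(2) by (simp add: R row_def)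
      moreover have "1 \<le> nats s' ''touch'' 0 0 \<longleftrightarrow> (\<exists>v\<in>R. {v, u} \<in> edges G)"
        unfolding touch by (auto simp: adjacency_def)
      moreover have "1 \<le> card R \<longleftrightarrow> R \<noteq> {}"
        by (simp add: R Suc_le_eq card_gt_0_iff)
      ultimately show "bval grow s' \<longleftrightarrow> ?P1 R u"
        using cnt u(1) by (auto simp: grow_def not_le)
    next
      fix s3 t3 X1
      assume fr: "frame saturate_vars s2 s3" and tab3: "table s3 X1" and X1: "{{}} \<subseteq> X1" "X1 \<subseteq> ?C"
        "\<And>S u. S \<in> X1 \<Longrightarrow> u < n \<Longrightarrow> ?P1 S u \<Longrightarrow> flip S u \<in> X1" and t3: "t3 \<le> 1000 * M ^ 4"
      have fr3: "frame ?A2 ?s0 s3" by (rule frame_trans[OF fr2 fr]) auto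
      have s3: "nats s3 ''n'' 0 0 = n" "nats s3 ''m'' 0 0 = m" "nats s3 ''adj'' = adjacency G"
        using s2 by (simp_all add: frame_nats[OF fr])
      have X1_F: "X1 \<subseteq> ?F" using X1(2) F(2) by (rule subset_trans)
      \<comment> \<open>Follow the construction of the set: each intermediate set has fewer than
        \<open>\<alpha> * m\<close> vertices, so the size cap never blocks the next
        insertion.\<close>
      have C_X1: "S \<in> X1" if "connected_set G S" "card S \<le> ?k" for S
        using that
      proof (induction rule: connected_set.induct)
        case empty
        then show ?case using X1(1) by simp
      next
        case (insert S v)
        have "finite S" using insert.hyps(1) connected_set_finite_subset by blast
        then have "card S < ?k" using insert.prems insert.hyps(3) by simp
        then have "flip S v \<in> X1" using insert G(2) by (intro X1(3)) auto
        then show ?case using insert.hyps(3) by (simp add: flip_def)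
      qed
      show "wp sub (Saturate shrink) s3
        (\<lambda>s4 t4. wp sub (AllCoefficients \<alpha>) s4 (\<lambda>s5 t5. wp sub PowerSums s5
        (\<lambda>s6 t6. wp sub Totals s6 (\<lambda>s7 t7. wp sub (Assign ''len'' (NVar ''m'')) s7
        (\<lambda>s8 t8. ?post s8 (t1 + (4 + (t3 + (t4 + (t5 + (t6 + (t7 + t8))))))))))))"
      proof (rule wp_Saturate[where Fam = ?F and X = X1 and P = "\<lambda>S u. u \<in> S"], unfold s3)
        fix S u assume "S \<in> ?F" "u \<in> S"
        then show "flip S u \<in> ?F" by (auto simp: flip_def)
      next
        fix s' R u
        assume fr: "frame saturate_vars s3 s'" and R: "R = row s' (nats s' ''r'' 0 0)"
          and u: "u = nats s' ''u'' 0 0" "u < n"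
        have "nats s' ''n'' 0 0 = n" using s3 by (simp add: frame_nats[OF fr])
        then show "bval shrink s' \<longleftrightarrow> u \<in> R" using u by (simp add: shrink_def R row_def)
      next
        fix s4 t4 X
        assume fr: "frame saturate_vars s3 s4" and tab4: "table s4 X" and X: "X1 \<subseteq> X" "X \<subseteq> ?F"
          "\<And>S u. S \<in> X \<Longrightarrow> u < n \<Longrightarrow> u \<in> S \<Longrightarrow> flip S u \<in> X" and t4: "t4 \<le> 1000 * M ^ 4"
        have fr4: "frame ?A2 ?s0 s4" by (rule frame_trans[OF fr3 fr]) auto
        have s4: "nats s4 ''n'' 0 0 = n" "nats s4 ''m'' 0 0 = m" "nats s4 ''adj'' = adjacency G"
          using s3 by (simp_all add: frame_nats[OF fr])
        have X_sub: "S \<subseteq> {..<n}" if "S \<in> X" for S using that X(2) F(3) G(2) by auto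
        have down: "T \<in> X" if "S \<in> X" "T \<subseteq> S" for S T
        proof (rule downward_closed[OF _ that(1) _ that(2)])
          show "S - {u} \<in> X" if "S \<in> X" "u \<in> S" for S u
            using X(3)[OF that(1) _ that(2)] X_sub[OF that(1)] that(2) by (auto simp: flip_def)
          show "finite S" using X_sub[OF that(1)] finite_subset by blast
        qed
        have "card X \<le> card ?F" using X(2) F(1) by (rule card_mono[rotated])
        then have N4: "nats s4 ''N'' 0 0 < M" using table_card[OF tab4] M(4) by simp
        let ?N = "nats s4 ''N'' 0 0"
        have row4: "row s4 x \<in> X" if "x < ?N" for x using tab4 that by (auto simp: table_def)
        show "wp sub (AllCoefficients \<alpha>) s4 (\<lambda>s5 t5. wp sub PowerSums s5
          (\<lambda>s6 t6. wp sub Totals s6 (\<lambda>s7 t7. wp sub (Assign ''len'' (NVar ''m'')) s7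
          (\<lambda>s8 t8. ?post s8 (t1 + (4 + (t3 + (t4 + (t5 + (t6 + (t7 + t8)))))))))))"
        proof (rule wp_AllCoefficients[where lam = lam and k = ?k, OF G(1)], unfold s4)
          fix x assume "x < ?N"
          then show "card (row s4 x) \<le> ?k" using row4 X(2) F(4) by blast
        next
          fix i show "graph_invariant (\<lambda>H. lam H i)" using big unfolding bigcp_def by blast
        next
          fix s5 t5 assume fr: "frame coefficient_vars s4 s5" and t5: "t5 \<le> (6 * \<alpha> + 500) * M ^ 4"
            and mu: "\<And>x i. x < ?N \<Longrightarrow> 1 \<le> i \<Longrightarrow> i \<le> m \<Longrightarrow> nums s5 ''mu'' x i =
              (if card (row s4 x) \<le> \<alpha> * i then lam (induced G (row s4 x)) i else 0)"
            and sg: "\<And>x. x < ?N \<Longrightarrow> nums s5 ''sg'' x 0 = (-1) ^ card (row s4 x)"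
          have fr5: "frame ?A3 ?s0 s5" by (rule frame_trans[OF fr4 fr]) auto
          have s5: "nats s5 ''n'' 0 0 = n" "nats s5 ''m'' 0 0 = m" "nats s5 ''N'' 0 0 = ?N"
            "nums s5 ''e'' = (\<lambda>_ _. 0)"
            using s4 s0 by (simp_all add: frame_nats[OF fr] frame_nums[OF fr5])
          have row5: "row s5 = row s4" by (rule row_frame[OF fr]) auto
          have tab5: "table s5 X" using tab4 table_cong[OF row5] s5 by simp
          show "wp sub PowerSums s5 (\<lambda>s6 t6. wp sub Totals s6 (\<lambda>s7 t7.
            wp sub (Assign ''len'' (NVar ''m'')) s7
            (\<lambda>s8 t8. ?post s8 (t1 + (4 + (t3 + (t4 + (t5 + (t6 + (t7 + t8))))))))))"
          proof (rule wp_PowerSums[where \<mu> = \<mu> and P = P, OF _ _ _ tab5 down], unfold s5 row5)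
            fix x i assume "x < ?N" "1 \<le> i" "i \<le> m"
            then show "nums s5 ''mu'' x i = \<mu> i (row s4 x)" using mu by (simp add: \<mu>_def)
          next
            fix S j assume S: "S \<in> X" and j: "1 \<le> j" "j \<le> m"
            have S': "fin_graph (induced G S)"
              using X_sub[OF S] G by (auto intro: fin_graph_induced)
            \<comment> \<open>For \<open>U\<close> inside \<open>S\<close> the weight \<mu> refers
              to \<open>induced G U\<close> directly, so one array \<open>mu\<close> serves every
              \<open>S\<close>.\<close>
            have e: "coeff (p (induced G S)) i = (\<Sum>U\<in>Pow S. \<mu> i U)" for i
              unfolding coeff_eq_sum_induced[OF big S']
              by (rule sum.cong) (auto simp: \<mu>_def induced_induced)
            show "P j S = - (of_nat j * (\<Sum>U\<in>Pow S. \<mu> j U) +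
                (\<Sum>i\<in>{1..<j}. (\<Sum>U\<in>Pow S. \<mu> i U) * P (j - i) S))"
              unfolding P_def e[symmetric]
              using j bigcp_coeff_0[OF big S'] by (intro newton_identity) auto
          next
            fix s6 t6 assume fr: "frame power_sum_vars s5 s6" and t6: "t6 \<le> 600 * M ^ 3"
              and p6: "\<And>x j. x < ?N \<Longrightarrow> 1 \<le> j \<Longrightarrow> j \<le> m \<Longrightarrow> nums s6 ''p'' x j = P j (row s4 x)"
            have fr6: "frame ?A4 ?s0 s6" by (rule frame_trans[OF fr5 fr]) auto
            have s6: "nats s6 ''n'' 0 0 = n" "nats s6 ''m'' 0 0 = m" "nats s6 ''N'' 0 0 = ?N"
              "nums s6 ''out'' = (\<lambda>_ _. 0)" "nums s6 ''sg'' = nums s5 ''sg''"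
              using s5 s0 by (simp_all add: frame_nats[OF fr] frame_nums[OF fr6] frame_nums[OF fr])
            have row6: "row s6 = row s4"
              using row_frame[OF fr] row5 by simp
            have tab6: "table s6 X" using tab4 table_cong[OF row6] s6 by simp
            show "wp sub Totals s6 (\<lambda>s7 t7. wp sub (Assign ''len'' (NVar ''m'')) s7
              (\<lambda>s8 t8. ?post s8 (t1 + (4 + (t3 + (t4 + (t5 + (t6 + (t7 + t8)))))))))"
            proof (rule wp_Totals[where P = P, OF _ _ _ tab6 down], unfold s6 row6)
              fix s7 t7 assume fr: "frame {''x'', ''y'', ''i'', ''w'', ''sub'', ''out''} s6 s7"
                and out: "\<And>i. i < m \<Longrightarrow> nums s7 ''out'' i 0 = (\<Sum>S\<in>X. moebius (P (Suc i)) S)"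
                and t7: "t7 \<le> 400 * M ^ 3"
              have m7: "nats s7 ''m'' 0 0 = m" using s6 by (simp add: frame_nats[OF fr])
              have "nums s7 ''out'' j 0 = inverse_power_sum (p G) (Suc j)" if j: "j < m" for j
              proof -
                have "inverse_power_sum (p G) (Suc j) = (\<Sum>S\<in>X. moebius (P (Suc j)) S)"
                  unfolding P_def
                proof (rule inverse_power_sum_localised[OF big G(1)])
                  show "X \<subseteq> Pow (verts G)" using X_sub G(2) by auto
                  fix S assume "connected_set G S" "card S \<le> \<alpha> * Suc j"
                  moreover have "\<alpha> * Suc j \<le> ?k" using j by (intro mult_le_mono) auto
                  ultimately show "S \<in> X" using C_X1 X(1) by auto
                qed simp
                then show ?thesis using out[OF j] by simp
              qed
              then have "outputs (set_nat ''len'' 0 0 m s7) (map (inverse_power_sum (p G)) [1..<m + 1])"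
                by (simp add: outputs_def del: upt_Suc)
              \<comment> \<open>The summands 4 and 6 are the assignments to \<open>N\<close> and
                \<open>len\<close>.\<close>
              moreover have "t1 + (4 + (t3 + (t4 + (t5 + (t6 + (t7 + 6)))))) \<le> (20 * \<alpha> + 5000) * M ^ 4"
              proof -
                have "4 * \<alpha> * M \<le> 4 * \<alpha> * M ^ 4" using M_powers by (intro mult_left_mono) linarith+
                then show ?thesis
                  using t1 t3 t4 t5 t6 t7 M_powers unfolding distrib_right by linarith
              qed
              ultimately show "wp sub (Assign ''len'' (NVar ''m'')) s7 (\<lambda>s8 t8.
                  ?post s8 (t1 + (4 + (t3 + (t4 + (t5 + (t6 + (t7 + t8))))))))"
                using m7 by simp
            qed (use M N4 sg p6 in auto)
          qed (use M N4 in auto)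
        qed (use M N4 G call in auto)
      qed (fact M tab3 X1_F F(1) | simp add: shrink_def)+
    qed (fact M tab2 C card_C | simp add: grow_def connected_set.empty)+
    then show "wp sub (Assign ''N'' (NConst 1)) s1 (\<lambda>s2 t2. wp sub (Saturate grow) s2
      (\<lambda>s3 t3. wp sub (Saturate shrink) s3
      (\<lambda>s4 t4. wp sub (AllCoefficients \<alpha>) s4 (\<lambda>s5 t5. wp sub PowerSums s5
      (\<lambda>s6 t6. wp sub Totals s6 (\<lambda>s7 t7. wp sub (Assign ''len'' (NVar ''m'')) s7
      (\<lambda>s8 t8. ?post s8 (t1 + (t2 + (t3 + (t4 + (t5 + (t6 + (t7 + t8))))))))))))))"
      unfolding wp_NSet[of sub "''N''"] nval.simps ncost.simps four s2_def[symmetric] .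
  qed (use m M in auto)
qed

end

text \<open>An exponential in a logarithm is a power: \<open>B ^ (C ln X) = X ^ (C ln B)\<close>.
  The ratio \<open>X\<close> replaces \<open>n / \<epsilon>\<close>, which may be below 1.\<close>

lemma power_floor_ln_le:
  fixes C \<epsilon> :: real and n B :: nat
  assumes "C > 0" "\<epsilon> > 0" "B \<ge> 1"
  defines "X \<equiv> real (max n 1) / min \<epsilon> 1"
  shows "real (B ^ nat \<lfloor>C * ln (real n / \<epsilon>)\<rfloor>) \<le> X ^ nat \<lceil>C * ln (real B)\<rceil>"
proof -
  let ?m = "nat \<lfloor>C * ln (real n / \<epsilon>)\<rfloor>" and ?c = "nat \<lceil>C * ln (real B)\<rceil>"
  have X: "1 \<le> X"
    using assms(2) unfolding X_def by (simp add: le_divide_eq_1 min_le_iff_disj le_max_iff_disj)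
  have "real ?m \<le> C * ln X"
  proof (cases "n = 0")
    case False
    have "real n / \<epsilon> \<le> X"
      unfolding X_def using assms(2) by (intro frac_le) auto
    then have "C * ln (real n / \<epsilon>) \<le> C * ln X"
      using assms(1,2) False X by simp
    moreover have "0 \<le> C * ln X" using assms(1) X by simp
    ultimately show ?thesis by linarith
  qed (use assms(1) X in simp)
  moreover have "0 \<le> ln (real B)" using assms(3) by simp
  ultimately have "real ?m * ln (real B) \<le> C * ln X * ln (real B)" by (rule mult_right_mono)
  also have "\<dots> = C * ln (real B) * ln X" by simp
  also have "\<dots> \<le> real ?c * ln X"
    using X by (intro mult_right_mono) (linarith, simp)
  finally have "exp (real ?m * ln (real B)) \<le> exp (real ?c * ln X)" by simp
  moreover have "exp (real ?m * ln (real B)) = real (B ^ ?m)"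
    using assms(3) by (simp add: exp_of_nat_mult)
  moreover have "exp (real ?c * ln X) = X ^ ?c" using X by (simp add: exp_of_nat_mult)
  ultimately show ?thesis by simp
qed

text \<open>The program depends on \<open>C\<close> and \<open>\<alpha>\<close> only and reaches
  \<open>p\<close> through calls of the subroutine; \<open>\<Delta>\<close>, \<open>\<beta>\<close>
  and the time constant of \<open>Q\<close> go into \<open>K\<close>.\<close>

theorem theorem3p1:
  fixes C :: real and \<Delta> \<alpha> \<beta> :: nat
  assumes "C > 0"
  shows "\<exists>P. \<forall>p lam Q. bigcp \<alpha> \<beta> lam Q p \<longrightarrow>
    (\<exists>K::nat. \<forall>G n (\<epsilon>::real).
       fin_graph G \<longrightarrow> verts G = {..<n} \<longrightarrow> max_degree_le G \<Delta> \<longrightarrow> \<epsilon> > 0 \<longrightarrow>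
       (\<exists>t s. exec (run_as_sub Q) P (input n (adjacency G) 0 (complex_of_real \<epsilon>)) t s \<and>
          real t \<le> real K * (real (max n 1) / min \<epsilon> 1) ^ K \<and>
          outputs s (map (inverse_power_sum (p G)) [1..<nat \<lfloor>C * ln (real n / \<epsilon>)\<rfloor> + 1])))"
proof (intro exI[of _ "Program C \<alpha>"] allI impI)
  fix p lam Q assume big: "bigcp \<alpha> \<beta> lam Q p"
  then have "computes_coeffs \<alpha> \<beta> lam Q" unfolding bigcp_def by blast
  then obtain L :: nat where L: "\<And>i k H. fin_graph H \<Longrightarrow> verts H = {..<k} \<Longrightarrow> k \<le> \<alpha> * i \<Longrightarrow>
      \<exists>t\<le>L * \<beta> ^ k. run_as_sub Q k (adjacency H) i (lam H i) t"
    unfolding computes_coeffs_def by blast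
  \<comment> \<open>Per unit of \<open>\<alpha> * m\<close>: a factor 2 for subsets and another 2 to
    absorb the number of walk lengths, \<open>(\<Delta> + 1)\<^sup>2\<close> for the walks, and
    \<open>\<beta> + 1\<close> for the subroutine.\<close>
  define B0 where "B0 = 4 * (\<Delta> + 1)\<^sup>2 * (\<beta> + 1)"
  \<comment> \<open>The extra 2 makes \<open>B ^ m\<close> exceed \<open>m\<close> even if
    \<open>\<alpha> = 0\<close>.\<close>
  define B where "B = 2 * B0 ^ \<alpha>"
  define c where "c = nat \<lceil>C * ln (real B)\<rceil>"
  define a where "a = (20 * \<alpha> + 5000) * (L + 3) ^ 4"
  define K where "K = a + 4 * (c + 1)"
  have B0: "4 \<le> B0" using mult_le_mono[of 1 "(\<Delta> + 1)\<^sup>2" 1 "\<beta> + 1"] by (simp add: B0_def)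
  show "\<exists>K::nat. \<forall>G n (\<epsilon>::real).
       fin_graph G \<longrightarrow> verts G = {..<n} \<longrightarrow> max_degree_le G \<Delta> \<longrightarrow> \<epsilon> > 0 \<longrightarrow>
       (\<exists>t s. exec (run_as_sub Q) (Program C \<alpha>) (input n (adjacency G) 0 (complex_of_real \<epsilon>)) t s \<and>
          real t \<le> real K * (real (max n 1) / min \<epsilon> 1) ^ K \<and>
          outputs s (map (inverse_power_sum (p G)) [1..<nat \<lfloor>C * ln (real n / \<epsilon>)\<rfloor> + 1]))"
  proof (rule exI[of _ K], intro allI impI)
    fix G n and \<epsilon> :: real
    assume G: "fin_graph G" "verts G = {..<n}" "max_degree_le G \<Delta>" and \<epsilon>: "\<epsilon> > 0"
    define m where "m = nat \<lfloor>C * ln (real n / \<epsilon>)\<rfloor>"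
    define X where "X = real (max n 1) / min \<epsilon> 1"
    define n' where "n' = max n 1"
    \<comment> \<open>\<open>L\<close> covers the time of the calls, and 3 puts \<open>M\<close>
      strictly above the family, whose size is at most \<open>2 * (n' * B ^ m)\<close>.\<close>
    define M where "M = (L + 3) * (n' * B ^ m)"
    let ?k = "\<alpha> * m"
    let ?F = "{U. \<exists>S. connected_set G S \<and> card S \<le> ?k \<and> U \<subseteq> S}"
    have n': "n \<le> n'" "1 \<le> n'" by (auto simp: n'_def)
    have Bm: "B ^ m = 2 ^ m * B0 ^ ?k" by (simp add: B_def power_mult_distrib power_mult)
    have "1 \<le> B0 ^ ?k" using B0 by simp
    have m_less: "m < B ^ m"
    proof -
      have "m < 2 ^ m" by simp
      also have "(2::nat) ^ m \<le> B ^ m" unfolding Bm using \<open>1 \<le> B0 ^ ?k\<close> by simp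
      finally show ?thesis .
    qed
    have B0k: "B0 ^ ?k \<le> B ^ m" unfolding Bm by simp
    have k_less: "?k < B ^ m"
    proof -
      have "?k < 2 ^ ?k" by simp
      also have "(2::nat) ^ ?k \<le> B0 ^ ?k" using B0 by (intro power_mono) auto
      also note B0k
      finally show ?thesis .
    qed
    have Bm': "B ^ m \<le> n' * B ^ m" "1 \<le> B ^ m" using n' m_less by auto
    have n_le: "n \<le> n' * B ^ m" using n' Bm'(2) by (metis mult_le_mono nat_mult_1_right)
    have F_le: "card ?F \<le> 2 * (n' * B ^ m)"
    proof -
      have "card ?F \<le> (1 + ?k * (card (verts G) * (\<Delta> + 1) ^ (2 * ?k))) * 2 ^ ?k"
        by (rule card_subsets_connected_sets[OF G(1,3)])
      \<comment> \<open>The factor \<open>\<alpha> * m\<close> is bounded by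
        \<open>2 ^ (\<alpha> * m)\<close>, and the 1 for the empty set by doubling.\<close>
      also have "\<dots> \<le> (2 * (2 ^ ?k * (n' * (\<Delta> + 1) ^ (2 * ?k)))) * 2 ^ ?k"
      proof (rule mult_right_mono)
        have "?k * (card (verts G) * (\<Delta> + 1) ^ (2 * ?k)) \<le> 2 ^ ?k * (n' * (\<Delta> + 1) ^ (2 * ?k))"
          using n' G(2) by (intro mult_le_mono) auto
        moreover have "1 \<le> 2 ^ ?k * (n' * (\<Delta> + 1) ^ (2 * ?k))" using n' by simp
        ultimately show "1 + ?k * (card (verts G) * (\<Delta> + 1) ^ (2 * ?k)) \<le>
            2 * (2 ^ ?k * (n' * (\<Delta> + 1) ^ (2 * ?k)))" by linarith
      qed simp
      also have "\<dots> = 2 * (n' * (4 * (\<Delta> + 1)\<^sup>2) ^ ?k)"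
      proof -
        have "(4::nat) ^ ?k = 2 ^ ?k * 2 ^ ?k" by (simp flip: power_mult_distrib)
        then show ?thesis by (simp add: power_mult_distrib power_mult)
      qed
      also have "\<dots> \<le> 2 * (n' * B ^ m)"
      proof -
        have "(4 * (\<Delta> + 1)\<^sup>2) ^ ?k \<le> B0 ^ ?k" by (intro power_mono) (simp_all add: B0_def)
        then show ?thesis using B0k by (intro mult_left_mono) auto
      qed
      finally show ?thesis .
    qed
    have M_ge: "3 * (n' * B ^ m) \<le> M" by (simp add: M_def)
    have "0 < n' * B ^ m" using Bm' by linarith
    then interpret machine "run_as_sub Q" M
      by unfold_locales (use M_ge in linarith)
    have "wp (run_as_sub Q) (Program C \<alpha>) (input n (adjacency G) 0 (complex_of_real \<epsilon>))
        (\<lambda>s' t. t \<le> (20 * \<alpha> + 5000) * M ^ 4 \<and>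
          outputs s' (map (inverse_power_sum (p G)) [1..<m + 1]))"
    proof (rule wp_Program[OF big G(1,2) assms \<epsilon> m_def])
      show "n < M" "m < M" "?k < M" "card ?F < M"
        using M_ge \<open>0 < n' * B ^ m\<close> n_le m_less k_less Bm' F_le by linarith+
      fix H d i assume H: "fin_graph H" "verts H = {..<d}" "d \<le> \<alpha> * i" "d \<le> ?k"
      obtain t where t: "t \<le> L * \<beta> ^ d" "run_as_sub Q d (adjacency H) i (lam H i) t"
        using L[OF H(1-3)] by blast
      have "1 * (\<beta> + 1) \<le> B0" unfolding B0_def by (rule mult_le_mono1) simp
      then have "\<beta> ^ d \<le> B0 ^ d" by (intro power_mono) auto
      also have "\<dots> \<le> B0 ^ ?k" using H(4) B0 by (intro power_increasing) auto
      finally have "\<beta> ^ d \<le> n' * B ^ m" using B0k Bm'(1) by linarith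
      then have "L * \<beta> ^ d \<le> (L + 3) * (n' * B ^ m)" by (intro mult_le_mono) auto
      then show "\<exists>t\<le>M. run_as_sub Q d (adjacency H) i (lam H i) t"
        using t unfolding M_def by (meson order_trans)
    qed
    then obtain t s where ts: "exec (run_as_sub Q) (Program C \<alpha>)
        (input n (adjacency G) 0 (complex_of_real \<epsilon>)) t s"
      "t \<le> (20 * \<alpha> + 5000) * M ^ 4" "outputs s (map (inverse_power_sum (p G)) [1..<m + 1])"
      unfolding wp_def by blast
    have X: "1 \<le> X"
      using \<epsilon> unfolding X_def by (simp add: le_divide_eq_1 min_le_iff_disj le_max_iff_disj)
    have "real n' \<le> X"
      using \<epsilon> frac_le[of "real (max n 1)" "real (max n 1)" "min \<epsilon> 1" 1] by (simp add: X_def n'_def)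
    moreover have "real (B ^ m) \<le> X ^ c"
      unfolding m_def X_def c_def using assms \<epsilon> B0 by (intro power_floor_ln_le) (auto simp: B_def)
    ultimately have "real n' * real (B ^ m) \<le> X * X ^ c" using X by (intro mult_mono) auto
    then have "real M \<le> real (L + 3) * X ^ (c + 1)"
      unfolding M_def of_nat_mult by (intro mult_left_mono) auto
    then have "real M ^ 4 \<le> (real (L + 3) * X ^ (c + 1)) ^ 4" by (intro power_mono) auto
    also have "\<dots> = real ((L + 3) ^ 4) * X ^ (4 * (c + 1))"
      by (simp only: power_mult_distrib of_nat_power power_mult[symmetric] mult.commute[of "c + 1" 4])
    finally have "real ((20 * \<alpha> + 5000) * M ^ 4) \<le>
        real (20 * \<alpha> + 5000) * (real ((L + 3) ^ 4) * X ^ (4 * (c + 1)))"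
      unfolding of_nat_mult of_nat_power by (intro mult_left_mono) auto
    also have "\<dots> = real a * X ^ (4 * (c + 1))" by (simp add: a_def)
    \<comment> \<open>\<open>K\<close> exceeds the factor \<open>a\<close> as well as the exponent
      \<open>4 * (c + 1)\<close>, and \<open>X\<close> is at least 1.\<close>
    also have "\<dots> \<le> real K * X ^ K"
      using X by (intro mult_mono power_increasing) (auto simp: K_def)
    finally have "real t \<le> real K * X ^ K" using ts(2) by linarith
    then show "\<exists>t s. exec (run_as_sub Q) (Program C \<alpha>)
          (input n (adjacency G) 0 (complex_of_real \<epsilon>)) t s \<and>
        real t \<le> real K * (real (max n 1) / min \<epsilon> 1) ^ K \<and>
        outputs s (map (inverse_power_sum (p G)) [1..<nat \<lfloor>C * ln (real n / \<epsilon>)\<rfloor> + 1])"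
      using ts(1,3) unfolding X_def m_def by blast
  qed
qed

end
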